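(* Let $\mathcal A$ be a small category and $G$ a crossed $\mathcal A$-group. The functor $$(\rtimes_G):\mathbf{Set}^{/G}_{\mathcal A}\times\mathbf{Set}^{/G}_{\mathcal A}\to\mathbf{Set}^{/G}_{\mathcal A}$$ is a monoidal structure on $\mathbf{Set}^{/G}_{\mathcal A}$ where the unit is the terminal $\mathcal A$-set $\ast$ with the unit map $\ast\to G$. Moreover, the monoidal structure is biclosed; i.e. there are functors $$\mathrm{Hom}^{\mathsf L}_G,\ \mathrm{Hom}^{\mathsf R}_G:(\mathbf{Set}^{/G}_{\mathcal A})^{\mathrm{op}}\times\mathbf{Set}^{/G}_{\mathcal A}\to\mathbf{Set}^{/G}_{\mathcal A}$$ together with natural isomorphisms $$\mathbf{Set}^{/G}_{\mathcal A}(X\rtimes_G Y,Z)\cong\mathbf{Set}^{/G}_{\mathcal A}(X,\mathrm{Hom}^{\mathsf R}_G(Y,Z))\cong\mathbf{Set}^{/G}_{\mathcal A}(Y,\mathrm{Hom}^{\mathsf L}_G(X,Z)).$$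
   Context: An $\mathcal A$-set is a presheaf of sets on $\mathcal A$; they form $\mathbf{Set}_{\mathcal A}$. A crossed $\mathcal A$-group is an $\mathcal A$-set $G$ together with a group structure on each $G(a)$ and a left action $G(b)\times\mathcal A(a,b)\to\mathcal A(a,b)$, $(x,\varphi)\mapsto\varphi^x$, of the group $G(b)$ for all $a,b$, such that: (i) $(\psi\varphi)^x=\psi^x\varphi^{\psi^\ast(x)}$ for $\varphi:a\to b$, $\psi:b\to c$, $x\in G(c)$; (ii) $\varphi^\ast(xy)=(\varphi^y)^\ast(x)\varphi^\ast(y)$ for $\varphi:a\to b$, $x,y\in G(b)$. $\mathbf{Set}^{/G}_{\mathcal A}$ is the category of $\mathcal A$-sets over the underlying $\mathcal A$-set of $G$. For $p:X\to G$ in it, $x\in X(b)$ and $\varphi:a\to b$, write $\varphi^x:=\varphi^{p(x)}$. For $p:X\to G$ and $q:Y\to G$, $X\rtimes_G Y$ is the $\mathcal A$-set with $(X\rtimes_G Y)(a)=X(a)\times Y(a)$ and $\varphi^\ast(x,y)=((\varphi^y)^\ast(x),\varphi^\ast(y))$, with structure map to $G$ given by $(x,y)\mapsto p(x)q(y)$; on morphisms it is the degreewise product. The associativity and unit isomorphisms are the degreewise canonical ones of cartesian products of sets. The unit map $\ast\to G$ picks out the unit of $G(a)$ for each $a$. *)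

theory Defs
  imports "HOL-Algebra.Group_Action" "HOL-Library.Equipollence"
begin

section \<open>Universes\<close>

text \<open>
  The sets in which presheaves take their values are the members of a Grothendieck universe.
  A type of this class is such a universe: its elements are the small sets, and
  \<open>elts\<close> sends a small set to the collection of its members. The axioms are extensionality
  and closure under subsets, unions, power sets and replacement along arbitrary functions
  (closure under unordered pairs follows). Neither infinity nor foundation is assumed, so that,
  besides the universes of ZFC, the hereditarily finite sets also qualify (where small means finite).
\<close>

class set_universe =
  fixes elts :: "'a \<Rightarrow> 'a set"
  assumes elts_inject: "elts x = elts y \<Longrightarrow> x = y"
    and elts_subset: "S \<subseteq> elts x \<Longrightarrow> S \<in> range elts"
    and elts_Union: "\<Union> (elts ` elts x) \<in> range elts"
    and elts_Pow: "{y. elts y \<subseteq> elts x} \<in> range elts"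
    and elts_replacement: "h ` elts x \<in> range elts"

definition mkset :: "'u::set_universe set \<Rightarrow> 'u"
  where "mkset = inv_into UNIV elts"

text \<open>Kuratowski pairs inside the universe.\<close>

definition vpair :: "'u::set_universe \<Rightarrow> 'u \<Rightarrow> 'u"
  where "vpair x y = mkset {mkset {x}, mkset {x, y}}"

definition vfst :: "'u::set_universe \<Rightarrow> 'u"
  where "vfst z = (THE x. \<exists>y. z = vpair x y)"

definition vsnd :: "'u::set_universe \<Rightarrow> 'u"
  where "vsnd z = (THE y. \<exists>x. z = vpair x y)"

definition vtimes :: "'u::set_universe set \<Rightarrow> 'u set \<Rightarrow> 'u set"
  where "vtimes S T = {vpair x y |x y. x \<in> S \<and> y \<in> T}"

section \<open>Categories\<close>

record ('o, 'm) cat =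
  Obj :: "'o set"
  Arr :: "'m set"
  Dom :: "'m \<Rightarrow> 'o"
  Cod :: "'m \<Rightarrow> 'o"
  Ide :: "'o \<Rightarrow> 'm"
  Cmp :: "'m \<Rightarrow> 'm \<Rightarrow> 'm"  (infixl \<open>\<cdot>\<index>\<close> 70)

definition homset :: "('o, 'm) cat \<Rightarrow> 'o \<Rightarrow> 'o \<Rightarrow> 'm set"
  where "homset C a b = {f \<in> Arr C. Dom C f = a \<and> Cod C f = b}"

locale category =
  fixes C :: "('o, 'm) cat" (structure)
  assumes Dom_in_Obj: "f \<in> Arr C \<Longrightarrow> Dom C f \<in> Obj C"
    and Cod_in_Obj: "f \<in> Arr C \<Longrightarrow> Cod C f \<in> Obj C"
    and Ide_in_homset: "a \<in> Obj C \<Longrightarrow> Ide C a \<in> homset C a a"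
    and Cmp_in_homset: "f \<in> homset C a b \<Longrightarrow> g \<in> homset C b c \<Longrightarrow> g \<cdot> f \<in> homset C a c"
    and Cmp_Ide_right: "f \<in> homset C a b \<Longrightarrow> f \<cdot> Ide C a = f"
    and Cmp_Ide_left: "f \<in> homset C a b \<Longrightarrow> Ide C b \<cdot> f = f"
    and Cmp_assoc: "f \<in> homset C a b \<Longrightarrow> g \<in> homset C b c \<Longrightarrow> h \<in> homset C c d
      \<Longrightarrow> (h \<cdot> g) \<cdot> f = h \<cdot> (g \<cdot> f)"

definition small_category :: "'u::set_universe itself \<Rightarrow> ('o, 'm) cat \<Rightarrow> bool"
  where "small_category U A \<longleftrightarrow> category A \<and>
    (\<exists>u::'u. Obj A \<approx> elts u) \<and> (\<exists>u::'u. Arr A \<approx> elts u)"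

definition op_cat :: "('o, 'm) cat \<Rightarrow> ('o, 'm) cat"
  where "op_cat C = \<lparr>Obj = Obj C, Arr = Arr C, Dom = Cod C, Cod = Dom C, Ide = Ide C,
    Cmp = (\<lambda>g f. f \<cdot>\<^bsub>C\<^esub> g)\<rparr>"

definition prod_cat :: "('o, 'm) cat \<Rightarrow> ('p, 'n) cat \<Rightarrow> ('o \<times> 'p, 'm \<times> 'n) cat"
    (infixr \<open>\<times>\<^sub>C\<close> 80)
  where "C \<times>\<^sub>C D = \<lparr>Obj = Obj C \<times> Obj D, Arr = Arr C \<times> Arr D,
    Dom = (\<lambda>(f, g). (Dom C f, Dom D g)), Cod = (\<lambda>(f, g). (Cod C f, Cod D g)),
    Ide = (\<lambda>(a, b). (Ide C a, Ide D b)),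
    Cmp = (\<lambda>(f', g') (f, g). (f' \<cdot>\<^bsub>C\<^esub> f, g' \<cdot>\<^bsub>D\<^esub> g))\<rparr>"

text \<open>All sets on a fixed type, with functions that are \<open>undefined\<close> outside their domain.\<close>

definition sets_cat :: "('m set, 'm set \<times> 'm set \<times> ('m \<Rightarrow> 'm)) cat"
  where "sets_cat = \<lparr>Obj = UNIV, Arr = {(S, T, h). h \<in> S \<rightarrow>\<^sub>E T},
    Dom = (\<lambda>(S, T, h). S), Cod = (\<lambda>(S, T, h). T),
    Ide = (\<lambda>S. (S, S, \<lambda>x\<in>S. x)),
    Cmp = (\<lambda>(S', T', k) (S, T, h). (S, T', compose S k h))\<rparr>"

text \<open>The objects of the slice over \<open>c\<close> are the arrows to \<open>c\<close>; an arrow from \<open>p\<close> to \<open>q\<close> is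
  recorded as \<open>(p, q, f)\<close>.\<close>

definition slice_cat :: "('o, 'm) cat \<Rightarrow> 'o \<Rightarrow> ('m, 'm \<times> 'm \<times> 'm) cat"
  where "slice_cat C c = \<lparr>Obj = {p \<in> Arr C. Cod C p = c},
    Arr = {(p, q, f). p \<in> Arr C \<and> Cod C p = c \<and> q \<in> Arr C \<and> Cod C q = c \<and>
      f \<in> homset C (Dom C p) (Dom C q) \<and> q \<cdot>\<^bsub>C\<^esub> f = p},
    Dom = (\<lambda>(p, q, f). p), Cod = (\<lambda>(p, q, f). q),
    Ide = (\<lambda>p. (p, p, Ide C (Dom C p))),
    Cmp = (\<lambda>(p', q', g) (p, q, f). (p, q', g \<cdot>\<^bsub>C\<^esub> f))\<rparr>"

definition terminal_object :: "('o, 'm) cat \<Rightarrow> 'o \<Rightarrow> bool"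
  where "terminal_object C t \<longleftrightarrow> t \<in> Obj C \<and> (\<forall>a\<in>Obj C. \<exists>!f. f \<in> homset C a t)"

definition iso_arrow :: "('o, 'm) cat \<Rightarrow> 'm \<Rightarrow> bool"
  where "iso_arrow C f \<longleftrightarrow> f \<in> Arr C \<and> (\<exists>g \<in> homset C (Cod C f) (Dom C f).
    g \<cdot>\<^bsub>C\<^esub> f = Ide C (Dom C f) \<and> f \<cdot>\<^bsub>C\<^esub> g = Ide C (Cod C f))"

section \<open>Functors and natural isomorphisms\<close>

record ('o, 'm, 'p, 'n) fctr =
  OMap :: "'o \<Rightarrow> 'p"
  AMap :: "'m \<Rightarrow> 'n"

definition is_functor :: "('o, 'm) cat \<Rightarrow> ('p, 'n) cat \<Rightarrow> ('o, 'm, 'p, 'n) fctr \<Rightarrow> bool"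
  where "is_functor C D F \<longleftrightarrow> category C \<and> category D \<and>
    (\<forall>a\<in>Obj C. OMap F a \<in> Obj D) \<and>
    (\<forall>f\<in>Arr C. AMap F f \<in> homset D (OMap F (Dom C f)) (OMap F (Cod C f))) \<and>
    (\<forall>a\<in>Obj C. AMap F (Ide C a) = Ide D (OMap F a)) \<and>
    (\<forall>f\<in>Arr C. \<forall>g\<in>Arr C. Dom C g = Cod C f \<longrightarrow>
      AMap F (g \<cdot>\<^bsub>C\<^esub> f) = AMap F g \<cdot>\<^bsub>D\<^esub> AMap F f)"

definition natural_iso :: "('o, 'm) cat \<Rightarrow> ('p, 'n) cat \<Rightarrow> ('o, 'm, 'p, 'n) fctr \<Rightarrow>
    ('o, 'm, 'p, 'n) fctr \<Rightarrow> ('o \<Rightarrow> 'n) \<Rightarrow> bool"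
  where "natural_iso C D F H t \<longleftrightarrow> is_functor C D F \<and> is_functor C D H \<and>
    (\<forall>a\<in>Obj C. t a \<in> homset D (OMap F a) (OMap H a) \<and> iso_arrow D (t a)) \<and>
    (\<forall>f\<in>Arr C. t (Cod C f) \<cdot>\<^bsub>D\<^esub> AMap F f = AMap H f \<cdot>\<^bsub>D\<^esub> t (Dom C f))"

definition naturally_isomorphic :: "('o, 'm) cat \<Rightarrow> ('p, 'n) cat \<Rightarrow> ('o, 'm, 'p, 'n) fctr \<Rightarrow>
    ('o, 'm, 'p, 'n) fctr \<Rightarrow> bool"
  where "naturally_isomorphic C D F H \<longleftrightarrow> (\<exists>t. natural_iso C D F H t)"

text \<open>The functor \<open>C(-, -)\<close> from \<open>op_cat C \<times>\<^sub>C C\<close> to \<open>sets_cat\<close>.\<close>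

definition hom_functor ::
    "('o, 'm) cat \<Rightarrow> ('o \<times> 'o, 'm \<times> 'm, 'm set, 'm set \<times> 'm set \<times> ('m \<Rightarrow> 'm)) fctr"
  where "hom_functor C = \<lparr>OMap = (\<lambda>(a, b). homset C a b),
    AMap = (\<lambda>(f, h). (homset C (Cod C f) (Dom C h), homset C (Dom C f) (Cod C h),
      \<lambda>u\<in>homset C (Cod C f) (Dom C h). h \<cdot>\<^bsub>C\<^esub> u \<cdot>\<^bsub>C\<^esub> f))\<rparr>"

section \<open>Monoidal and biclosed structures\<close>

locale monoidal_structure =
  fixes C :: "('o, 'm) cat" (structure)
    and T :: "('o \<times> 'o, 'm \<times> 'm, 'o, 'm) fctr"
    and I :: 'o
    and assoc :: "'o \<times> 'o \<times> 'o \<Rightarrow> 'm"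
    and lunit :: "'o \<Rightarrow> 'm"
    and runit :: "'o \<Rightarrow> 'm"
  assumes tensor_functor: "is_functor (C \<times>\<^sub>C C) C T"
    and unit_in_Obj: "I \<in> Obj C"
    and assoc_natural: "natural_iso (C \<times>\<^sub>C C \<times>\<^sub>C C) C
      \<lparr>OMap = (\<lambda>(x, y, z). OMap T (OMap T (x, y), z)),
       AMap = (\<lambda>(f, g, h). AMap T (AMap T (f, g), h))\<rparr>
      \<lparr>OMap = (\<lambda>(x, y, z). OMap T (x, OMap T (y, z))),
       AMap = (\<lambda>(f, g, h). AMap T (f, AMap T (g, h)))\<rparr> assoc"
    and lunit_natural: "natural_iso C C
      \<lparr>OMap = (\<lambda>x. OMap T (I, x)), AMap = (\<lambda>f. AMap T (Ide C I, f))\<rparr>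
      \<lparr>OMap = (\<lambda>x. x), AMap = (\<lambda>f. f)\<rparr> lunit"
    and runit_natural: "natural_iso C C
      \<lparr>OMap = (\<lambda>x. OMap T (x, I)), AMap = (\<lambda>f. AMap T (f, Ide C I))\<rparr>
      \<lparr>OMap = (\<lambda>x. x), AMap = (\<lambda>f. f)\<rparr> runit"
    and pentagon: "w \<in> Obj C \<Longrightarrow> x \<in> Obj C \<Longrightarrow> y \<in> Obj C \<Longrightarrow> z \<in> Obj C \<Longrightarrow>
      assoc (w, x, OMap T (y, z)) \<cdot> assoc (OMap T (w, x), y, z) =
      AMap T (Ide C w, assoc (x, y, z)) \<cdot> assoc (w, OMap T (x, y), z)
        \<cdot> AMap T (assoc (w, x, y), Ide C z)"
    and triangle: "x \<in> Obj C \<Longrightarrow> y \<in> Obj C \<Longrightarrow>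
      AMap T (Ide C x, lunit y) \<cdot> assoc (x, I, y) = AMap T (runit x, Ide C y)"

text \<open>For a bifunctor \<open>T\<close> on \<open>C\<close> and bifunctors \<open>HR\<close>, \<open>HL\<close> from \<open>op_cat C \<times>\<^sub>C C\<close> to \<open>C\<close>, the three
  functors \<open>C(T(X,Y), Z)\<close>, \<open>C(X, HR(Y,Z))\<close> and \<open>C(Y, HL(X,Z))\<close> of \<open>(X, Y, Z)\<close>, all from
  \<open>op_cat C \<times>\<^sub>C op_cat C \<times>\<^sub>C C\<close> to \<open>sets_cat\<close>.\<close>

definition hom_tensor :: "('o, 'm) cat \<Rightarrow> ('o \<times> 'o, 'm \<times> 'm, 'o, 'm) fctr \<Rightarrow>
    ('o \<times> 'o \<times> 'o, 'm \<times> 'm \<times> 'm, 'm set, 'm set \<times> 'm set \<times> ('m \<Rightarrow> 'm)) fctr"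
  where "hom_tensor C T = \<lparr>OMap = (\<lambda>(x, y, z). OMap (hom_functor C) (OMap T (x, y), z)),
    AMap = (\<lambda>(f, g, h). AMap (hom_functor C) (AMap T (f, g), h))\<rparr>"

definition hom_right :: "('o, 'm) cat \<Rightarrow> ('o \<times> 'o, 'm \<times> 'm, 'o, 'm) fctr \<Rightarrow>
    ('o \<times> 'o \<times> 'o, 'm \<times> 'm \<times> 'm, 'm set, 'm set \<times> 'm set \<times> ('m \<Rightarrow> 'm)) fctr"
  where "hom_right C HR = \<lparr>OMap = (\<lambda>(x, y, z). OMap (hom_functor C) (x, OMap HR (y, z))),
    AMap = (\<lambda>(f, g, h). AMap (hom_functor C) (f, AMap HR (g, h)))\<rparr>"

definition hom_left :: "('o, 'm) cat \<Rightarrow> ('o \<times> 'o, 'm \<times> 'm, 'o, 'm) fctr \<Rightarrow>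
    ('o \<times> 'o \<times> 'o, 'm \<times> 'm \<times> 'm, 'm set, 'm set \<times> 'm set \<times> ('m \<Rightarrow> 'm)) fctr"
  where "hom_left C HL = \<lparr>OMap = (\<lambda>(x, y, z). OMap (hom_functor C) (y, OMap HL (x, z))),
    AMap = (\<lambda>(f, g, h). AMap (hom_functor C) (g, AMap HL (f, h)))\<rparr>"

section \<open>Presheaves\<close>

record ('o, 'm, 'u) psh =
  At :: "'o \<Rightarrow> 'u set"
  Res :: "'m \<Rightarrow> 'u \<Rightarrow> 'u"

text \<open>Here and for morphisms, values outside \<open>A\<close> are required to be \<open>undefined\<close>, so that equality
  of the records is equality of presheaves on \<open>A\<close>, resp. of their morphisms.\<close>

locale presheaf =
  fixes A :: "('o, 'm) cat" (structure)
    and X :: "('o, 'm, 'u::set_universe) psh"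
  assumes At_extensional: "At X \<in> extensional (Obj A)"
    and Res_extensional: "Res X \<in> extensional (Arr A)"
    and At_small: "a \<in> Obj A \<Longrightarrow> At X a \<in> range elts"
    and Res_maps: "f \<in> homset A a b \<Longrightarrow> Res X f \<in> At X b \<rightarrow>\<^sub>E At X a"
    and Res_Ide: "a \<in> Obj A \<Longrightarrow> x \<in> At X a \<Longrightarrow> Res X (Ide A a) x = x"
    and Res_Cmp: "f \<in> homset A a b \<Longrightarrow> g \<in> homset A b c \<Longrightarrow> x \<in> At X c \<Longrightarrow>
      Res X (g \<cdot> f) x = Res X f (Res X g x)"

record ('o, 'm, 'u) psh_map =
  Src :: "('o, 'm, 'u) psh"
  Tgt :: "('o, 'm, 'u) psh"
  Map :: "'o \<Rightarrow> 'u \<Rightarrow> 'u"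

locale presheaf_map =
  fixes A :: "('o, 'm) cat" (structure)
    and t :: "('o, 'm, 'u::set_universe) psh_map"
  assumes Src_presheaf: "presheaf A (Src t)"
    and Tgt_presheaf: "presheaf A (Tgt t)"
    and Map_extensional: "Map t \<in> extensional (Obj A)"
    and Map_maps: "a \<in> Obj A \<Longrightarrow> Map t a \<in> At (Src t) a \<rightarrow>\<^sub>E At (Tgt t) a"
    and Map_natural: "f \<in> homset A a b \<Longrightarrow> x \<in> At (Src t) b \<Longrightarrow>
      Map t a (Res (Src t) f x) = Res (Tgt t) f (Map t b x)"

definition presheaf_cat ::
    "('o, 'm) cat \<Rightarrow> (('o, 'm, 'u::set_universe) psh, ('o, 'm, 'u) psh_map) cat"
  where "presheaf_cat A = \<lparr>Obj = {X. presheaf A X}, Arr = {t. presheaf_map A t},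
    Dom = Src, Cod = Tgt,
    Ide = (\<lambda>X. \<lparr>Src = X, Tgt = X, Map = (\<lambda>a\<in>Obj A. \<lambda>x\<in>At X a. x)\<rparr>),
    Cmp = (\<lambda>s t. \<lparr>Src = Src t, Tgt = Tgt s,
      Map = (\<lambda>a\<in>Obj A. compose (At (Src t) a) (Map s a) (Map t a))\<rparr>)\<rparr>"

definition terminal_psh :: "('o, 'm) cat \<Rightarrow> ('o, 'm, 'u::set_universe) psh"
  where "terminal_psh A = \<lparr>At = (\<lambda>a\<in>Obj A. {mkset {}}),
    Res = (\<lambda>f\<in>Arr A. \<lambda>x\<in>{mkset {}}. mkset {})\<rparr>"

section \<open>Crossed groups\<close>

text \<open>\<open>Act G x \<phi>\<close> is \<open>\<phi>\<^sup>x\<close>, for \<open>\<phi>\<close> with codomain \<open>b\<close> and \<open>x\<close> in \<open>G(b)\<close>.\<close>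

record ('o, 'm, 'u) crossed_grp =
  Und :: "('o, 'm, 'u) psh"
  Grp :: "'o \<Rightarrow> 'u monoid"
  Act :: "'u \<Rightarrow> 'm \<Rightarrow> 'm"

locale crossed_group =
  fixes A :: "('o, 'm) cat" (structure)
    and G :: "('o, 'm, 'u::set_universe) crossed_grp"
  assumes Und_presheaf: "presheaf A (Und G)"
    and Grp_group: "a \<in> Obj A \<Longrightarrow> group (Grp G a)"
    and Grp_carrier: "a \<in> Obj A \<Longrightarrow> carrier (Grp G a) = At (Und G) a"
    and Act_action: "a \<in> Obj A \<Longrightarrow> b \<in> Obj A \<Longrightarrow>
      group_action (Grp G b) (homset A a b) (\<lambda>x. \<lambda>\<phi>\<in>homset A a b. Act G x \<phi>)"
    and Act_Cmp: "\<phi> \<in> homset A a b \<Longrightarrow> \<psi> \<in> homset A b c \<Longrightarrow> x \<in> At (Und G) c \<Longrightarrow>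
      Act G x (\<psi> \<cdot> \<phi>) = Act G x \<psi> \<cdot> Act G (Res (Und G) \<psi> x) \<phi>"
    and Res_mult: "\<phi> \<in> homset A a b \<Longrightarrow> x \<in> At (Und G) b \<Longrightarrow> y \<in> At (Und G) b \<Longrightarrow>
      Res (Und G) \<phi> (x \<otimes>\<^bsub>Grp G b\<^esub> y) =
      Res (Und G) (Act G y \<phi>) x \<otimes>\<^bsub>Grp G a\<^esub> Res (Und G) \<phi> y"

section \<open>Presheaves over a crossed group\<close>

type_synonym ('o, 'm, 'u) over_obj = "('o, 'm, 'u) psh_map"
type_synonym ('o, 'm, 'u) over_arr =
  "('o, 'm, 'u) psh_map \<times> ('o, 'm, 'u) psh_map \<times> ('o, 'm, 'u) psh_map"

definition over_cat :: "('o, 'm) cat \<Rightarrow> ('o, 'm, 'u::set_universe) crossed_grp \<Rightarrow>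
    (('o, 'm, 'u) over_obj, ('o, 'm, 'u) over_arr) cat"
  where "over_cat A G = slice_cat (presheaf_cat A) (Und G)"

definition twist_psh :: "('o, 'm) cat \<Rightarrow> ('o, 'm, 'u::set_universe) crossed_grp \<Rightarrow>
    ('o, 'm, 'u) over_obj \<Rightarrow> ('o, 'm, 'u) over_obj \<Rightarrow> ('o, 'm, 'u) psh"
  where "twist_psh A G p q = \<lparr>
    At = (\<lambda>a\<in>Obj A. vtimes (At (Src p) a) (At (Src q) a)),
    Res = (\<lambda>\<phi>\<in>Arr A. \<lambda>z\<in>vtimes (At (Src p) (Cod A \<phi>)) (At (Src q) (Cod A \<phi>)).
      vpair (Res (Src p) (Act G (Map q (Cod A \<phi>) (vsnd z)) \<phi>) (vfst z))
            (Res (Src q) \<phi> (vsnd z)))\<rparr>"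

definition twist_obj :: "('o, 'm) cat \<Rightarrow> ('o, 'm, 'u::set_universe) crossed_grp \<Rightarrow>
    ('o, 'm, 'u) over_obj \<Rightarrow> ('o, 'm, 'u) over_obj \<Rightarrow> ('o, 'm, 'u) over_obj"
  where "twist_obj A G p q = \<lparr>Src = twist_psh A G p q, Tgt = Und G,
    Map = (\<lambda>a\<in>Obj A. \<lambda>z\<in>vtimes (At (Src p) a) (At (Src q) a).
      Map p a (vfst z) \<otimes>\<^bsub>Grp G a\<^esub> Map q a (vsnd z))\<rparr>"

definition twist_arr :: "('o, 'm) cat \<Rightarrow> ('o, 'm, 'u::set_universe) crossed_grp \<Rightarrow>
    ('o, 'm, 'u) over_arr \<Rightarrow> ('o, 'm, 'u) over_arr \<Rightarrow> ('o, 'm, 'u) over_arr"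
  where "twist_arr A G = (\<lambda>(p, p', f) (q, q', g). (twist_obj A G p q, twist_obj A G p' q',
    \<lparr>Src = twist_psh A G p q, Tgt = twist_psh A G p' q',
     Map = (\<lambda>a\<in>Obj A. \<lambda>z\<in>vtimes (At (Src p) a) (At (Src q) a).
       vpair (Map f a (vfst z)) (Map g a (vsnd z)))\<rparr>))"

definition twist :: "('o, 'm) cat \<Rightarrow> ('o, 'm, 'u::set_universe) crossed_grp \<Rightarrow>
    (('o, 'm, 'u) over_obj \<times> ('o, 'm, 'u) over_obj,
     ('o, 'm, 'u) over_arr \<times> ('o, 'm, 'u) over_arr,
     ('o, 'm, 'u) over_obj, ('o, 'm, 'u) over_arr) fctr"
  where "twist A G = \<lparr>OMap = (\<lambda>(p, q). twist_obj A G p q),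
    AMap = (\<lambda>(f, g). twist_arr A G f g)\<rparr>"

definition unit_obj :: "('o, 'm) cat \<Rightarrow> ('o, 'm, 'u::set_universe) crossed_grp \<Rightarrow>
    ('o, 'm, 'u) over_obj"
  where "unit_obj A G = \<lparr>Src = terminal_psh A, Tgt = Und G,
    Map = (\<lambda>a\<in>Obj A. \<lambda>x\<in>{mkset {}}. \<one>\<^bsub>Grp G a\<^esub>)\<rparr>"

text \<open>The canonical bijections \<open>((x, y), z) \<mapsto> (x, (y, z))\<close>, \<open>(*, x) \<mapsto> x\<close> and \<open>(x, *) \<mapsto> x\<close>.\<close>

definition twist_assoc :: "('o, 'm) cat \<Rightarrow> ('o, 'm, 'u::set_universe) crossed_grp \<Rightarrow>
    ('o, 'm, 'u) over_obj \<times> ('o, 'm, 'u) over_obj \<times> ('o, 'm, 'u) over_obj \<Rightarrow>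
    ('o, 'm, 'u) over_arr"
  where "twist_assoc A G = (\<lambda>(p, q, r).
    (twist_obj A G (twist_obj A G p q) r, twist_obj A G p (twist_obj A G q r),
     \<lparr>Src = twist_psh A G (twist_obj A G p q) r, Tgt = twist_psh A G p (twist_obj A G q r),
      Map = (\<lambda>a\<in>Obj A. \<lambda>z\<in>vtimes (vtimes (At (Src p) a) (At (Src q) a)) (At (Src r) a).
        vpair (vfst (vfst z)) (vpair (vsnd (vfst z)) (vsnd z)))\<rparr>))"

definition twist_lunit :: "('o, 'm) cat \<Rightarrow> ('o, 'm, 'u::set_universe) crossed_grp \<Rightarrow>
    ('o, 'm, 'u) over_obj \<Rightarrow> ('o, 'm, 'u) over_arr"
  where "twist_lunit A G = (\<lambda>p. (twist_obj A G (unit_obj A G) p, p,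
    \<lparr>Src = twist_psh A G (unit_obj A G) p, Tgt = Src p,
     Map = (\<lambda>a\<in>Obj A. \<lambda>z\<in>vtimes {mkset {}} (At (Src p) a). vsnd z)\<rparr>))"

definition twist_runit :: "('o, 'm) cat \<Rightarrow> ('o, 'm, 'u::set_universe) crossed_grp \<Rightarrow>
    ('o, 'm, 'u) over_obj \<Rightarrow> ('o, 'm, 'u) over_arr"
  where "twist_runit A G = (\<lambda>p. (twist_obj A G p (unit_obj A G), p,
    \<lparr>Src = twist_psh A G p (unit_obj A G), Tgt = Src p,
     Map = (\<lambda>a\<in>Obj A. \<lambda>z\<in>vtimes (At (Src p) a) {mkset {}}. vfst z)\<rparr>))"

end

theory Submission
  imports Defs
begin

text \<open>
  All monoidal axioms are checked elementwise; that \<open>X \<rtimes>\<^sub>G Y\<close> is a presheaf is axiom (i)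
  of a crossed group, that its structure map is natural is axiom (ii), and associativity is
  \<open>\<phi>\<^sup>x\<^sup>y = (\<phi>\<^sup>y)\<^sup>x\<close>. For closedness it suffices to give each functor
  \<open>- \<rtimes>\<^sub>G Y\<close> and \<open>X \<rtimes>\<^sub>G -\<close> a universal arrow to every \<open>Z\<close>. Since objects over \<open>G\<close> are presheaves
  on the elements of \<open>G\<close>, the Yoneda lemma dictates the internal homs: over \<open>g \<in> G(b)\<close> they consist
  of the morphisms over \<open>G\<close> from \<open>A(-, b) \<rtimes>\<^sub>G Y\<close>, resp. \<open>X \<rtimes>\<^sub>G A(-, b)\<close>, to \<open>Z\<close>, where \<open>A(-, b)\<close> lies
  over \<open>G\<close> by \<open>\<alpha> \<mapsto> \<alpha>\<^sup>*(g)\<close>. Smallness of \<open>A\<close> makes these collections small, hence equipotent to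
  members of the universe.
\<close>

text \<open>Nothing in the axioms of a crossed group says that the action fixes identities or that
  restriction preserves group units. The first is needed for the identity law of
  \<open>X \<rtimes>\<^sub>G Y\<close>, the second for naturality of the unit map; both are
  extracted from (i) and (ii) by using that the values of G are groups. Universal arrows suffice
  because an arrow into an internal hom is determined by its composite with evaluation. This forces
  the action of the internal hom on arrows, and every functoriality or naturality claim becomes a
  comparison of such composites. The arrows of A have their own type and need not be members of the
  universe, so \<open>A(-, b)\<close> is not literally an object over G. The morphisms out of it are
  handled as functions of an external type, and only the small collection that they form is coded
  into the universe. In \<open>X \<rtimes>\<^sub>G Y\<close> it is always the first factor that is
  twisted. Hence the right hom twists the representable presheaf and the left hom twists the fixed
  object X; one construction with two twist parameters covers both.\<close>

section \<open>Small sets\<close>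

lemma elts_mkset: "S \<in> range elts \<Longrightarrow> elts (mkset S) = S"
  unfolding mkset_def by (rule f_inv_into_f)

lemma small_subset: "T \<in> range elts \<Longrightarrow> S \<subseteq> T \<Longrightarrow> S \<in> range elts"
  using elts_subset by blast

lemma small_image: "S \<in> range elts \<Longrightarrow> h ` S \<in> range elts"
  for h :: "'u::set_universe \<Rightarrow> 'u"
  using elts_replacement by blast

text \<open>Types are inhabited, so the universe has some member, and the empty set is a subset of
  it.\<close>

lemma small_empty: "{} \<in> range (elts :: 'u::set_universe \<Rightarrow> 'u set)"
  by (rule elts_subset[of _ undefined]) simp

text \<open>Pairing comes from power sets and replacement: two successive power sets of the empty
  set give a set with two distinct members, and replacement sends these to \<open>x\<close> and
  \<open>y\<close>.\<close>

lemma small_doubleton: "{x, y} \<in> range (elts :: 'u::set_universe \<Rightarrow> 'u set)"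
proof -
  define e :: 'u where "e = mkset {}"
  have e: "elts e = {}"
    unfolding e_def by (rule elts_mkset[OF small_empty])
  have "{z. elts z \<subseteq> elts e} = {e}"
    using elts_inject[of _ e] by (auto simp: e)
  then obtain v :: 'u where v: "elts v = {e}"
    using elts_Pow[of e] by auto
  have "{z. elts z \<subseteq> elts v} = {e, v}"
    using e v elts_inject by (auto simp: subset_singleton_iff) blast+
  then have "{e, v} \<in> range elts"
    using elts_Pow[of v] by simp
  from small_image[OF this, of "\<lambda>z. if z = e then x else y"] show ?thesis
    using e v by (auto simp: image_def insert_commute split: if_splits)
qed

lemma small_singleton: "{x} \<in> range (elts :: 'u::set_universe \<Rightarrow> 'u set)"
  using small_doubleton[of x x] by simp

text \<open>The union axiom concerns the members of one member of the universe, so the family is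
  turned into such a member: replacement collects the codes \<open>mkset (F x)\<close>.\<close>

lemma small_UN:
  fixes F :: "'u::set_universe \<Rightarrow> 'u set"
  assumes "S \<in> range elts" and "\<And>x. x \<in> S \<Longrightarrow> F x \<in> range elts"
  shows "(\<Union>x\<in>S. F x) \<in> range elts"
proof -
  obtain v where v: "elts v = (\<lambda>x. mkset (F x)) ` S"
    using small_image[OF assms(1)] by (metis imageE)
  have "\<Union> (elts ` elts v) = (\<Union>x\<in>S. F x)"
    using assms(2) by (auto simp: v elts_mkset)
  then show ?thesis
    using elts_Union[of v] by simp
qed

section \<open>Pairs inside the universe\<close>

lemma mkset_inject:
  "S \<in> range elts \<Longrightarrow> T \<in> range elts \<Longrightarrow> mkset S = mkset T \<longleftrightarrow> S = T"
  by (metis elts_mkset)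

lemma vpair_inject [simp]: "vpair x y = vpair x' y' \<longleftrightarrow> x = x' \<and> y = y'"
  by (auto simp: vpair_def mkset_inject small_doubleton small_singleton doubleton_eq_iff)

lemma vfst_vpair [simp]: "vfst (vpair x y) = x"
  unfolding vfst_def by auto

lemma vsnd_vpair [simp]: "vsnd (vpair x y) = y"
  unfolding vsnd_def by auto

lemma vpair_in_vtimes [simp]: "vpair x y \<in> vtimes S T \<longleftrightarrow> x \<in> S \<and> y \<in> T"
  unfolding vtimes_def by auto

lemma vtimesE [elim!]:
  assumes "z \<in> vtimes S T"
  obtains x y where "z = vpair x y" "x \<in> S" "y \<in> T"
  using assms unfolding vtimes_def by auto

lemma small_vtimes:
  assumes "S \<in> range elts" and "T \<in> range elts"
  shows "vtimes S T \<in> range elts"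
proof -
  have "vtimes S T = (\<Union>x\<in>S. vpair x ` T)"
    unfolding vtimes_def by auto
  then show ?thesis
    using small_UN[OF assms(1)] small_image[OF assms(2)] by simp
qed

text \<open>Smallness for sets of any type: a copy of the set lies in the universe
  \<open>'u\<close>. It is needed because the elements of the internal homs are functions, which are
  not themselves elements of \<open>'u\<close>.\<close>

definition small :: "'u::set_universe itself \<Rightarrow> 'a set \<Rightarrow> bool"
  where "small U S \<longleftrightarrow> (\<exists>f :: 'a \<Rightarrow> 'u. inj_on f S \<and> f ` S \<in> range elts)"

text \<open>An injection into a member of the universe is enough, since subsets of members are again
  members.\<close>

lemma smallI_lepoll:
  fixes f :: "'a \<Rightarrow> 'u::set_universe"
  assumes "inj_on f S" and "f ` S \<subseteq> T" and "T \<in> range elts"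
  shows "small TYPE('u) S"
  unfolding small_def using assms(1) small_subset[OF assms(3,2)] by (intro exI conjI)

lemma small_if_eqpoll: "S \<approx> elts u \<Longrightarrow> small TYPE('u) S"
  for u :: "'u::set_universe"
  unfolding eqpoll_def bij_betw_def small_def by auto

lemma small_if_range: "S \<in> range elts \<Longrightarrow> small TYPE('u) S"
  for S :: "'u::set_universe set"
  unfolding small_def by (auto intro!: exI[of _ id])

lemma small_inj_image:
  fixes U :: "'u::set_universe itself"
  assumes "inj_on g S" and "g ` S \<subseteq> T" and "small U T"
  shows "small U S"
proof -
  obtain f :: "'b \<Rightarrow> 'u" where f: "inj_on f T" "f ` T \<in> range elts"
    using assms(3) unfolding small_def by blast
  have "inj_on (f \<circ> g) S"
    using assms(1) inj_on_subset[OF f(1) assms(2)] by (rule comp_inj_on)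
  moreover have "(f \<circ> g) ` S \<in> range elts"
    unfolding image_comp[symmetric] using f(2) image_mono[OF assms(2)] by (rule small_subset)
  ultimately show ?thesis
    unfolding small_def by blast
qed

lemma small_mono: "small U T \<Longrightarrow> S \<subseteq> T \<Longrightarrow> small U S"
  by (rule small_inj_image[of id]) auto

lemma small_Times:
  fixes U :: "'u::set_universe itself"
  assumes "small U S" and "small U T"
  shows "small U (S \<times> T)"
proof -
  obtain f :: "'a \<Rightarrow> 'u" and g :: "'b \<Rightarrow> 'u"
    where "inj_on f S" "f ` S \<in> range elts" "inj_on g T" "g ` T \<in> range elts"
    using assms unfolding small_def by blast
  moreover from this have "inj_on (\<lambda>(x, y). vpair (f x) (g y)) (S \<times> T)"
    by (auto simp: inj_on_def)
  ultimately have "small TYPE('u) (S \<times> T)"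
    by (intro smallI_lepoll[of "\<lambda>(x, y). vpair (f x) (g y)" _ "vtimes (f ` S) (g ` T)"] small_vtimes)
      (auto intro!: imageI simp del: imageE)
  then show ?thesis
    by (simp add: small_def)
qed

text \<open>A subset of \<open>S\<close> is coded by the universe element that collects its image
  under \<open>f\<close>; all these codes lie in the power set of \<open>elts u\<close>.\<close>

lemma small_Pow:
  fixes U :: "'u::set_universe itself"
  assumes "small U S"
  shows "small U (Pow S)"
proof -
  obtain f :: "'a \<Rightarrow> 'u" and u where f: "inj_on f S" "f ` S = elts u"
    using assms unfolding small_def by auto
  have sm: "f ` X \<in> range elts" if "X \<subseteq> S" for X
    using f(2) that by (metis elts_subset image_mono)
  have "inj_on (\<lambda>X. mkset (f ` X)) (Pow S)"
    using f(1) by (auto intro!: inj_onI simp: mkset_inject sm inj_on_image_eq_iff)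
  moreover have "(\<lambda>X. mkset (f ` X)) ` Pow S \<subseteq> {y. elts y \<subseteq> elts u}"
    unfolding f(2)[symmetric] by (auto simp: elts_mkset sm intro!: imageI)
  ultimately have "small TYPE('u) (Pow S)"
    using elts_Pow by (rule smallI_lepoll)
  then show ?thesis
    by (simp add: small_def)
qed

text \<open>A function that is \<open>undefined\<close> off \<open>S\<close> is determined by its
  graph, so the function space embeds in the power set of \<open>S \<times> T\<close>.\<close>

lemma small_PiE:
  assumes "small U S" and "small U T"
  shows "small U (S \<rightarrow>\<^sub>E T)"
proof (rule small_inj_image)
  show "inj_on (\<lambda>h. (\<lambda>x. (x, h x)) ` S) (S \<rightarrow>\<^sub>E T)"
  proof (rule inj_onI)
    fix h k assume h: "h \<in> S \<rightarrow>\<^sub>E T" and k: "k \<in> S \<rightarrow>\<^sub>E T"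
      and eq: "(\<lambda>x. (x, h x)) ` S = (\<lambda>x. (x, k x)) ` S"
    from h k show "h = k"
    proof (rule PiE_ext)
      fix x assume "x \<in> S"
      then have "(x, h x) \<in> (\<lambda>x. (x, k x)) ` S"
        unfolding eq[symmetric] by (rule imageI)
      then show "h x = k x"
        by auto
    qed
  qed
  show "(\<lambda>h. (\<lambda>x. (x, h x)) ` S) ` (S \<rightarrow>\<^sub>E T) \<subseteq> Pow (S \<times> T)"
    by auto
  show "small U (Pow (S \<times> T))"
    using assms by (intro small_Pow small_Times)
qed

text \<open>The index set may have any type; its coding moves it into the universe, where
  \<open>small_UN\<close> applies.\<close>

lemma small_UN_external:
  fixes F :: "'a \<Rightarrow> 'u::set_universe set"
  assumes "small TYPE('u) S" and "\<And>x. x \<in> S \<Longrightarrow> F x \<in> range elts"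
  shows "small TYPE('u) (\<Union>x\<in>S. F x)"
proof (rule small_if_range)
  obtain f :: "'a \<Rightarrow> 'u" where f: "inj_on f S" "f ` S \<in> range elts"
    using assms unfolding small_def by blast
  have "(\<Union>x\<in>S. F x) = (\<Union>y\<in>f ` S. F (inv_into S f y))"
    using f(1) by simp
  also have "\<dots> \<in> range elts"
    using f(2) by (rule small_UN) (metis assms(2) inv_into_into)
  finally show "(\<Union>x\<in>S. F x) \<in> range elts" .
qed

section \<open>Categories and functors\<close>

lemma Arr_in_homset: "f \<in> Arr C \<Longrightarrow> f \<in> homset C (Dom C f) (Cod C f)"
  by (simp add: homset_def)

lemma homset_iff: "f \<in> homset C a b \<longleftrightarrow> f \<in> Arr C \<and> Dom C f = a \<and> Cod C f = b"
  by (simp add: homset_def)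

context category
begin

lemma homset_Obj:
  assumes "f \<in> homset C a b"
  shows "a \<in> Obj C" and "b \<in> Obj C"
  using assms Dom_in_Obj Cod_in_Obj by (auto simp: homset_iff)

lemma category_op: "category (op_cat C)"
  by unfold_locales
    (auto simp: op_cat_def homset_iff Dom_in_Obj Cod_in_Obj Ide_in_homset[unfolded homset_iff]
      Cmp_in_homset[unfolded homset_iff] Cmp_Ide_right[unfolded homset_iff]
      Cmp_Ide_left[unfolded homset_iff] Cmp_assoc[unfolded homset_iff])

end

lemma category_prod:
  assumes "category C" and "category D"
  shows "category (C \<times>\<^sub>C D)"
proof -
  interpret C: category C by fact
  interpret D: category D by fact
  show ?thesis
    by unfold_locales
      (auto simp: prod_cat_def homset_iff C.Dom_in_Obj C.Cod_in_Obj C.Ide_in_homset[unfolded homset_iff]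
      C.Cmp_in_homset[unfolded homset_iff] C.Cmp_Ide_right[unfolded homset_iff]
      C.Cmp_Ide_left[unfolded homset_iff] C.Cmp_assoc[unfolded homset_iff]
      D.Dom_in_Obj D.Cod_in_Obj D.Ide_in_homset[unfolded homset_iff]
      D.Cmp_in_homset[unfolded homset_iff] D.Cmp_Ide_right[unfolded homset_iff]
      D.Cmp_Ide_left[unfolded homset_iff] D.Cmp_assoc[unfolded homset_iff])
qed

lemma category_sets: "category sets_cat"
  by unfold_locales
    (auto simp: sets_cat_def homset_iff compose_def restrict_def PiE_iff extensional_def fun_eq_iff)

lemma homset_slice_iff:
  "F \<in> homset (slice_cat C c) p q \<longleftrightarrow> (\<exists>f. F = (p, q, f) \<and> p \<in> Arr C \<and> Cod C p = c \<and>
    q \<in> Arr C \<and> Cod C q = c \<and> f \<in> homset C (Dom C p) (Dom C q) \<and> q \<cdot>\<^bsub>C\<^esub> f = p)"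
  by (auto simp: homset_def slice_cat_def)

lemma Cmp_slice: "(p', q', g) \<cdot>\<^bsub>slice_cat C c\<^esub> (p, q, f) = (p, q', g \<cdot>\<^bsub>C\<^esub> f)"
  by (simp add: slice_cat_def)

lemma Ide_slice: "Ide (slice_cat C c) p = (p, p, Ide C (Dom C p))"
  by (simp add: slice_cat_def)

lemma category_slice:
  assumes "category C"
  shows "category (slice_cat C c)"
proof -
  interpret category C by fact
  have assoc: "p'' \<cdot>\<^bsub>C\<^esub> (g \<cdot>\<^bsub>C\<^esub> f) = p"
    if "p'' \<in> Arr C" "g \<in> homset C (Dom C p') (Dom C p'')" "p'' \<cdot>\<^bsub>C\<^esub> g = p'"
      "f \<in> homset C (Dom C p) (Dom C p')" "p' \<cdot>\<^bsub>C\<^esub> f = p" for p p' p'' f g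
    using Cmp_assoc[OF that(4,2) Arr_in_homset[OF that(1)]] that by simp
  show ?thesis
  proof unfold_locales
    fix F assume "F \<in> Arr (slice_cat C c)"
    then show "Dom (slice_cat C c) F \<in> Obj (slice_cat C c)" "Cod (slice_cat C c) F \<in> Obj (slice_cat C c)"
      by (auto simp: slice_cat_def)
  next
    fix p assume "p \<in> Obj (slice_cat C c)"
    then have "p \<in> homset C (Dom C p) c"
      by (simp add: slice_cat_def homset_iff)
    then show "Ide (slice_cat C c) p \<in> homset (slice_cat C c) p p"
      using Ide_in_homset[OF homset_Obj(1)] Cmp_Ide_right
      by (auto simp: homset_slice_iff homset_iff slice_cat_def)
  qed (auto simp: homset_slice_iff Cmp_slice assoc Ide_slice
        intro: Cmp_Ide_right Cmp_Ide_left Cmp_assoc Cmp_in_homset)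
qed

section \<open>Composing functors; composing and inverting natural isomorphisms\<close>

definition comp_functor ::
    "('p, 'n, 'q, 'k) fctr \<Rightarrow> ('o, 'm, 'p, 'n) fctr \<Rightarrow> ('o, 'm, 'q, 'k) fctr"
  where "comp_functor F K = \<lparr>OMap = (\<lambda>a. OMap F (OMap K a)), AMap = (\<lambda>f. AMap F (AMap K f))\<rparr>"

lemma is_functorD:
  assumes "is_functor C D F"
  shows "category C" and "category D"
    and "a \<in> Obj C \<Longrightarrow> OMap F a \<in> Obj D"
    and "f \<in> homset C a b \<Longrightarrow> AMap F f \<in> homset D (OMap F a) (OMap F b)"
    and "a \<in> Obj C \<Longrightarrow> AMap F (Ide C a) = Ide D (OMap F a)"
    and "f \<in> homset C a b \<Longrightarrow> g \<in> homset C b c \<Longrightarrow>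
      AMap F (g \<cdot>\<^bsub>C\<^esub> f) = AMap F g \<cdot>\<^bsub>D\<^esub> AMap F f"
  using assms unfolding is_functor_def by (auto simp: homset_iff)

lemma is_functorI:
  assumes "category C" and "category D"
    and "\<And>a. a \<in> Obj C \<Longrightarrow> OMap F a \<in> Obj D"
    and "\<And>f a b. f \<in> homset C a b \<Longrightarrow> AMap F f \<in> homset D (OMap F a) (OMap F b)"
    and "\<And>a. a \<in> Obj C \<Longrightarrow> AMap F (Ide C a) = Ide D (OMap F a)"
    and "\<And>f g a b c. f \<in> homset C a b \<Longrightarrow> g \<in> homset C b c \<Longrightarrow>
      AMap F (g \<cdot>\<^bsub>C\<^esub> f) = AMap F g \<cdot>\<^bsub>D\<^esub> AMap F f"
  shows "is_functor C D F"
  unfolding is_functor_def using assms Arr_in_homset by metis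

lemma is_functor_comp:
  assumes "is_functor B C K" and "is_functor C D F"
  shows "is_functor B D (comp_functor F K)"
proof -
  note K = is_functorD[OF assms(1)] and F = is_functorD[OF assms(2)]
  show ?thesis
    unfolding comp_functor_def
  proof (rule is_functorI)
    fix f g a b c assume "f \<in> homset B a b" "g \<in> homset B b c"
    then show "AMap \<lparr>OMap = \<lambda>a. OMap F (OMap K a), AMap = \<lambda>f. AMap F (AMap K f)\<rparr> (g \<cdot>\<^bsub>B\<^esub> f) =
      AMap \<lparr>OMap = \<lambda>a. OMap F (OMap K a), AMap = \<lambda>f. AMap F (AMap K f)\<rparr> g \<cdot>\<^bsub>D\<^esub>
      AMap \<lparr>OMap = \<lambda>a. OMap F (OMap K a), AMap = \<lambda>f. AMap F (AMap K f)\<rparr> f"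
      by (simp add: K(6) F(6)[OF K(4) K(4)])
  qed (simp_all add: K(1,3,5) F(2,3,5) F(4)[OF K(4)])
qed

lemma natural_isoD:
  assumes "natural_iso C D F H t"
  shows "is_functor C D F" and "is_functor C D H"
    and "a \<in> Obj C \<Longrightarrow> t a \<in> homset D (OMap F a) (OMap H a)"
    and "a \<in> Obj C \<Longrightarrow> iso_arrow D (t a)"
    and "f \<in> homset C a b \<Longrightarrow> t b \<cdot>\<^bsub>D\<^esub> AMap F f = AMap H f \<cdot>\<^bsub>D\<^esub> t a"
  using assms unfolding natural_iso_def by (auto simp: homset_iff)

lemma natural_isoI:
  assumes "is_functor C D F" and "is_functor C D H"
    and "\<And>a. a \<in> Obj C \<Longrightarrow> t a \<in> homset D (OMap F a) (OMap H a)"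
    and "\<And>a. a \<in> Obj C \<Longrightarrow> iso_arrow D (t a)"
    and "\<And>f a b. f \<in> homset C a b \<Longrightarrow> t b \<cdot>\<^bsub>D\<^esub> AMap F f = AMap H f \<cdot>\<^bsub>D\<^esub> t a"
  shows "natural_iso C D F H t"
  unfolding natural_iso_def using assms Arr_in_homset by metis

text \<open>Whiskering on the source side; it allows the variables of a natural isomorphism to be
  permuted.\<close>

lemma natural_iso_comp_functor:
  assumes "natural_iso C D F H t" and "is_functor B C K"
  shows "natural_iso B D (comp_functor F K) (comp_functor H K) (\<lambda>a. t (OMap K a))"
proof (rule natural_isoI)
  show "is_functor B D (comp_functor F K)" "is_functor B D (comp_functor H K)"
    using assms by (auto intro: is_functor_comp natural_isoD)
qed (use natural_isoD[OF assms(1)] is_functorD[OF assms(2)] in \<open>auto simp: comp_functor_def\<close>)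

text \<open>Pointwise inverses of a natural family are natural: compose each naturality square with
  the inverses on both sides.\<close>

lemma naturally_isomorphic_sym:
  assumes "naturally_isomorphic C D F H"
  shows "naturally_isomorphic C D H F"
proof -
  obtain t where t: "natural_iso C D F H t"
    using assms unfolding naturally_isomorphic_def by blast
  note tD = natural_isoD[OF t] and FD = is_functorD[OF natural_isoD(1)[OF t]]
    and HD = is_functorD[OF natural_isoD(2)[OF t]]
  interpret D: category D using FD by simp
  have "\<exists>s. s \<in> homset D (OMap H a) (OMap F a) \<and> s \<cdot>\<^bsub>D\<^esub> t a = Ide D (OMap F a) \<and>
      t a \<cdot>\<^bsub>D\<^esub> s = Ide D (OMap H a)" if "a \<in> Obj C" for a
    using tD(3,4)[OF that] unfolding iso_arrow_def by (auto simp: homset_iff)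
  then obtain s where s: "\<And>a. a \<in> Obj C \<Longrightarrow> s a \<in> homset D (OMap H a) (OMap F a)"
    and st: "\<And>a. a \<in> Obj C \<Longrightarrow> s a \<cdot>\<^bsub>D\<^esub> t a = Ide D (OMap F a)"
    and ts: "\<And>a. a \<in> Obj C \<Longrightarrow> t a \<cdot>\<^bsub>D\<^esub> s a = Ide D (OMap H a)"
    by metis
  have "natural_iso C D H F s"
  proof (rule natural_isoI)
    fix a assume "a \<in> Obj C"
    then show "iso_arrow D (s a)"
      using s[of a] tD(3)[of a] st ts unfolding iso_arrow_def
      by (auto simp: homset_iff intro!: bexI[of _ "t a"])
  next
    fix f a b assume f: "f \<in> homset C a b"
    interpret C: category C using FD by simp
    note ab = C.homset_Obj[OF f]
    have "s b \<cdot>\<^bsub>D\<^esub> AMap H f = s b \<cdot>\<^bsub>D\<^esub> (AMap H f \<cdot>\<^bsub>D\<^esub> (t a \<cdot>\<^bsub>D\<^esub> s a))"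
      by (metis D.Cmp_Ide_right HD(4) ab(1) f ts)
    also have "\<dots> = s b \<cdot>\<^bsub>D\<^esub> ((AMap H f \<cdot>\<^bsub>D\<^esub> t a) \<cdot>\<^bsub>D\<^esub> s a)"
      by (simp add: D.Cmp_assoc[OF s[OF ab(1)] tD(3)[OF ab(1)] HD(4)[OF f]])
    also have "\<dots> = s b \<cdot>\<^bsub>D\<^esub> ((t b \<cdot>\<^bsub>D\<^esub> AMap F f) \<cdot>\<^bsub>D\<^esub> s a)"
      by (simp add: tD(5)[OF f])
    also have "\<dots> = s b \<cdot>\<^bsub>D\<^esub> (t b \<cdot>\<^bsub>D\<^esub> (AMap F f \<cdot>\<^bsub>D\<^esub> s a))"
      by (simp add: D.Cmp_assoc[OF s[OF ab(1)] FD(4)[OF f] tD(3)[OF ab(2)]])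
    also have "\<dots> = (s b \<cdot>\<^bsub>D\<^esub> t b) \<cdot>\<^bsub>D\<^esub> (AMap F f \<cdot>\<^bsub>D\<^esub> s a)"
      using D.Cmp_assoc[OF D.Cmp_in_homset[OF s[OF ab(1)] FD(4)[OF f]] tD(3)[OF ab(2)] s[OF ab(2)]]
      by simp
    also have "\<dots> = AMap F f \<cdot>\<^bsub>D\<^esub> s a"
      using D.Cmp_Ide_left[OF D.Cmp_in_homset[OF s[OF ab(1)] FD(4)[OF f]]] st[OF ab(2)] by simp
    finally show "s b \<cdot>\<^bsub>D\<^esub> AMap H f = AMap F f \<cdot>\<^bsub>D\<^esub> s a" .
  qed (use tD(1,2) s in auto)
  then show ?thesis
    unfolding naturally_isomorphic_def by blast
qed

lemma (in category) iso_arrow_Cmp: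
  assumes f: "f \<in> homset C a b" "iso_arrow C f" and g: "g \<in> homset C b c" "iso_arrow C g"
  shows "iso_arrow C (g \<cdot> f)"
proof -
  obtain f' where f': "f' \<in> homset C b a" "f' \<cdot> f = Ide C a" "f \<cdot> f' = Ide C b"
    using f unfolding iso_arrow_def by (auto simp: homset_iff)
  obtain g' where g': "g' \<in> homset C c b" "g' \<cdot> g = Ide C b" "g \<cdot> g' = Ide C c"
    using g unfolding iso_arrow_def by (auto simp: homset_iff)
  \<comment> \<open>Stated for arbitrary arrows so that it serves both composites: that of
    \<open>f\<close> and \<open>g\<close>, and that of their inverses in the reverse order.\<close>
  have cancel: "(k' \<cdot> h') \<cdot> (h \<cdot> k) = Ide C x"
    if "k \<in> homset C x y" "h \<in> homset C y z" "h' \<in> homset C z y" "k' \<in> homset C y x"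
      "h' \<cdot> h = Ide C y" "k' \<cdot> k = Ide C x" for h h' k k' x y z
  proof -
    have "(k' \<cdot> h') \<cdot> (h \<cdot> k) = k' \<cdot> (h' \<cdot> (h \<cdot> k))"
      using that by (intro Cmp_assoc Cmp_in_homset)
    also have "h' \<cdot> (h \<cdot> k) = (h' \<cdot> h) \<cdot> k"
      using that by (metis Cmp_assoc)
    also have "\<dots> = k"
      using that Cmp_Ide_left by metis
    finally show ?thesis
      using that by simp
  qed
  have "g \<cdot> f \<in> homset C a c" "f' \<cdot> g' \<in> homset C c a"
    using f g f' g' by (auto intro: Cmp_in_homset)
  moreover have "(f' \<cdot> g') \<cdot> (g \<cdot> f) = Ide C a" "(g \<cdot> f) \<cdot> (f' \<cdot> g') = Ide C c"
    using cancel f g f' g' by blast+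
  ultimately show ?thesis
    unfolding iso_arrow_def by (auto simp: homset_iff)
qed

lemma naturally_isomorphic_trans:
  assumes "naturally_isomorphic C D F H" and "naturally_isomorphic C D H K"
  shows "naturally_isomorphic C D F K"
proof -
  obtain s t where s: "natural_iso C D F H s" and t: "natural_iso C D H K t"
    using assms unfolding naturally_isomorphic_def by blast
  note FD = is_functorD[OF natural_isoD(1)[OF s]] and HD = is_functorD[OF natural_isoD(2)[OF s]]
    and KD = is_functorD[OF natural_isoD(2)[OF t]]
  interpret C: category C using FD by simp
  interpret D: category D using FD by simp
  have "natural_iso C D F K (\<lambda>a. t a \<cdot>\<^bsub>D\<^esub> s a)"
  proof (rule natural_isoI)
    fix a assume "a \<in> Obj C"
    then show "t a \<cdot>\<^bsub>D\<^esub> s a \<in> homset D (OMap F a) (OMap K a)" "iso_arrow D (t a \<cdot>\<^bsub>D\<^esub> s a)"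
      using natural_isoD(3,4)[OF s] natural_isoD(3,4)[OF t] D.Cmp_in_homset D.iso_arrow_Cmp by blast+
  next
    fix f a b assume f: "f \<in> homset C a b"
    note ab = C.homset_Obj[OF f]
    note sa = natural_isoD(3)[OF s ab(1)] and sb = natural_isoD(3)[OF s ab(2)]
      and ta = natural_isoD(3)[OF t ab(1)] and tb = natural_isoD(3)[OF t ab(2)]
    show "(t b \<cdot>\<^bsub>D\<^esub> s b) \<cdot>\<^bsub>D\<^esub> AMap F f = AMap K f \<cdot>\<^bsub>D\<^esub> (t a \<cdot>\<^bsub>D\<^esub> s a)"
      using D.Cmp_assoc[OF FD(4)[OF f] sb tb] D.Cmp_assoc[OF sa HD(4)[OF f] tb]
        D.Cmp_assoc[OF sa ta KD(4)[OF f]] natural_isoD(5)[OF s f] natural_isoD(5)[OF t f]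
      by simp
  qed (use natural_isoD[OF s] natural_isoD[OF t] in auto)
  then show ?thesis
    unfolding naturally_isomorphic_def by blast
qed

lemma op_cat_simps [simp]:
  "Obj (op_cat C) = Obj C" "Arr (op_cat C) = Arr C" "Ide (op_cat C) = Ide C"
  "homset (op_cat C) a b = homset C b a" "g \<cdot>\<^bsub>op_cat C\<^esub> f = f \<cdot>\<^bsub>C\<^esub> g"
  by (auto simp: op_cat_def homset_def)

lemma prod_cat_simps [simp]:
  "Obj (C \<times>\<^sub>C D) = Obj C \<times> Obj D"
  "Ide (C \<times>\<^sub>C D) (a, b) = (Ide C a, Ide D b)"
  "homset (C \<times>\<^sub>C D) (a, b) (a', b') = homset C a a' \<times> homset D b b'"
  "(f', g') \<cdot>\<^bsub>C \<times>\<^sub>C D\<^esub> (f, g) = (f' \<cdot>\<^bsub>C\<^esub> f, g' \<cdot>\<^bsub>D\<^esub> g)"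
  by (auto simp: prod_cat_def homset_def)

lemma sets_cat_simps [simp]:
  "Obj sets_cat = UNIV" "Ide sets_cat S = (S, S, \<lambda>x\<in>S. x)"
  "(S, T, h) \<in> homset sets_cat S' T' \<longleftrightarrow> S = S' \<and> T = T' \<and> h \<in> S' \<rightarrow>\<^sub>E T'"
  "(S', T', k) \<cdot>\<^bsub>sets_cat\<^esub> (S, T, h) = (S, T', compose S k h)"
  by (auto simp: sets_cat_def homset_def)

lemma iso_arrow_sets_cat:
  assumes "bij_betw h S T" and "h \<in> extensional S"
  shows "iso_arrow sets_cat (S, T, h)"
proof -
  have h: "(S, T, h) \<in> homset sets_cat S T"
    using assms by (auto simp: bij_betw_def PiE_def)
  have k: "(T, S, \<lambda>y\<in>T. inv_into S h y) \<in> homset sets_cat T S"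
    using assms(1) by (auto simp: bij_betw_def intro: inv_into_into)
  have "compose S (\<lambda>y\<in>T. inv_into S h y) h = (\<lambda>x\<in>S. x)"
    "compose T h (\<lambda>y\<in>T. inv_into S h y) = (\<lambda>y\<in>T. y)"
    using assms(1) by (auto simp: compose_def bij_betw_def f_inv_into_f fun_eq_iff)
  then show ?thesis
    using h k unfolding iso_arrow_def
    by (intro conjI bexI[of _ "(T, S, \<lambda>y\<in>T. inv_into S h y)"]) (auto simp: homset_iff sets_cat_def)
qed

lemma is_functor_prodI:
  assumes "category C" and "category D" and "category E"
    and "\<And>a b. a \<in> Obj C \<Longrightarrow> b \<in> Obj D \<Longrightarrow> OMap F (a, b) \<in> Obj E"
    and "\<And>f g a a' b b'. f \<in> homset C a a' \<Longrightarrow> g \<in> homset D b b' \<Longrightarrow>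
      AMap F (f, g) \<in> homset E (OMap F (a, b)) (OMap F (a', b'))"
    and "\<And>a b. a \<in> Obj C \<Longrightarrow> b \<in> Obj D \<Longrightarrow> AMap F (Ide C a, Ide D b) = Ide E (OMap F (a, b))"
    and "\<And>f f' g g' a a' a'' b b' b''. f \<in> homset C a a' \<Longrightarrow> f' \<in> homset C a' a'' \<Longrightarrow>
      g \<in> homset D b b' \<Longrightarrow> g' \<in> homset D b' b'' \<Longrightarrow>
      AMap F (f' \<cdot>\<^bsub>C\<^esub> f, g' \<cdot>\<^bsub>D\<^esub> g) = AMap F (f', g') \<cdot>\<^bsub>E\<^esub> AMap F (f, g)"
  shows "is_functor (C \<times>\<^sub>C D) E F"
proof (rule is_functorI)
  show "category (C \<times>\<^sub>C D)" "category E"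
    using assms(1-3) by (auto intro: category_prod)
next
  fix p assume "p \<in> Obj (C \<times>\<^sub>C D)"
  then show "OMap F p \<in> Obj E" "AMap F (Ide (C \<times>\<^sub>C D) p) = Ide E (OMap F p)"
    using assms(4,6) by auto
next
  fix f p q assume "f \<in> homset (C \<times>\<^sub>C D) p q"
  then show "AMap F f \<in> homset E (OMap F p) (OMap F q)"
    using assms(5) by (cases f; cases p; cases q) auto
next
  fix f g p q r assume "f \<in> homset (C \<times>\<^sub>C D) p q" "g \<in> homset (C \<times>\<^sub>C D) q r"
  then show "AMap F (g \<cdot>\<^bsub>C \<times>\<^sub>C D\<^esub> f) = AMap F g \<cdot>\<^bsub>E\<^esub> AMap F f"
    using assms(7) by (cases f; cases g; cases p; cases q; cases r) auto
qed

lemma is_functor_prodD: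
  assumes "is_functor (C \<times>\<^sub>C D) E F"
  shows "a \<in> Obj C \<Longrightarrow> b \<in> Obj D \<Longrightarrow> OMap F (a, b) \<in> Obj E"
    and "f \<in> homset C a a' \<Longrightarrow> g \<in> homset D b b' \<Longrightarrow>
      AMap F (f, g) \<in> homset E (OMap F (a, b)) (OMap F (a', b'))"
    and "a \<in> Obj C \<Longrightarrow> b \<in> Obj D \<Longrightarrow> AMap F (Ide C a, Ide D b) = Ide E (OMap F (a, b))"
    and "f \<in> homset C a a' \<Longrightarrow> f' \<in> homset C a' a'' \<Longrightarrow>
      g \<in> homset D b b' \<Longrightarrow> g' \<in> homset D b' b'' \<Longrightarrow>
      AMap F (f' \<cdot>\<^bsub>C\<^esub> f, g' \<cdot>\<^bsub>D\<^esub> g) = AMap F (f', g') \<cdot>\<^bsub>E\<^esub> AMap F (f, g)"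
  using is_functorD(3)[OF assms, of "(a, b)"] is_functorD(4)[OF assms, of "(f, g)" "(a, b)" "(a', b')"]
    is_functorD(5)[OF assms, of "(a, b)"]
    is_functorD(6)[OF assms, of "(f, g)" "(a, b)" "(a', b')" "(f', g')" "(a'', b'')"]
  by auto

section \<open>Functors derived from a tensor product\<close>

context
  fixes C :: "('o, 'm) cat" (structure) and T
  assumes tensor: "is_functor (C \<times>\<^sub>C C) C T"
begin

interpretation category C
  by (rule is_functorD(2)[OF tensor])

lemmas tensorD = is_functor_prodD[OF tensor]

lemma is_functor_tensor_left: "is_functor (C \<times>\<^sub>C C \<times>\<^sub>C C) C
    \<lparr>OMap = (\<lambda>(x, y, z). OMap T (OMap T (x, y), z)), AMap = (\<lambda>(f, g, h). AMap T (AMap T (f, g), h))\<rparr>"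
  (is "is_functor _ _ ?F")
proof (rule is_functor_prodI)
  fix x yz assume "x \<in> Obj C" "yz \<in> Obj (C \<times>\<^sub>C C)"
  then show "OMap ?F (x, yz) \<in> Obj C" "AMap ?F (Ide C x, Ide (C \<times>\<^sub>C C) yz) = Ide C (OMap ?F (x, yz))"
    by (cases yz; simp add: tensorD(1,3))+
next
  fix f gh x x' yz yz' assume "f \<in> homset C x x'" "gh \<in> homset (C \<times>\<^sub>C C) yz yz'"
  then show "AMap ?F (f, gh) \<in> homset C (OMap ?F (x, yz)) (OMap ?F (x', yz'))"
    by (cases gh; cases yz; cases yz') (simp add: tensorD(2))
next
  fix f f' gh gh' x x' x'' yz yz' yz''
  assume f: "f \<in> homset C x x'" "f' \<in> homset C x' x''"
    and gh: "gh \<in> homset (C \<times>\<^sub>C C) yz yz'" "gh' \<in> homset (C \<times>\<^sub>C C) yz' yz''"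
  obtain g h g' h' y z y' z' y'' z'' where [simp]: "gh = (g, h)" "gh' = (g', h')"
    "yz = (y, z)" "yz' = (y', z')" "yz'' = (y'', z'')"
    by (metis prod.exhaust)
  have g: "g \<in> homset C y y'" "g' \<in> homset C y' y''" and h: "h \<in> homset C z z'" "h' \<in> homset C z' z''"
    using gh by auto
  show "AMap ?F (f' \<cdot> f, gh' \<cdot>\<^bsub>C \<times>\<^sub>C C\<^esub> gh) = AMap ?F (f', gh') \<cdot> AMap ?F (f, gh)"
    using tensorD(4)[OF f g] tensorD(4)[OF tensorD(2)[OF f(1) g(1)] tensorD(2)[OF f(2) g(2)] h] by simp
qed (intro category_prod category_axioms)+

lemma is_functor_tensor_right: "is_functor (C \<times>\<^sub>C C \<times>\<^sub>C C) C
    \<lparr>OMap = (\<lambda>(x, y, z). OMap T (x, OMap T (y, z))), AMap = (\<lambda>(f, g, h). AMap T (f, AMap T (g, h)))\<rparr>"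
  (is "is_functor _ _ ?F")
proof (rule is_functor_prodI)
  fix x yz assume "x \<in> Obj C" "yz \<in> Obj (C \<times>\<^sub>C C)"
  then show "OMap ?F (x, yz) \<in> Obj C" "AMap ?F (Ide C x, Ide (C \<times>\<^sub>C C) yz) = Ide C (OMap ?F (x, yz))"
    by (cases yz; simp add: tensorD(1,3))+
next
  fix f gh x x' yz yz' assume "f \<in> homset C x x'" "gh \<in> homset (C \<times>\<^sub>C C) yz yz'"
  then show "AMap ?F (f, gh) \<in> homset C (OMap ?F (x, yz)) (OMap ?F (x', yz'))"
    by (cases gh; cases yz; cases yz') (simp add: tensorD(2))
next
  fix f f' gh gh' x x' x'' yz yz' yz''
  assume f: "f \<in> homset C x x'" "f' \<in> homset C x' x''"
    and gh: "gh \<in> homset (C \<times>\<^sub>C C) yz yz'" "gh' \<in> homset (C \<times>\<^sub>C C) yz' yz''"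
  obtain g h g' h' y z y' z' y'' z'' where [simp]: "gh = (g, h)" "gh' = (g', h')"
    "yz = (y, z)" "yz' = (y', z')" "yz'' = (y'', z'')"
    by (metis prod.exhaust)
  have g: "g \<in> homset C y y'" "g' \<in> homset C y' y''" and h: "h \<in> homset C z z'" "h' \<in> homset C z' z''"
    using gh by auto
  show "AMap ?F (f' \<cdot> f, gh' \<cdot>\<^bsub>C \<times>\<^sub>C C\<^esub> gh) = AMap ?F (f', gh') \<cdot> AMap ?F (f, gh)"
    using tensorD(4)[OF g h] tensorD(4)[OF f tensorD(2)[OF g(1) h(1)] tensorD(2)[OF g(2) h(2)]] by simp
qed (intro category_prod category_axioms)+

lemma is_functor_tensor_fixed:
  assumes "I \<in> Obj C"
  shows "is_functor C C \<lparr>OMap = (\<lambda>x. OMap T (I, x)), AMap = (\<lambda>f. AMap T (Ide C I, f))\<rparr>"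
    and "is_functor C C \<lparr>OMap = (\<lambda>x. OMap T (x, I)), AMap = (\<lambda>f. AMap T (f, Ide C I))\<rparr>"
  using tensorD(4)[OF Ide_in_homset[OF assms] Ide_in_homset[OF assms]]
    tensorD(4)[OF _ _ Ide_in_homset[OF assms] Ide_in_homset[OF assms]]
    Cmp_Ide_left[OF Ide_in_homset[OF assms]]
  by (intro is_functorI category_axioms; simp add: tensorD(1-3) Ide_in_homset assms)+

lemma is_functor_ident: "is_functor C C \<lparr>OMap = (\<lambda>x. x), AMap = (\<lambda>f. f)\<rparr>"
  by (intro is_functorI category_axioms) auto

end

section \<open>Hom functors and parametrized adjoints\<close>

context category
begin

lemma hom_functor_OMap [simp]: "OMap (hom_functor C) (a, b) = homset C a b"
  by (simp add: hom_functor_def)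

lemma hom_functor_AMap:
  assumes "f \<in> homset C a' a" and "h \<in> homset C b b'"
  shows "AMap (hom_functor C) (f, h) = (homset C a b, homset C a' b', \<lambda>u\<in>homset C a b. h \<cdot> u \<cdot> f)"
  using assms by (simp add: hom_functor_def homset_iff)

lemma is_functor_hom_functor: "is_functor (op_cat C \<times>\<^sub>C C) sets_cat (hom_functor C)"
proof (rule is_functor_prodI)
  fix f h a a' b b' assume "f \<in> homset (op_cat C) a a'" "h \<in> homset C b b'"
  then show "AMap (hom_functor C) (f, h) \<in> homset sets_cat (OMap (hom_functor C) (a, b)) (OMap (hom_functor C) (a', b'))"
    by (auto simp: hom_functor_AMap intro!: Cmp_in_homset)
next
  fix a b assume "a \<in> Obj (op_cat C)" "b \<in> Obj C"
  then show "AMap (hom_functor C) (Ide (op_cat C) a, Ide C b) = Ide sets_cat (OMap (hom_functor C) (a, b))"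
    by (auto simp: hom_functor_AMap[OF Ide_in_homset Ide_in_homset] Cmp_Ide_left Cmp_Ide_right
      intro!: restrict_ext)
next
  fix f f' h h' a a' a'' b b' b''
  assume "f \<in> homset (op_cat C) a a'" "f' \<in> homset (op_cat C) a' a''"
    and h: "h \<in> homset C b b'" "h' \<in> homset C b' b''"
  then have f: "f \<in> homset C a' a" "f' \<in> homset C a'' a'"
    by auto
  have "(h' \<cdot> h) \<cdot> u \<cdot> (f \<cdot> f') = h' \<cdot> (h \<cdot> u \<cdot> f) \<cdot> f'" if u: "u \<in> homset C a b" for u
  proof -
    have "(h' \<cdot> h) \<cdot> u \<cdot> (f \<cdot> f') = h' \<cdot> (h \<cdot> u) \<cdot> (f \<cdot> f')"
      by (simp add: Cmp_assoc[OF u h])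
    also have "\<dots> = h' \<cdot> (h \<cdot> u) \<cdot> f \<cdot> f'"
      using Cmp_assoc[OF f(2,1) Cmp_in_homset[OF Cmp_in_homset[OF u h(1)] h(2)]] by simp
    also have "h' \<cdot> (h \<cdot> u) \<cdot> f = h' \<cdot> (h \<cdot> u \<cdot> f)"
      using Cmp_assoc[OF f(1) Cmp_in_homset[OF u h(1)] h(2)] by simp
    finally show ?thesis .
  qed
  moreover have "h \<cdot> u \<cdot> f \<in> homset C a' b'" if "u \<in> homset C a b" for u
    using that f(1) h(1) by (blast intro: Cmp_in_homset)
  ultimately show "AMap (hom_functor C) (f' \<cdot>\<^bsub>op_cat C\<^esub> f, h' \<cdot> h) =
      AMap (hom_functor C) (f', h') \<cdot>\<^bsub>sets_cat\<^esub> AMap (hom_functor C) (f, h)"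
    by (simp add: hom_functor_AMap[OF f(1) h(1)] hom_functor_AMap[OF f(2) h(2)]
      hom_functor_AMap[OF Cmp_in_homset[OF f(2,1)] Cmp_in_homset[OF h]] compose_def cong: restrict_cong)
qed (auto intro: category_op category_sets category_axioms)

text \<open>Factored as the tensor of the two contravariant variables followed by the hom functor,
  so that only the inner functor has to be checked.\<close>

lemma is_functor_hom_tensor:
  assumes "is_functor (C \<times>\<^sub>C C) C T"
  shows "is_functor (op_cat C \<times>\<^sub>C op_cat C \<times>\<^sub>C C) sets_cat (hom_tensor C T)"
proof -
  let ?K = "\<lparr>OMap = \<lambda>(x, y, z). (OMap T (x, y), z), AMap = \<lambda>(f, g, h). (AMap T (f, g), h)\<rparr>"
  note T = is_functor_prodD[OF assms]
  have "is_functor (op_cat C \<times>\<^sub>C op_cat C \<times>\<^sub>C C) (op_cat C \<times>\<^sub>C C) ?K"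
  proof (rule is_functor_prodI)
    fix x yz assume "x \<in> Obj (op_cat C)" "yz \<in> Obj (op_cat C \<times>\<^sub>C C)"
    then show "OMap ?K (x, yz) \<in> Obj (op_cat C \<times>\<^sub>C C)"
      "AMap ?K (Ide (op_cat C) x, Ide (op_cat C \<times>\<^sub>C C) yz) = Ide (op_cat C \<times>\<^sub>C C) (OMap ?K (x, yz))"
      by (cases yz; simp add: T(1,3))+
  next
    fix f gh x x' yz yz' assume "f \<in> homset (op_cat C) x x'" "gh \<in> homset (op_cat C \<times>\<^sub>C C) yz yz'"
    then show "AMap ?K (f, gh) \<in> homset (op_cat C \<times>\<^sub>C C) (OMap ?K (x, yz)) (OMap ?K (x', yz'))"
      by (cases gh; cases yz; cases yz') (simp add: T(2))
  next
    fix f f' gh gh' x x' x'' yz yz' yz''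
    assume "f \<in> homset (op_cat C) x x'" "f' \<in> homset (op_cat C) x' x''"
      "gh \<in> homset (op_cat C \<times>\<^sub>C C) yz yz'" "gh' \<in> homset (op_cat C \<times>\<^sub>C C) yz' yz''"
    then show "AMap ?K (f' \<cdot>\<^bsub>op_cat C\<^esub> f, gh' \<cdot>\<^bsub>op_cat C \<times>\<^sub>C C\<^esub> gh) =
        AMap ?K (f', gh') \<cdot>\<^bsub>op_cat C \<times>\<^sub>C C\<^esub> AMap ?K (f, gh)"
      by (cases gh; cases gh'; cases yz; cases yz'; cases yz'') (simp, elim conjE, rule T(4))
  qed (intro category_prod category_op category_axioms)+
  moreover have "hom_tensor C T = comp_functor (hom_functor C) ?K"
    by (auto simp: hom_tensor_def comp_functor_def)
  ultimately show ?thesis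
    using is_functor_comp[OF _ is_functor_hom_functor] by simp
qed

lemma is_functor_hom_right:
  assumes "is_functor (op_cat C \<times>\<^sub>C C) C H"
  shows "is_functor (op_cat C \<times>\<^sub>C op_cat C \<times>\<^sub>C C) sets_cat (hom_right C H)"
proof -
  let ?K = "\<lparr>OMap = \<lambda>(x, y, z). (x, OMap H (y, z)), AMap = \<lambda>(f, g, h). (f, AMap H (g, h))\<rparr>"
  note H = is_functor_prodD[OF assms]
  have "is_functor (op_cat C \<times>\<^sub>C op_cat C \<times>\<^sub>C C) (op_cat C \<times>\<^sub>C C) ?K"
  proof (rule is_functor_prodI)
    fix x yz assume "x \<in> Obj (op_cat C)" "yz \<in> Obj (op_cat C \<times>\<^sub>C C)"
    then show "OMap ?K (x, yz) \<in> Obj (op_cat C \<times>\<^sub>C C)"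
      "AMap ?K (Ide (op_cat C) x, Ide (op_cat C \<times>\<^sub>C C) yz) = Ide (op_cat C \<times>\<^sub>C C) (OMap ?K (x, yz))"
      by (cases yz; simp add: H(1,3)[simplified])+
  next
    fix f gh x x' yz yz' assume "f \<in> homset (op_cat C) x x'" "gh \<in> homset (op_cat C \<times>\<^sub>C C) yz yz'"
    then show "AMap ?K (f, gh) \<in> homset (op_cat C \<times>\<^sub>C C) (OMap ?K (x, yz)) (OMap ?K (x', yz'))"
      by (cases gh; cases yz; cases yz') (simp add: H(2)[simplified])
  next
    fix f f' gh gh' x x' x'' yz yz' yz''
    assume "f \<in> homset (op_cat C) x x'" "f' \<in> homset (op_cat C) x' x''"
      "gh \<in> homset (op_cat C \<times>\<^sub>C C) yz yz'" "gh' \<in> homset (op_cat C \<times>\<^sub>C C) yz' yz''"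
    then show "AMap ?K (f' \<cdot>\<^bsub>op_cat C\<^esub> f, gh' \<cdot>\<^bsub>op_cat C \<times>\<^sub>C C\<^esub> gh) =
        AMap ?K (f', gh') \<cdot>\<^bsub>op_cat C \<times>\<^sub>C C\<^esub> AMap ?K (f, gh)"
      by (cases gh; cases gh'; cases yz; cases yz'; cases yz'') (simp, elim conjE, rule H(4)[unfolded op_cat_simps])
  qed (intro category_prod category_op category_axioms)+
  moreover have "hom_right C H = comp_functor (hom_functor C) ?K"
    by (auto simp: hom_right_def comp_functor_def)
  ultimately show ?thesis
    using is_functor_comp[OF _ is_functor_hom_functor] by simp
qed

end

text \<open>The adjoint is given only objectwise, by a universal arrow \<open>ev y z\<close> from
  tensoring with \<open>y\<close> on the right to \<open>z\<close>. That \<open>H\<close> is a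
  functor is derived from universality.\<close>

locale closing = category C
  for C :: "('o, 'm) cat" (structure) +
  fixes T :: "('o \<times> 'o, 'm \<times> 'm, 'o, 'm) fctr"
    and H :: "'o \<Rightarrow> 'o \<Rightarrow> 'o"
    and ev :: "'o \<Rightarrow> 'o \<Rightarrow> 'm"
  assumes tensor: "is_functor (C \<times>\<^sub>C C) C T"
    and H_Obj: "y \<in> Obj C \<Longrightarrow> z \<in> Obj C \<Longrightarrow> H y z \<in> Obj C"
    and ev_in_homset: "y \<in> Obj C \<Longrightarrow> z \<in> Obj C \<Longrightarrow> ev y z \<in> homset C (OMap T (H y z, y)) z"
    and ev_universal: "x \<in> Obj C \<Longrightarrow> y \<in> Obj C \<Longrightarrow> z \<in> Obj C \<Longrightarrow>
      f \<in> homset C (OMap T (x, y)) z \<Longrightarrow>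
      \<exists>!k. k \<in> homset C x (H y z) \<and> ev y z \<cdot> AMap T (k, Ide C y) = f"
begin

lemmas T_in_homset = is_functor_prodD(2)[OF tensor]
  and T_Ide = is_functor_prodD(3)[OF tensor]
  and T_Cmp = is_functor_prodD(4)[OF tensor]

definition transpose :: "'o \<Rightarrow> 'o \<Rightarrow> 'o \<Rightarrow> 'm \<Rightarrow> 'm"
  where "transpose x y z f = (THE k. k \<in> homset C x (H y z) \<and> ev y z \<cdot> AMap T (k, Ide C y) = f)"

lemma
  assumes "x \<in> Obj C" "y \<in> Obj C" "z \<in> Obj C" "f \<in> homset C (OMap T (x, y)) z"
  shows transpose_in_homset: "transpose x y z f \<in> homset C x (H y z)"
    and ev_transpose: "ev y z \<cdot> AMap T (transpose x y z f, Ide C y) = f"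
  using theI'[OF ev_universal[OF assms]] unfolding transpose_def by auto

lemma ev_T_in_homset:
  assumes "y \<in> Obj C" "z \<in> Obj C" "k \<in> homset C x (H y z)"
  shows "ev y z \<cdot> AMap T (k, Ide C y) \<in> homset C (OMap T (x, y)) z"
  using T_in_homset[OF assms(3) Ide_in_homset[OF assms(1)]] ev_in_homset[OF assms(1,2)]
  by (rule Cmp_in_homset)

lemma transpose_eqI:
  assumes "y \<in> Obj C" "z \<in> Obj C" "k \<in> homset C x (H y z)" "ev y z \<cdot> AMap T (k, Ide C y) = f"
  shows "transpose x y z f = k"
proof -
  have x: "x \<in> Obj C"
    using homset_Obj(1)[OF assms(3)] .
  have f: "f \<in> homset C (OMap T (x, y)) z"
    using ev_T_in_homset[OF assms(1-3)] assms(4) by simp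
  show ?thesis
    using ev_universal[OF x assms(1,2) f] assms(3,4) transpose_in_homset[OF x assms(1,2) f]
      ev_transpose[OF x assms(1,2) f] by blast
qed

text \<open>Universality leaves one choice: evaluation has to be compatible with \<open>g\<close>
  and \<open>h\<close> as in \<open>ev_H_arr\<close>, and that equation has exactly one
  solution.\<close>

definition H_arr :: "'m \<Rightarrow> 'm \<Rightarrow> 'm"
  where "H_arr g h = transpose (H (Cod C g) (Dom C h)) (Dom C g) (Cod C h)
    (h \<cdot> ev (Cod C g) (Dom C h) \<cdot> AMap T (Ide C (H (Cod C g) (Dom C h)), g))"

lemma
  assumes g: "g \<in> homset C y' y" and h: "h \<in> homset C z z'"
  shows H_arr_in_homset: "H_arr g h \<in> homset C (H y z) (H y' z')"
    and ev_H_arr: "ev y' z' \<cdot> AMap T (H_arr g h, Ide C y') = h \<cdot> ev y z \<cdot> AMap T (Ide C (H y z), g)"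
proof -
  note y = homset_Obj[OF g] and z = homset_Obj[OF h]
  have *: "h \<cdot> ev y z \<cdot> AMap T (Ide C (H y z), g) \<in> homset C (OMap T (H y z, y')) z'"
    using T_in_homset[OF Ide_in_homset[OF H_Obj[OF y(2) z(1)]] g]
      Cmp_in_homset[OF ev_in_homset[OF y(2) z(1)] h] by (rule Cmp_in_homset)
  have "H_arr g h = transpose (H y z) y' z' (h \<cdot> ev y z \<cdot> AMap T (Ide C (H y z), g))"
    using g h unfolding H_arr_def by (simp add: homset_iff)
  then show "H_arr g h \<in> homset C (H y z) (H y' z')"
    "ev y' z' \<cdot> AMap T (H_arr g h, Ide C y') = h \<cdot> ev y z \<cdot> AMap T (Ide C (H y z), g)"
    using transpose_in_homset[OF H_Obj[OF y(2) z(1)] y(1) z(2) *]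
      ev_transpose[OF H_Obj[OF y(2) z(1)] y(1) z(2) *] by auto
qed

text \<open>Both sides are arrows into an internal hom, so it is enough to compare them after
  evaluation. Naturality in all three variables is packed into one equation, from which the
  composition law for \<open>H_arr\<close> follows as well.\<close>

lemma transpose_natural:
  assumes k: "k \<in> homset C x' x" and g: "g \<in> homset C y' y" and h: "h \<in> homset C z z'"
    and f: "f \<in> homset C (OMap T (x, y)) z"
  shows "transpose x' y' z' (h \<cdot> f \<cdot> AMap T (k, g)) = H_arr g h \<cdot> transpose x y z f \<cdot> k"
proof (rule transpose_eqI)
  note x = homset_Obj[OF k] and y = homset_Obj[OF g] and z = homset_Obj[OF h]
  let ?u = "transpose x y z f"
  let ?I = "Ide C (H y z)"
  note u = transpose_in_homset[OF x(2) y(2) z(1) f]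
  note uf = ev_transpose[OF x(2) y(2) z(1) f]
  note HA = H_arr_in_homset[OF g h] and evHA = ev_H_arr[OF g h]
  note hy = Ide_in_homset[OF y(2)] and hy' = Ide_in_homset[OF y(1)]
    and hH = Ide_in_homset[OF H_Obj[OF y(2) z(1)]] and hx = Ide_in_homset[OF x(2)]
  note e = ev_in_homset[OF y(2) z(1)] and e' = ev_in_homset[OF y(1) z(2)]
  show "y' \<in> Obj C" "z' \<in> Obj C"
    using y z by auto
  show uk: "H_arr g h \<cdot> ?u \<cdot> k \<in> homset C x' (H y' z')"
    using k u HA by (blast intro: Cmp_in_homset)
  note uk' = Cmp_in_homset[OF k u]
  have "AMap T (H_arr g h \<cdot> ?u \<cdot> k, Ide C y') = AMap T (H_arr g h \<cdot> (?u \<cdot> k), Ide C y' \<cdot> Ide C y')"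
    by (simp add: Cmp_assoc[OF k u HA] Cmp_Ide_left[OF hy'])
  also have "\<dots> = AMap T (H_arr g h, Ide C y') \<cdot> AMap T (?u \<cdot> k, Ide C y')"
    by (rule T_Cmp[OF uk' HA hy' hy'])
  finally have "ev y' z' \<cdot> AMap T (H_arr g h \<cdot> ?u \<cdot> k, Ide C y')
      = ev y' z' \<cdot> AMap T (H_arr g h, Ide C y') \<cdot> AMap T (?u \<cdot> k, Ide C y')"
    by (simp add: Cmp_assoc[OF T_in_homset[OF uk' hy'] T_in_homset[OF HA hy'] e'])
  also have "\<dots> = h \<cdot> ev y z \<cdot> AMap T (?I, g) \<cdot> AMap T (?u \<cdot> k, Ide C y')"
    by (simp add: evHA)
  also have "\<dots> = h \<cdot> ev y z \<cdot> (AMap T (?I, g) \<cdot> AMap T (?u \<cdot> k, Ide C y'))"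
    by (rule Cmp_assoc[OF T_in_homset[OF uk' hy'] T_in_homset[OF hH g] Cmp_in_homset[OF e h]])
  \<comment> \<open>Interchange moves \<open>g\<close> from the evaluation side to the side of
    \<open>f\<close>: both \<open>T(1, g) T(u k, 1)\<close> and \<open>T(u, 1) T(k, g)\<close> equal
    \<open>T(u k, g)\<close>.\<close>
  also have "AMap T (?I, g) \<cdot> AMap T (?u \<cdot> k, Ide C y') = AMap T (?u \<cdot> k, g)"
    by (simp add: T_Cmp[OF uk' hH hy' g, symmetric] Cmp_Ide_left[OF uk'] Cmp_Ide_right[OF g])
  also have "AMap T (?u \<cdot> k, g) = AMap T (?u, Ide C y) \<cdot> AMap T (k, g)"
    by (simp add: T_Cmp[OF k u g hy, symmetric] Cmp_Ide_left[OF g])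
  also have "h \<cdot> ev y z \<cdot> (AMap T (?u, Ide C y) \<cdot> AMap T (k, g))
      = h \<cdot> ev y z \<cdot> AMap T (?u, Ide C y) \<cdot> AMap T (k, g)"
    by (rule Cmp_assoc[OF T_in_homset[OF k g] T_in_homset[OF u hy] Cmp_in_homset[OF e h], symmetric])
  also have "h \<cdot> ev y z \<cdot> AMap T (?u, Ide C y) = h \<cdot> f"
    by (simp add: Cmp_assoc[OF T_in_homset[OF u hy] e h] uf)
  finally show "ev y' z' \<cdot> AMap T (H_arr g h \<cdot> ?u \<cdot> k, Ide C y') = h \<cdot> f \<cdot> AMap T (k, g)" .
qed

definition H_functor :: "('o \<times> 'o, 'm \<times> 'm, 'o, 'm) fctr"
  where "H_functor = \<lparr>OMap = (\<lambda>(y, z). H y z), AMap = (\<lambda>(g, h). H_arr g h)\<rparr>"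

lemma is_functor_H: "is_functor (op_cat C \<times>\<^sub>C C) C H_functor"
proof (rule is_functor_prodI)
  fix y z assume "y \<in> Obj (op_cat C)" and z: "z \<in> Obj C"
  then have y: "y \<in> Obj C"
    by simp
  show "AMap H_functor (Ide (op_cat C) y, Ide C z) = Ide C (OMap H_functor (y, z))"
    using y z unfolding H_functor_def H_arr_def op_cat_simps prod.case fctr.simps
    using Ide_in_homset[OF y] Ide_in_homset[OF z] Cmp_Ide_left[OF ev_in_homset[OF y z]]
      Ide_in_homset[OF H_Obj[OF y z]]
    by (intro transpose_eqI) (simp_all add: homset_iff[of "Ide C _"])
next
  fix g g' h h' y y' y'' z z' z''
  assume "g \<in> homset (op_cat C) y y'" "g' \<in> homset (op_cat C) y' y''"
    and h: "h \<in> homset C z z'" and h': "h' \<in> homset C z' z''"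
  then have g: "g \<in> homset C y' y" and g': "g' \<in> homset C y'' y'"
    by auto
  note y = homset_Obj[OF g] and z = homset_Obj[OF h]
  let ?I = "Ide C (H y z)"
  have I: "?I \<in> homset C (H y z) (H y z)"
    using y z by (intro Ide_in_homset H_Obj)
  have gg': "AMap T (?I, g) \<cdot> AMap T (?I, g') = AMap T (?I, g \<cdot> g')"
    by (simp add: T_Cmp[OF I I g' g, symmetric] Cmp_Ide_left[OF I])
  note e = ev_in_homset[OF y(2) z(1)]
  note Tg = T_in_homset[OF I g] and Tg' = T_in_homset[OF I g']
  \<comment> \<open>\<open>H_arr g h\<close> is the transpose of this \<open>f\<close>, so the
    composition law is \<open>transpose_natural\<close> for \<open>f\<close> with the identity in
    the first variable.\<close>
  define f where "f = h \<cdot> ev y z \<cdot> AMap T (?I, g)"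
  have f: "f \<in> homset C (OMap T (H y z, y')) z'"
    unfolding f_def using Tg Cmp_in_homset[OF e h] by (rule Cmp_in_homset)
  have "h' \<cdot> f \<cdot> AMap T (?I, g') = h' \<cdot> h \<cdot> ev y z \<cdot> AMap T (?I, g \<cdot> g')"
    unfolding f_def
    using Cmp_assoc[OF Tg Cmp_in_homset[OF e h] h']
      Cmp_assoc[OF Tg' Tg Cmp_in_homset[OF Cmp_in_homset[OF e h] h']] Cmp_assoc[OF e h h'] gg'
    by simp
  then have "H_arr (g \<cdot> g') (h' \<cdot> h) = transpose (H y z) y'' z'' (h' \<cdot> f \<cdot> AMap T (?I, g'))"
    using Cmp_in_homset[OF g' g] Cmp_in_homset[OF h h'] unfolding H_arr_def by (simp add: homset_iff)
  also have "\<dots> = H_arr g' h' \<cdot> transpose (H y z) y' z' f \<cdot> ?I"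
    by (rule transpose_natural[OF I g' h' f])
  also have "\<dots> = H_arr g' h' \<cdot> transpose (H y z) y' z' f"
    using Cmp_Ide_right[OF Cmp_in_homset[OF transpose_in_homset[OF _ _ _ f] H_arr_in_homset[OF g' h']]]
      y z homset_Obj[OF h'] H_Obj by simp
  also have "transpose (H y z) y' z' f = H_arr g h"
    using g h unfolding H_arr_def f_def by (simp add: homset_iff)
  finally show "AMap H_functor (g' \<cdot>\<^bsub>op_cat C\<^esub> g, h' \<cdot> h) = AMap H_functor (g', h') \<cdot> AMap H_functor (g, h)"
    by (simp add: H_functor_def)
qed (auto simp: H_functor_def intro: category_op category_axioms H_Obj H_arr_in_homset)

lemma natural_iso_transpose:
  "natural_iso (op_cat C \<times>\<^sub>C op_cat C \<times>\<^sub>C C) sets_cat (hom_tensor C T) (hom_right C H_functor)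
    (\<lambda>(x, y, z). (homset C (OMap T (x, y)) z, homset C x (H y z),
      \<lambda>f\<in>homset C (OMap T (x, y)) z. transpose x y z f))"
proof (rule natural_isoI)
  show "is_functor (op_cat C \<times>\<^sub>C op_cat C \<times>\<^sub>C C) sets_cat (hom_tensor C T)"
    by (rule is_functor_hom_tensor[OF tensor])
  show "is_functor (op_cat C \<times>\<^sub>C op_cat C \<times>\<^sub>C C) sets_cat (hom_right C H_functor)"
    by (rule is_functor_hom_right[OF is_functor_H])
next
  fix a assume "a \<in> Obj (op_cat C \<times>\<^sub>C op_cat C \<times>\<^sub>C C)"
  then obtain x y z where [simp]: "a = (x, y, z)" and xyz: "x \<in> Obj C" "y \<in> Obj C" "z \<in> Obj C"
    by auto
  show "(case a of (x, y, z) \<Rightarrow> (homset C (OMap T (x, y)) z, homset C x (H y z),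
      \<lambda>f\<in>homset C (OMap T (x, y)) z. transpose x y z f))
    \<in> homset sets_cat (OMap (hom_tensor C T) a) (OMap (hom_right C H_functor) a)"
    using xyz by (auto simp: hom_tensor_def hom_right_def H_functor_def intro: transpose_in_homset)
  have "bij_betw (transpose x y z) (homset C (OMap T (x, y)) z) (homset C x (H y z))"
    using xyz
    by (intro bij_betwI[where g = "\<lambda>k. ev y z \<cdot> AMap T (k, Ide C y)"])
      (auto intro: transpose_in_homset ev_T_in_homset ev_transpose transpose_eqI)
  then have "bij_betw (\<lambda>f\<in>homset C (OMap T (x, y)) z. transpose x y z f)
      (homset C (OMap T (x, y)) z) (homset C x (H y z))"
    by (simp cong: bij_betw_cong)
  then show "iso_arrow sets_cat (case a of (x, y, z) \<Rightarrow> (homset C (OMap T (x, y)) z, homset C x (H y z),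
      \<lambda>f\<in>homset C (OMap T (x, y)) z. transpose x y z f))"
    by (simp add: iso_arrow_sets_cat)
next
  fix F a b assume F: "F \<in> homset (op_cat C \<times>\<^sub>C op_cat C \<times>\<^sub>C C) a b"
  obtain x y z x' y' z' k g h where [simp]: "a = (x, y, z)" "b = (x', y', z')" "F = (k, g, h)"
    by (metis prod.exhaust)
  have k: "k \<in> homset C x' x" and g: "g \<in> homset C y' y" and h: "h \<in> homset C z z'"
    using F by auto
  note x = homset_Obj[OF k] and y = homset_Obj[OF g] and z = homset_Obj[OF h]
  have "h \<cdot> f \<cdot> AMap T (k, g) \<in> homset C (OMap T (x', y')) z'"
    if "f \<in> homset C (OMap T (x, y)) z" for f
    using that T_in_homset[OF k g] h by (blast intro: Cmp_in_homset)
  then show "(case b of (x, y, z) \<Rightarrow> (homset C (OMap T (x, y)) z, homset C x (H y z),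
        \<lambda>f\<in>homset C (OMap T (x, y)) z. transpose x y z f)) \<cdot>\<^bsub>sets_cat\<^esub> AMap (hom_tensor C T) F
    = AMap (hom_right C H_functor) F \<cdot>\<^bsub>sets_cat\<^esub> (case a of (x, y, z) \<Rightarrow>
        (homset C (OMap T (x, y)) z, homset C x (H y z),
        \<lambda>f\<in>homset C (OMap T (x, y)) z. transpose x y z f))"
    using x y z
    by (simp add: hom_tensor_def hom_right_def hom_functor_AMap[OF T_in_homset[OF k g] h]
      hom_functor_AMap[OF k H_arr_in_homset[OF g h]] H_functor_def compose_def
      transpose_natural[OF k g h] transpose_in_homset cong: restrict_cong)
qed

end

lemma (in category) right_adjoint_exists:
  assumes "is_functor (C \<times>\<^sub>C C) C T"
    and univ: "\<And>y z. y \<in> Obj C \<Longrightarrow> z \<in> Obj C \<Longrightarrow>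
      \<exists>H\<in>Obj C. \<exists>e\<in>homset C (OMap T (H, y)) z. \<forall>x\<in>Obj C. \<forall>f\<in>homset C (OMap T (x, y)) z.
        \<exists>!k. k \<in> homset C x H \<and> e \<cdot> AMap T (k, Ide C y) = f"
  shows "\<exists>Hom. is_functor (op_cat C \<times>\<^sub>C C) C Hom \<and>
    naturally_isomorphic (op_cat C \<times>\<^sub>C op_cat C \<times>\<^sub>C C) sets_cat (hom_tensor C T) (hom_right C Hom)"
proof -
  \<comment> \<open>One predicate on the pair of object and arrow lets choice select
    \<open>H\<close> and \<open>ev\<close> together.\<close>
  define universal where "universal H e y z \<longleftrightarrow> H \<in> Obj C \<and> e \<in> homset C (OMap T (H, y)) z \<and>
    (\<forall>x\<in>Obj C. \<forall>f\<in>homset C (OMap T (x, y)) z.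
      \<exists>!k. k \<in> homset C x H \<and> e \<cdot> AMap T (k, Ide C y) = f)" for H e y z
  have "\<exists>H e. universal H e y z" if "y \<in> Obj C" "z \<in> Obj C" for y z
    using univ[OF that] unfolding universal_def by (elim bexE) (intro exI conjI)
  then obtain H ev where u: "\<And>y z. y \<in> Obj C \<Longrightarrow> z \<in> Obj C \<Longrightarrow> universal (H y z) (ev y z) y z"
    by metis
  interpret closing C T H ev
    by unfold_locales (rule assms(1), use u in \<open>simp_all add: universal_def\<close>)
  show ?thesis
    using is_functor_H natural_iso_transpose unfolding naturally_isomorphic_def by blast
qed

text \<open>A left internal hom for a tensor is a right internal hom for the reversed tensor.\<close>

lemma (in category) biclosed_exists:
  assumes T: "is_functor (C \<times>\<^sub>C C) C T"
    and right: "\<And>y z. y \<in> Obj C \<Longrightarrow> z \<in> Obj C \<Longrightarrow>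
      \<exists>H\<in>Obj C. \<exists>e\<in>homset C (OMap T (H, y)) z. \<forall>x\<in>Obj C. \<forall>f\<in>homset C (OMap T (x, y)) z.
        \<exists>!k. k \<in> homset C x H \<and> e \<cdot> AMap T (k, Ide C y) = f"
    and left: "\<And>x z. x \<in> Obj C \<Longrightarrow> z \<in> Obj C \<Longrightarrow>
      \<exists>H\<in>Obj C. \<exists>e\<in>homset C (OMap T (x, H)) z. \<forall>y\<in>Obj C. \<forall>f\<in>homset C (OMap T (x, y)) z.
        \<exists>!k. k \<in> homset C y H \<and> e \<cdot> AMap T (Ide C x, k) = f"
  shows "\<exists>HomL HomR. is_functor (op_cat C \<times>\<^sub>C C) C HomL \<and> is_functor (op_cat C \<times>\<^sub>C C) C HomR \<and>
    naturally_isomorphic (op_cat C \<times>\<^sub>C op_cat C \<times>\<^sub>C C) sets_cat (hom_tensor C T) (hom_right C HomR) \<and>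
    naturally_isomorphic (op_cat C \<times>\<^sub>C op_cat C \<times>\<^sub>C C) sets_cat (hom_right C HomR) (hom_left C HomL)"
proof -
  let ?E = "op_cat C \<times>\<^sub>C op_cat C \<times>\<^sub>C C"
  obtain HomR where R: "is_functor (op_cat C \<times>\<^sub>C C) C HomR"
    "naturally_isomorphic ?E sets_cat (hom_tensor C T) (hom_right C HomR)"
    using right_adjoint_exists[OF T right] by auto
  let ?T' = "\<lparr>OMap = \<lambda>(y, x). OMap T (x, y), AMap = \<lambda>(g, f). AMap T (f, g)\<rparr>"
  have T': "is_functor (C \<times>\<^sub>C C) C ?T'"
  proof (rule is_functor_prodI)
    fix f f' g g' x x' x'' y y' y''
    assume "f \<in> homset C x x'" "f' \<in> homset C x' x''" "g \<in> homset C y y'" "g' \<in> homset C y' y''"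
    then show "AMap ?T' (f' \<cdot> f, g' \<cdot> g) = AMap ?T' (f', g') \<cdot> AMap ?T' (f, g)"
      using is_functor_prodD(4)[OF T] by simp
  qed (simp_all add: category_axioms is_functor_prodD(1-3)[OF T])
  obtain HomL where L: "is_functor (op_cat C \<times>\<^sub>C C) C HomL"
    and "naturally_isomorphic ?E sets_cat (hom_tensor C ?T') (hom_right C HomL)"
    using right_adjoint_exists[OF T'] left by auto
  then obtain t where t: "natural_iso ?E sets_cat (hom_tensor C ?T') (hom_right C HomL) t"
    unfolding naturally_isomorphic_def by blast
  \<comment> \<open>The adjunction for the reversed tensor lists the variables as
    \<open>(y, x, z)\<close>; this swap restores the order \<open>(x, y, z)\<close>.\<close>
  let ?K = "\<lparr>OMap = \<lambda>(x, y, z). (y, x, z), AMap = \<lambda>(f, g, h). (g, f, h)\<rparr>"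
  have "is_functor ?E ?E ?K"
    by (rule is_functor_prodI) (auto intro: category_prod category_op category_axioms)
  from natural_iso_comp_functor[OF t this]
  have "naturally_isomorphic ?E sets_cat (comp_functor (hom_tensor C ?T') ?K)
      (comp_functor (hom_right C HomL) ?K)"
    unfolding naturally_isomorphic_def by blast
  also have "comp_functor (hom_tensor C ?T') ?K = hom_tensor C T"
    by (auto simp: comp_functor_def hom_tensor_def)
  also have "comp_functor (hom_right C HomL) ?K = hom_left C HomL"
    by (auto simp: comp_functor_def hom_right_def hom_left_def)
  finally have "naturally_isomorphic ?E sets_cat (hom_right C HomR) (hom_left C HomL)"
    using naturally_isomorphic_trans[OF naturally_isomorphic_sym[OF R(2)]] by blast
  then show ?thesis
    using R L by blast
qed

section \<open>Presheaves\<close>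

lemma psh_map_eqI:
  assumes "presheaf_map A s" and "presheaf_map A t" and "Src s = Src t" and "Tgt s = Tgt t"
    and "\<And>a x. a \<in> Obj A \<Longrightarrow> x \<in> At (Src s) a \<Longrightarrow> Map s a x = Map t a x"
  shows "s = t"
proof -
  interpret s: presheaf_map A s by fact
  interpret t: presheaf_map A t by fact
  have "Map s = Map t"
  proof (rule extensionalityI[OF s.Map_extensional t.Map_extensional])
    fix a assume a: "a \<in> Obj A"
    show "Map s a = Map t a"
      using s.Map_maps[OF a] t.Map_maps[OF a, folded assms(3)] assms(5)[OF a]
      by (intro extensionalityI[of _ "At (Src s) a"]) (auto simp: PiE_def)
  qed
  then show ?thesis
    using assms(3,4) by simp
qed

lemma presheaf_cat_simps [simp]:
  "Obj (presheaf_cat A) = {X. presheaf A X}" "Arr (presheaf_cat A) = {t. presheaf_map A t}"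
  "Dom (presheaf_cat A) = Src" "Cod (presheaf_cat A) = Tgt"
  "t \<in> homset (presheaf_cat A) X Y \<longleftrightarrow> presheaf_map A t \<and> Src t = X \<and> Tgt t = Y"
  "Src (Ide (presheaf_cat A) X) = X" "Tgt (Ide (presheaf_cat A) X) = X"
  "Src (t' \<cdot>\<^bsub>presheaf_cat A\<^esub> t) = Src t" "Tgt (t' \<cdot>\<^bsub>presheaf_cat A\<^esub> t) = Tgt t'"
  by (auto simp: presheaf_cat_def homset_def)

lemma Map_Ide_presheaf_cat [simp]:
  "a \<in> Obj A \<Longrightarrow> x \<in> At X a \<Longrightarrow> Map (Ide (presheaf_cat A) X) a x = x"
  by (simp add: presheaf_cat_def)

lemma Map_Cmp_presheaf_cat [simp]:
  "a \<in> Obj A \<Longrightarrow> x \<in> At (Src t) a \<Longrightarrow>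
    Map (t' \<cdot>\<^bsub>presheaf_cat A\<^esub> t) a x = Map t' a (Map t a x)"
  by (simp add: presheaf_cat_def compose_def)

context
  fixes A :: "('o, 'm) cat" (structure)
  assumes A: "category A"
begin

interpretation category A
  by (rule A)

lemma presheaf_map_Ide:
  assumes "presheaf A X"
  shows "presheaf_map A (Ide (presheaf_cat A) X)"
proof -
  interpret presheaf A X by fact
  show ?thesis
    using assms Res_maps homset_Obj
    by (intro presheaf_map.intro) (auto simp: presheaf_cat_def)
qed

lemma presheaf_map_Cmp:
  assumes "presheaf_map A s" and "presheaf_map A t" and "Tgt s = Src t"
  shows "presheaf_map A (t \<cdot>\<^bsub>presheaf_cat A\<^esub> s)"
proof -
  interpret s: presheaf_map A s by fact
  interpret t: presheaf_map A t by fact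
  interpret S: presheaf A "Src s" by (rule s.Src_presheaf)
  note sm = s.Map_maps[THEN PiE_mem] and tm = t.Map_maps[THEN PiE_mem]
  show ?thesis
  proof (rule presheaf_map.intro)
    show "Map (t \<cdot>\<^bsub>presheaf_cat A\<^esub> s) \<in> extensional (Obj A)"
      by (simp add: presheaf_cat_def)
  next
    fix a assume a: "a \<in> Obj A"
    then show "Map (t \<cdot>\<^bsub>presheaf_cat A\<^esub> s) a \<in> At (Src (t \<cdot>\<^bsub>presheaf_cat A\<^esub> s)) a
        \<rightarrow>\<^sub>E At (Tgt (t \<cdot>\<^bsub>presheaf_cat A\<^esub> s)) a"
      using sm[OF a] tm[OF a] assms(3)
      by (intro PiE_I) (simp_all add: presheaf_cat_def compose_def)
  next
    fix f a b x assume f: "f \<in> homset A a b" and "x \<in> At (Src (t \<cdot>\<^bsub>presheaf_cat A\<^esub> s)) b"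
    then have x: "x \<in> At (Src s) b"
      by simp
    note ab = homset_Obj[OF f]
    show "Map (t \<cdot>\<^bsub>presheaf_cat A\<^esub> s) a (Res (Src (t \<cdot>\<^bsub>presheaf_cat A\<^esub> s)) f x) =
        Res (Tgt (t \<cdot>\<^bsub>presheaf_cat A\<^esub> s)) f (Map (t \<cdot>\<^bsub>presheaf_cat A\<^esub> s) b x)"
      using S.Res_maps[OF f, THEN PiE_mem, OF x] x sm[OF ab(2) x] ab assms(3)
      by (simp add: s.Map_natural[OF f x] t.Map_natural[OF f])
  qed (simp_all add: s.Src_presheaf t.Tgt_presheaf)
qed

lemma category_presheaf_cat: "category (presheaf_cat A)"
proof unfold_locales
  fix t assume "t \<in> Arr (presheaf_cat A)"
  then show "Dom (presheaf_cat A) t \<in> Obj (presheaf_cat A)" "Cod (presheaf_cat A) t \<in> Obj (presheaf_cat A)"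
    by (auto intro: presheaf_map.Src_presheaf presheaf_map.Tgt_presheaf)
next
  fix X assume "X \<in> Obj (presheaf_cat A)"
  then show "Ide (presheaf_cat A) X \<in> homset (presheaf_cat A) X X"
    by (simp add: presheaf_map_Ide)
next
  fix s t X Y Z assume "s \<in> homset (presheaf_cat A) X Y" "t \<in> homset (presheaf_cat A) Y Z"
  then show "t \<cdot>\<^bsub>presheaf_cat A\<^esub> s \<in> homset (presheaf_cat A) X Z"
    by (simp add: presheaf_map_Cmp)
next
  fix t X Y assume "t \<in> homset (presheaf_cat A) X Y"
  then have t: "presheaf_map A t" "Src t = X" "Tgt t = Y"
    by auto
  then interpret presheaf_map A t by simp
  note m = Map_maps[THEN PiE_mem]
  show "t \<cdot>\<^bsub>presheaf_cat A\<^esub> Ide (presheaf_cat A) X = t" "Ide (presheaf_cat A) Y \<cdot>\<^bsub>presheaf_cat A\<^esub> t = t"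
    using Src_presheaf Tgt_presheaf t(1) unfolding t(2,3)[symmetric]
    by (auto intro!: psh_map_eqI presheaf_map_Cmp presheaf_map_Ide simp: m)
next
  fix s t u W X Y Z assume "s \<in> homset (presheaf_cat A) W X" "t \<in> homset (presheaf_cat A) X Y"
    "u \<in> homset (presheaf_cat A) Y Z"
  then have st: "presheaf_map A s" "Src s = W" "Tgt s = X" "presheaf_map A t" "Src t = X" "Tgt t = Y"
    "presheaf_map A u" "Src u = Y" "Tgt u = Z"
    by auto
  note m = presheaf_map.Map_maps[OF st(1), THEN PiE_mem]
  show "(u \<cdot>\<^bsub>presheaf_cat A\<^esub> t) \<cdot>\<^bsub>presheaf_cat A\<^esub> s = u \<cdot>\<^bsub>presheaf_cat A\<^esub> (t \<cdot>\<^bsub>presheaf_cat A\<^esub> s)"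
    using st presheaf_map.Map_maps[OF st(4), THEN PiE_mem]
    by (auto intro!: psh_map_eqI presheaf_map_Cmp simp: m)
qed

lemma terminal_object_terminal_psh:
  "terminal_object (presheaf_cat A) (terminal_psh A :: ('o, 'm, 'u::set_universe) psh)"
  (is "terminal_object _ ?T")
proof -
  have T: "presheaf A ?T"
    using homset_Obj Cmp_in_homset Ide_in_homset
    by unfold_locales (auto simp: terminal_psh_def homset_iff small_singleton)
  have "\<exists>!t. t \<in> homset (presheaf_cat A) X ?T" if X: "presheaf A X" for X
  proof -
    interpret presheaf A X by fact
    let ?t = "\<lparr>Src = X, Tgt = ?T, Map = \<lambda>a\<in>Obj A. \<lambda>x\<in>At X a. mkset {}\<rparr>"
    have t: "presheaf_map A ?t"
      using X T homset_Obj Res_maps[THEN PiE_mem]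
      by (intro presheaf_map.intro) (auto simp: terminal_psh_def homset_iff)
    show ?thesis
    proof (rule ex1I)
      show "?t \<in> homset (presheaf_cat A) X ?T"
        using t by simp
    next
      fix s assume "s \<in> homset (presheaf_cat A) X ?T"
      then have s: "presheaf_map A s" "Src s = X" "Tgt s = ?T"
        by auto
      show "s = ?t"
      proof (rule psh_map_eqI[OF s(1) t])
        fix a x assume "a \<in> Obj A" "x \<in> At (Src s) a"
        then show "Map s a x = Map ?t a x"
          using presheaf_map.Map_maps[OF s(1), THEN PiE_mem, of a x] s by (simp add: terminal_psh_def)
      qed (use s in auto)
    qed
  qed
  with T show ?thesis
    by (auto simp: terminal_object_def)
qed

end

section \<open>Presheaves over a crossed group\<close>

text \<open>Raw families are cut down to their domains here once, as the convention on
  \<open>undefined\<close> values demands; later proofs argue with the raw families alone. A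
  restriction map is given only \<open>\<phi>\<close>, so its domain is read off from
  \<open>Cod A \<phi>\<close>.\<close>

definition mkobj :: "('o, 'm) cat \<Rightarrow> ('o, 'm, 'u::set_universe) crossed_grp \<Rightarrow> ('o \<Rightarrow> 'u set) \<Rightarrow>
    ('m \<Rightarrow> 'u \<Rightarrow> 'u) \<Rightarrow> ('o \<Rightarrow> 'u \<Rightarrow> 'u) \<Rightarrow> ('o, 'm, 'u) over_obj"
  where "mkobj A G S R m = \<lparr>Src = \<lparr>At = \<lambda>a\<in>Obj A. S a, Res = \<lambda>\<phi>\<in>Arr A. \<lambda>x\<in>S (Cod A \<phi>). R \<phi> x\<rparr>,
    Tgt = Und G, Map = \<lambda>a\<in>Obj A. \<lambda>x\<in>S a. m a x\<rparr>"

definition mkarr :: "('o, 'm) cat \<Rightarrow> ('o, 'm, 'u::set_universe) over_obj \<Rightarrow> ('o, 'm, 'u) over_obj \<Rightarrow>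
    ('o \<Rightarrow> 'u \<Rightarrow> 'u) \<Rightarrow> ('o, 'm, 'u) over_arr"
  where "mkarr A p q h = (p, q, \<lparr>Src = Src p, Tgt = Src q, Map = \<lambda>a\<in>Obj A. \<lambda>x\<in>At (Src p) a. h a x\<rparr>)"

definition app :: "('o, 'm, 'u) over_arr \<Rightarrow> 'o \<Rightarrow> 'u \<Rightarrow> 'u"
  where "app F = Map (snd (snd F))"

locale crossed_group_category = category A + crossed_group A G
  for A :: "('o, 'm) cat" (structure) and G :: "('o, 'm, 'u::set_universe) crossed_grp"
begin

section \<open>Consequences of the crossed group axioms\<close>

lemma G_closed: "x \<in> At (Und G) b \<Longrightarrow> y \<in> At (Und G) b \<Longrightarrow> b \<in> Obj A \<Longrightarrow>
    x \<otimes>\<^bsub>Grp G b\<^esub> y \<in> At (Und G) b"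
  using Grp_group[THEN group.is_monoid, THEN monoid.m_closed] Grp_carrier by blast

lemma G_one: "b \<in> Obj A \<Longrightarrow> \<one>\<^bsub>Grp G b\<^esub> \<in> At (Und G) b"
  using Grp_group[THEN group.is_monoid, THEN monoid.one_closed] Grp_carrier by blast

lemma Res_in: "\<phi> \<in> homset A a b \<Longrightarrow> x \<in> At (Und G) b \<Longrightarrow> Res (Und G) \<phi> x \<in> At (Und G) a"
  using presheaf.Res_maps[OF Und_presheaf] by blast

text \<open>\<open>Act_action\<close> speaks of a homomorphism into the permutations of a homset;
  these are its consequences for single arrows, free of the restriction to that homset.\<close>

lemma
  assumes \<phi>: "\<phi> \<in> homset A a b"
  shows Act_in_homset: "x \<in> At (Und G) b \<Longrightarrow> Act G x \<phi> \<in> homset A a b"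
    and Act_mult: "x \<in> At (Und G) b \<Longrightarrow> y \<in> At (Und G) b \<Longrightarrow>
      Act G (x \<otimes>\<^bsub>Grp G b\<^esub> y) \<phi> = Act G x (Act G y \<phi>)"
    and Act_one: "Act G \<one>\<^bsub>Grp G b\<^esub> \<phi> = \<phi>"
proof -
  note ab = homset_Obj[OF \<phi>]
  interpret act: group_action "Grp G b" "homset A a b" "\<lambda>x. \<lambda>\<phi>\<in>homset A a b. Act G x \<phi>"
    by (rule Act_action[OF ab])
  show in_homset: "Act G x \<phi> \<in> homset A a b" if "x \<in> At (Und G) b" for x
    using act.element_image[of x \<phi>] \<phi> that by (simp add: Grp_carrier[OF ab(2)])
  show "Act G (x \<otimes>\<^bsub>Grp G b\<^esub> y) \<phi> = Act G x (Act G y \<phi>)"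
    if "x \<in> At (Und G) b" "y \<in> At (Und G) b"
    using act.composition_rule[of \<phi> x y] in_homset[OF that(2)] \<phi> that by (simp add: Grp_carrier[OF ab(2)])
  show "Act G \<one>\<^bsub>Grp G b\<^esub> \<phi> = \<phi>"
    using fun_cong[OF act.id_eq_one, of \<phi>] \<phi> by simp
qed

text \<open>Apply \<open>Act_Cmp\<close> to \<open>\<psi> = Ide A b\<close> and to the \<open>\<phi>\<close> that \<open>x\<close> moves to \<open>Ide A b\<close>.\<close>

lemma Act_Ide:
  assumes b: "b \<in> Obj A" and x: "x \<in> At (Und G) b"
  shows "Act G x (Ide A b) = Ide A b"
proof -
  interpret g: group "Grp G b" by (rule Grp_group[OF b])
  note I = Ide_in_homset[OF b]
  let ?x' = "inv\<^bsub>Grp G b\<^esub> x"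
  have x': "?x' \<in> At (Und G) b"
    using x g.inv_closed by (simp add: Grp_carrier[OF b])
  have J: "Act G x (Act G ?x' (Ide A b)) = Ide A b"
    using Act_mult[OF I x x'] Act_one[OF I] g.r_inv[of x] x by (simp add: Grp_carrier[OF b])
  note h = Act_in_homset[OF I x'] Act_in_homset[OF I x]
  have "Act G x (Ide A b) \<cdot> Act G (Res (Und G) (Ide A b) x) (Act G ?x' (Ide A b))
      = Act G x (Ide A b \<cdot> Act G ?x' (Ide A b))"
    by (rule Act_Cmp[OF h(1) I x, symmetric])
  then have "Act G x (Ide A b) \<cdot> Ide A b = Ide A b"
    using J by (simp add: presheaf.Res_Ide[OF Und_presheaf b x] Cmp_Ide_left[OF h(1)])
  then show ?thesis
    by (simp add: Cmp_Ide_right[OF h(2)])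
qed

text \<open>Axiom (ii) at a pair of units, where the action is trivial, makes the restricted unit
  idempotent, and a group has only one idempotent. Naturality of the unit map rests on this.\<close>

lemma Res_one:
  assumes \<phi>: "\<phi> \<in> homset A a b"
  shows "Res (Und G) \<phi> \<one>\<^bsub>Grp G b\<^esub> = \<one>\<^bsub>Grp G a\<^esub>"
proof -
  note ab = homset_Obj[OF \<phi>]
  interpret a: group "Grp G a" by (rule Grp_group[OF ab(1)])
  interpret b: group "Grp G b" by (rule Grp_group[OF ab(2)])
  let ?e = "Res (Und G) \<phi> \<one>\<^bsub>Grp G b\<^esub>"
  have "?e \<in> carrier (Grp G a)"
    using Res_in[OF \<phi> G_one[OF ab(2)]] by (simp add: Grp_carrier[OF ab(1)])
  moreover have "?e \<otimes>\<^bsub>Grp G a\<^esub> ?e = ?e"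
    using Res_mult[OF \<phi> G_one[OF ab(2)] G_one[OF ab(2)]] Act_one[OF \<phi>] by simp
  ultimately show ?thesis
    by (metis a.l_cancel_one)
qed

section \<open>Objects and arrows over G, elementwise\<close>

lemma category_over: "category (over_cat A G)"
  unfolding over_cat_def by (intro category_slice category_presheaf_cat category_axioms)

lemma over_Obj_iff: "p \<in> Obj (over_cat A G) \<longleftrightarrow> presheaf_map A p \<and> Tgt p = Und G"
  by (auto simp: over_cat_def slice_cat_def)

lemma over_homset_iff:
  "F \<in> homset (over_cat A G) p q \<longleftrightarrow> p \<in> Obj (over_cat A G) \<and> q \<in> Obj (over_cat A G) \<and>
    (\<exists>f. F = (p, q, f) \<and> presheaf_map A f \<and> Src f = Src p \<and> Tgt f = Src q \<and>
      (\<forall>a\<in>Obj A. \<forall>x\<in>At (Src p) a. Map q a (Map f a x) = Map p a x))"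
proof -
  have "q \<cdot>\<^bsub>presheaf_cat A\<^esub> f = p \<longleftrightarrow>
      (\<forall>a\<in>Obj A. \<forall>x\<in>At (Src p) a. Map q a (Map f a x) = Map p a x)"
    if "presheaf_map A f" "Src f = Src p" "Tgt f = Src q" "presheaf_map A p" "Tgt p = Und G"
      "presheaf_map A q" "Tgt q = Und G" for f
  proof
    assume "q \<cdot>\<^bsub>presheaf_cat A\<^esub> f = p"
    then show "\<forall>a\<in>Obj A. \<forall>x\<in>At (Src p) a. Map q a (Map f a x) = Map p a x"
      using that by (metis Map_Cmp_presheaf_cat)
  next
    assume "\<forall>a\<in>Obj A. \<forall>x\<in>At (Src p) a. Map q a (Map f a x) = Map p a x"
    then show "q \<cdot>\<^bsub>presheaf_cat A\<^esub> f = p"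
      using that by (intro psh_map_eqI[OF presheaf_map_Cmp[OF category_axioms]]) auto
  qed
  then show ?thesis
    unfolding over_cat_def homset_slice_iff by (auto simp: slice_cat_def)
qed

context
  fixes p assumes p: "p \<in> Obj (over_cat A G)"
begin

interpretation p: presheaf_map A p
  using p by (simp add: over_Obj_iff)

interpretation X: presheaf A "Src p"
  by (rule p.Src_presheaf)

lemma over_At_small: "a \<in> Obj A \<Longrightarrow> At (Src p) a \<in> range elts"
  by (rule X.At_small)

lemma over_Res_in: "\<phi> \<in> homset A a b \<Longrightarrow> x \<in> At (Src p) b \<Longrightarrow> Res (Src p) \<phi> x \<in> At (Src p) a"
  by (rule X.Res_maps[THEN PiE_mem])

lemma over_Res_Ide: "a \<in> Obj A \<Longrightarrow> x \<in> At (Src p) a \<Longrightarrow> Res (Src p) (Ide A a) x = x"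
  by (rule X.Res_Ide)

lemma over_Res_Cmp: "\<phi> \<in> homset A a b \<Longrightarrow> \<psi> \<in> homset A b c \<Longrightarrow> x \<in> At (Src p) c \<Longrightarrow>
    Res (Src p) (\<psi> \<cdot> \<phi>) x = Res (Src p) \<phi> (Res (Src p) \<psi> x)"
  by (rule X.Res_Cmp)

lemma over_Map_in: "a \<in> Obj A \<Longrightarrow> x \<in> At (Src p) a \<Longrightarrow> Map p a x \<in> At (Und G) a"
  using p.Map_maps[THEN PiE_mem] p by (simp add: over_Obj_iff)

lemma over_Map_Res: "\<phi> \<in> homset A a b \<Longrightarrow> x \<in> At (Src p) b \<Longrightarrow>
    Map p a (Res (Src p) \<phi> x) = Res (Und G) \<phi> (Map p b x)"
  using p.Map_natural p by (simp add: over_Obj_iff)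

end

lemma mkobj_in_Obj:
  assumes "\<And>a. a \<in> Obj A \<Longrightarrow> S a \<in> range elts"
    and R: "\<And>\<phi> a b x. \<phi> \<in> homset A a b \<Longrightarrow> x \<in> S b \<Longrightarrow> R \<phi> x \<in> S a"
    and "\<And>a x. a \<in> Obj A \<Longrightarrow> x \<in> S a \<Longrightarrow> R (Ide A a) x = x"
    and Cmp: "\<And>\<phi> \<psi> a b c x. \<phi> \<in> homset A a b \<Longrightarrow> \<psi> \<in> homset A b c \<Longrightarrow> x \<in> S c \<Longrightarrow>
      R (\<psi> \<cdot> \<phi>) x = R \<phi> (R \<psi> x)"
    and m: "\<And>a x. a \<in> Obj A \<Longrightarrow> x \<in> S a \<Longrightarrow> m a x \<in> At (Und G) a"
    and nat: "\<And>\<phi> a b x. \<phi> \<in> homset A a b \<Longrightarrow> x \<in> S b \<Longrightarrow> m a (R \<phi> x) = Res (Und G) \<phi> (m b x)"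
  shows "mkobj A G S R m \<in> Obj (over_cat A G)"
proof -
  let ?X = "\<lparr>At = \<lambda>a\<in>Obj A. S a, Res = \<lambda>\<phi>\<in>Arr A. \<lambda>x\<in>S (Cod A \<phi>). R \<phi> x\<rparr>"
  have X: "presheaf A ?X"
  proof unfold_locales
    fix f a b assume f: "f \<in> homset A a b"
    then show "Res ?X f \<in> At ?X b \<rightarrow>\<^sub>E At ?X a"
      using homset_Obj[OF f] R[OF f] by (auto simp: homset_iff)
  next
    fix f a b g c x assume f: "f \<in> homset A a b" and g: "g \<in> homset A b c" and "x \<in> At ?X c"
    then show "Res ?X (g \<cdot> f) x = Res ?X f (Res ?X g x)"
      using homset_Obj[OF g] Cmp_in_homset[OF f g] R[OF g] Cmp[OF f g] by (auto simp: homset_iff)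
  qed (use assms Ide_in_homset in \<open>auto simp: homset_iff\<close>)
  have "presheaf_map A (mkobj A G S R m)"
  proof (rule presheaf_map.intro)
    fix f a b x assume f: "f \<in> homset A a b" and "x \<in> At (Src (mkobj A G S R m)) b"
    then show "Map (mkobj A G S R m) a (Res (Src (mkobj A G S R m)) f x) =
        Res (Tgt (mkobj A G S R m)) f (Map (mkobj A G S R m) b x)"
      using homset_Obj[OF f] R[OF f] nat[OF f] by (auto simp: homset_iff mkobj_def)
  qed (use X Und_presheaf m in \<open>auto simp: mkobj_def\<close>)
  then show ?thesis
    by (simp add: over_Obj_iff mkobj_def)
qed

lemma mkobj_simps:
  "a \<in> Obj A \<Longrightarrow> At (Src (mkobj A G S R m)) a = S a"
  "\<phi> \<in> homset A a b \<Longrightarrow> x \<in> S b \<Longrightarrow> Res (Src (mkobj A G S R m)) \<phi> x = R \<phi> x"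
  "a \<in> Obj A \<Longrightarrow> x \<in> S a \<Longrightarrow> Map (mkobj A G S R m) a x = m a x"
  by (auto simp: mkobj_def homset_iff)

lemma mkarr_in_homset:
  assumes p: "p \<in> Obj (over_cat A G)" and q: "q \<in> Obj (over_cat A G)"
    and h: "\<And>a x. a \<in> Obj A \<Longrightarrow> x \<in> At (Src p) a \<Longrightarrow> h a x \<in> At (Src q) a"
    and nat: "\<And>\<phi> a b x. \<phi> \<in> homset A a b \<Longrightarrow> x \<in> At (Src p) b \<Longrightarrow>
      h a (Res (Src p) \<phi> x) = Res (Src q) \<phi> (h b x)"
    and over: "\<And>a x. a \<in> Obj A \<Longrightarrow> x \<in> At (Src p) a \<Longrightarrow> Map q a (h a x) = Map p a x"
  shows "mkarr A p q h \<in> homset (over_cat A G) p q"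
proof -
  let ?f = "\<lparr>Src = Src p, Tgt = Src q, Map = \<lambda>a\<in>Obj A. \<lambda>x\<in>At (Src p) a. h a x\<rparr>"
  have "presheaf_map A ?f"
  proof (rule presheaf_map.intro)
    fix f a b x assume f: "f \<in> homset A a b" and "x \<in> At (Src ?f) b"
    then show "Map ?f a (Res (Src ?f) f x) = Res (Tgt ?f) f (Map ?f b x)"
      using homset_Obj[OF f] over_Res_in[OF p f] nat[OF f] by simp
  qed (use p q h in \<open>auto simp: over_Obj_iff intro: presheaf_map.Src_presheaf\<close>)
  then show ?thesis
    using p q over by (simp add: mkarr_def over_homset_iff)
qed

lemma app_mkarr: "a \<in> Obj A \<Longrightarrow> x \<in> At (Src p) a \<Longrightarrow> app (mkarr A p q h) a x = h a x"
  by (simp add: app_def mkarr_def)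

lemma
  assumes "F \<in> homset (over_cat A G) p q"
  shows app_in: "a \<in> Obj A \<Longrightarrow> x \<in> At (Src p) a \<Longrightarrow> app F a x \<in> At (Src q) a"
    and app_Res: "\<phi> \<in> homset A a b \<Longrightarrow> x \<in> At (Src p) b \<Longrightarrow>
      app F a (Res (Src p) \<phi> x) = Res (Src q) \<phi> (app F b x)"
    and Map_app: "a \<in> Obj A \<Longrightarrow> x \<in> At (Src p) a \<Longrightarrow> Map q a (app F a x) = Map p a x"
proof -
  obtain f where F: "F = (p, q, f)" "presheaf_map A f" "Src f = Src p" "Tgt f = Src q"
    "\<forall>a\<in>Obj A. \<forall>x\<in>At (Src p) a. Map q a (Map f a x) = Map p a x"
    using assms unfolding over_homset_iff by auto
  interpret f: presheaf_map A f by (rule F(2))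
  show "a \<in> Obj A \<Longrightarrow> x \<in> At (Src p) a \<Longrightarrow> app F a x \<in> At (Src q) a"
    "\<phi> \<in> homset A a b \<Longrightarrow> x \<in> At (Src p) b \<Longrightarrow> app F a (Res (Src p) \<phi> x) = Res (Src q) \<phi> (app F b x)"
    "a \<in> Obj A \<Longrightarrow> x \<in> At (Src p) a \<Longrightarrow> Map q a (app F a x) = Map p a x"
    using F f.Map_maps[THEN PiE_mem, of a x] f.Map_natural[of \<phi> a b x] by (auto simp: app_def)
qed

lemma over_arr_eqI:
  assumes "F \<in> homset (over_cat A G) p q" and "F' \<in> homset (over_cat A G) p q"
    and "\<And>a x. a \<in> Obj A \<Longrightarrow> x \<in> At (Src p) a \<Longrightarrow> app F a x = app F' a x"
  shows "F = F'"
  using assms unfolding over_homset_iff app_def by (auto intro!: psh_map_eqI)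

lemma app_Ide: "a \<in> Obj A \<Longrightarrow> x \<in> At (Src p) a \<Longrightarrow> app (Ide (over_cat A G) p) a x = x"
  by (simp add: over_cat_def Ide_slice app_def)

lemma app_Cmp:
  assumes "F \<in> homset (over_cat A G) p q" and "F' \<in> homset (over_cat A G) q r"
    and "a \<in> Obj A" and "x \<in> At (Src p) a"
  shows "app (F' \<cdot>\<^bsub>over_cat A G\<^esub> F) a x = app F' a (app F a x)"
  using assms unfolding over_homset_iff by (auto simp: over_cat_def Cmp_slice app_def)

text \<open>Degreewise inverses suffice: they inherit naturality and compatibility with the maps to
  G from the arrow itself.\<close>

lemma iso_arrow_over:
  assumes F: "F \<in> homset (over_cat A G) p q"
    and bij: "\<And>a. a \<in> Obj A \<Longrightarrow> bij_betw (app F a) (At (Src p) a) (At (Src q) a)"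
  shows "iso_arrow (over_cat A G) F"
proof -
  interpret O: category "over_cat A G" by (rule category_over)
  note pq = O.homset_Obj[OF F]
  let ?k = "\<lambda>a. inv_into (At (Src p) a) (app F a)"
  have k: "?k a y \<in> At (Src p) a" "app F a (?k a y) = y" if "a \<in> Obj A" "y \<in> At (Src q) a" for a y
    using bij[OF that(1)] that(2) by (auto simp: bij_betw_def inv_into_into f_inv_into_f)
  have k': "?k a (app F a x) = x" if "a \<in> Obj A" "x \<in> At (Src p) a" for a x
    using bij[OF that(1)] that(2) by (auto simp: bij_betw_def)
  have K: "mkarr A q p ?k \<in> homset (over_cat A G) q p"
  proof (rule mkarr_in_homset[OF pq(2,1)])
    fix \<phi> a b y assume \<phi>: "\<phi> \<in> homset A a b" and y: "y \<in> At (Src q) b"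
    note ab = homset_Obj[OF \<phi>]
    have "app F a (Res (Src p) \<phi> (?k b y)) = Res (Src q) \<phi> y"
      using app_Res[OF F \<phi> k(1)[OF ab(2) y]] k(2)[OF ab(2) y] by simp
    then show "?k a (Res (Src q) \<phi> y) = Res (Src p) \<phi> (?k b y)"
      using k'[OF ab(1) over_Res_in[OF pq(1) \<phi> k(1)[OF ab(2) y]]] by simp
  next
    fix a y assume "a \<in> Obj A" "y \<in> At (Src q) a"
    then show "Map p a (?k a y) = Map q a y"
      using Map_app[OF F, of a "?k a y"] k by simp
  qed (rule k)
  have "mkarr A q p ?k \<cdot>\<^bsub>over_cat A G\<^esub> F = Ide (over_cat A G) p"
    by (rule over_arr_eqI[OF O.Cmp_in_homset[OF F K] O.Ide_in_homset[OF pq(1)]])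
      (simp add: app_Cmp[OF F K] app_mkarr app_in[OF F] k' app_Ide)
  moreover have "F \<cdot>\<^bsub>over_cat A G\<^esub> mkarr A q p ?k = Ide (over_cat A G) q"
    by (rule over_arr_eqI[OF O.Cmp_in_homset[OF K F] O.Ide_in_homset[OF pq(2)]])
      (simp add: app_Cmp[OF K F] app_mkarr k app_Ide)
  ultimately show ?thesis
    using F K unfolding iso_arrow_def by (auto simp: homset_iff)
qed

section \<open>The twisted product\<close>

lemma twist_obj_eq_mkobj:
  "twist_obj A G p q = mkobj A G (\<lambda>a. vtimes (At (Src p) a) (At (Src q) a))
    (\<lambda>\<phi> z. vpair (Res (Src p) (Act G (Map q (Cod A \<phi>) (vsnd z)) \<phi>) (vfst z)) (Res (Src q) \<phi> (vsnd z)))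
    (\<lambda>a z. Map p a (vfst z) \<otimes>\<^bsub>Grp G a\<^esub> Map q a (vsnd z))"
  by (simp add: twist_obj_def twist_psh_def mkobj_def)

lemma unit_obj_eq_mkobj:
  "unit_obj A G = mkobj A G (\<lambda>a. {mkset {}}) (\<lambda>\<phi> x. mkset {}) (\<lambda>a x. \<one>\<^bsub>Grp G a\<^esub>)"
  by (simp add: unit_obj_def terminal_psh_def mkobj_def)

lemma unit_in_Obj: "unit_obj A G \<in> Obj (over_cat A G)"
  unfolding unit_obj_eq_mkobj by (rule mkobj_in_Obj) (auto simp: small_singleton G_one Res_one)

lemma unit_simps:
  "a \<in> Obj A \<Longrightarrow> At (Src (unit_obj A G)) a = {mkset {}}"
  "\<phi> \<in> homset A a b \<Longrightarrow> Res (Src (unit_obj A G)) \<phi> (mkset {}) = mkset {}"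
  "a \<in> Obj A \<Longrightarrow> Map (unit_obj A G) a (mkset {}) = \<one>\<^bsub>Grp G a\<^esub>"
  by (simp_all add: unit_obj_eq_mkobj mkobj_simps)

lemma At_twist: "a \<in> Obj A \<Longrightarrow> At (Src (twist_obj A G p q)) a = vtimes (At (Src p) a) (At (Src q) a)"
  by (simp add: twist_obj_eq_mkobj mkobj_simps)

lemma Res_twist:
  assumes "\<phi> \<in> homset A a b" and "x \<in> At (Src p) b" and "y \<in> At (Src q) b"
  shows "Res (Src (twist_obj A G p q)) \<phi> (vpair x y) =
    vpair (Res (Src p) (Act G (Map q b y) \<phi>) x) (Res (Src q) \<phi> y)"
proof -
  have "Cod A \<phi> = b"
    using assms(1) by (simp add: homset_iff)
  then show ?thesis
    using assms(2,3) by (simp add: twist_obj_eq_mkobj mkobj_simps(2)[OF assms(1)])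
qed

lemma Map_twist:
  "a \<in> Obj A \<Longrightarrow> x \<in> At (Src p) a \<Longrightarrow> y \<in> At (Src q) a \<Longrightarrow>
    Map (twist_obj A G p q) a (vpair x y) = Map p a x \<otimes>\<^bsub>Grp G a\<^esub> Map q a y"
  by (simp add: twist_obj_eq_mkobj mkobj_simps)

lemma twist_in_Obj:
  assumes p: "p \<in> Obj (over_cat A G)" and q: "q \<in> Obj (over_cat A G)"
  shows "twist_obj A G p q \<in> Obj (over_cat A G)"
  unfolding twist_obj_eq_mkobj
proof (rule mkobj_in_Obj)
  fix a assume "a \<in> Obj A"
  then show "vtimes (At (Src p) a) (At (Src q) a) \<in> range elts"
    by (intro small_vtimes over_At_small p q)
next
  fix \<phi> a b z assume \<phi>: "\<phi> \<in> homset A a b" and "z \<in> vtimes (At (Src p) b) (At (Src q) b)"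
  then obtain x y where [simp]: "z = vpair x y" and x: "x \<in> At (Src p) b" and y: "y \<in> At (Src q) b"
    by auto
  note ab = homset_Obj[OF \<phi>]
  have [simp]: "Cod A \<phi> = b" "Dom A \<phi> = a"
    using \<phi> by (auto simp: homset_iff)
  note m = over_Map_in[OF q ab(2) y] and act = Act_in_homset[OF \<phi> over_Map_in[OF q ab(2) y]]
  show "vpair (Res (Src p) (Act G (Map q (Cod A \<phi>) (vsnd z)) \<phi>) (vfst z)) (Res (Src q) \<phi> (vsnd z))
      \<in> vtimes (At (Src p) a) (At (Src q) a)"
    using over_Res_in[OF p act x] over_Res_in[OF q \<phi> y] by simp
  \<comment> \<open>This is axiom (ii): its first factor is restricted along \<open>\<phi>\<close>
    twisted by the image of \<open>y\<close>, exactly as the first component of the pair.\<close>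
  show "Map p a (vfst (vpair (Res (Src p) (Act G (Map q (Cod A \<phi>) (vsnd z)) \<phi>) (vfst z)) (Res (Src q) \<phi> (vsnd z))))
      \<otimes>\<^bsub>Grp G a\<^esub>
      Map q a (vsnd (vpair (Res (Src p) (Act G (Map q (Cod A \<phi>) (vsnd z)) \<phi>) (vfst z)) (Res (Src q) \<phi> (vsnd z)))) =
      Res (Und G) \<phi> (Map p b (vfst z) \<otimes>\<^bsub>Grp G b\<^esub> Map q b (vsnd z))"
    using over_Map_Res[OF p act x] over_Map_Res[OF q \<phi> y] Res_mult[OF \<phi> over_Map_in[OF p ab(2) x] m]
    by simp
next
  fix a z assume a: "a \<in> Obj A" and "z \<in> vtimes (At (Src p) a) (At (Src q) a)"
  then obtain x y where [simp]: "z = vpair x y" and x: "x \<in> At (Src p) a" and y: "y \<in> At (Src q) a"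
    by auto
  \<comment> \<open>The identity law holds because the twist leaves the identity arrow in place, by
    \<open>Act_Ide\<close>.\<close>
  show "vpair (Res (Src p) (Act G (Map q (Cod A (Ide A a)) (vsnd z)) (Ide A a)) (vfst z))
      (Res (Src q) (Ide A a) (vsnd z)) = z"
    using Ide_in_homset[OF a] Act_Ide[OF a over_Map_in[OF q a y]] over_Res_Ide[OF p a x] over_Res_Ide[OF q a y]
    by (simp add: homset_iff)
  show "Map p a (vfst z) \<otimes>\<^bsub>Grp G a\<^esub> Map q a (vsnd z) \<in> At (Und G) a"
    using G_closed[OF over_Map_in[OF p a x] over_Map_in[OF q a y] a] by simp
next
  fix \<phi> \<psi> a b c z
  assume \<phi>: "\<phi> \<in> homset A a b" and \<psi>: "\<psi> \<in> homset A b c" and "z \<in> vtimes (At (Src p) c) (At (Src q) c)"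
  then obtain x y where [simp]: "z = vpair x y" and x: "x \<in> At (Src p) c" and y: "y \<in> At (Src q) c"
    by auto
  have [simp]: "Cod A \<phi> = b" "Cod A \<psi> = c" "Cod A (\<psi> \<cdot> \<phi>) = c"
    using \<phi> \<psi> Cmp_in_homset[OF \<phi> \<psi>] by (auto simp: homset_iff)
  note bc = homset_Obj[OF \<psi>]
  note m = over_Map_in[OF q bc(2) y]
  \<comment> \<open>Axiom (i) splits the twisted composite. Its second factor is
    \<open>\<phi>\<close> twisted by the restriction along \<open>\<psi>\<close> of the image of
    \<open>y\<close>, which is the image of the restricted \<open>y\<close> since \<open>q\<close>
    is natural.\<close>
  have "Res (Src p) (Act G (Map q c y) (\<psi> \<cdot> \<phi>)) x =
      Res (Src p) (Act G (Map q b (Res (Src q) \<psi> y)) \<phi>) (Res (Src p) (Act G (Map q c y) \<psi>) x)"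
    unfolding Act_Cmp[OF \<phi> \<psi> m] over_Map_Res[OF q \<psi> y]
    by (rule over_Res_Cmp[OF p Act_in_homset[OF \<phi> Res_in[OF \<psi> m]] Act_in_homset[OF \<psi> m] x])
  then show "vpair (Res (Src p) (Act G (Map q (Cod A (\<psi> \<cdot> \<phi>)) (vsnd z)) (\<psi> \<cdot> \<phi>)) (vfst z))
      (Res (Src q) (\<psi> \<cdot> \<phi>) (vsnd z)) =
      vpair (Res (Src p) (Act G (Map q (Cod A \<phi>) (vsnd (vpair (Res (Src p) (Act G (Map q (Cod A \<psi>) (vsnd z)) \<psi>) (vfst z))
          (Res (Src q) \<psi> (vsnd z))))) \<phi>) (vfst (vpair (Res (Src p) (Act G (Map q (Cod A \<psi>) (vsnd z)) \<psi>) (vfst z))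
          (Res (Src q) \<psi> (vsnd z)))))
        (Res (Src q) \<phi> (vsnd (vpair (Res (Src p) (Act G (Map q (Cod A \<psi>) (vsnd z)) \<psi>) (vfst z))
          (Res (Src q) \<psi> (vsnd z)))))"
    using over_Res_Cmp[OF q \<phi> \<psi> y] by simp
qed

lemma twist_arr_eq_mkarr:
  assumes "F \<in> homset (over_cat A G) p p'" and "F' \<in> homset (over_cat A G) q q'"
  shows "twist_arr A G F F' = mkarr A (twist_obj A G p q) (twist_obj A G p' q')
    (\<lambda>a z. vpair (app F a (vfst z)) (app F' a (vsnd z)))"
proof -
  have "Src (twist_obj A G p q) = twist_psh A G p q" for p q
    by (simp add: twist_obj_def)
  moreover have "(\<lambda>a\<in>Obj A. \<lambda>z\<in>At (Src (twist_obj A G p q)) a. h a z) =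
      (\<lambda>a\<in>Obj A. \<lambda>z\<in>vtimes (At (Src p) a) (At (Src q) a). h a z)" for h :: "'o \<Rightarrow> 'u \<Rightarrow> 'u"
    by (auto simp: At_twist intro!: restrict_ext)
  ultimately show ?thesis
    using assms by (auto simp: over_homset_iff twist_arr_def mkarr_def app_def)
qed

text \<open>Naturality depends on the second arrow lying over G: \<open>F'\<close> does not change
  the image of \<open>y\<close> in G, so source and target twist \<open>\<phi>\<close> by the same
  group element.\<close>

lemma
  assumes F: "F \<in> homset (over_cat A G) p p'" and F': "F' \<in> homset (over_cat A G) q q'"
  shows twist_arr_in_homset:
      "twist_arr A G F F' \<in> homset (over_cat A G) (twist_obj A G p q) (twist_obj A G p' q')"
    and app_twist_arr: "a \<in> Obj A \<Longrightarrow> x \<in> At (Src p) a \<Longrightarrow> y \<in> At (Src q) a \<Longrightarrow>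
      app (twist_arr A G F F') a (vpair x y) = vpair (app F a x) (app F' a y)"
proof -
  interpret O: category "over_cat A G" by (rule category_over)
  note p = O.homset_Obj[OF F] and q = O.homset_Obj[OF F']
  show "twist_arr A G F F' \<in> homset (over_cat A G) (twist_obj A G p q) (twist_obj A G p' q')"
    unfolding twist_arr_eq_mkarr[OF F F']
  proof (rule mkarr_in_homset[OF twist_in_Obj[OF p(1) q(1)] twist_in_Obj[OF p(2) q(2)]])
    fix \<phi> a b z assume \<phi>: "\<phi> \<in> homset A a b" and "z \<in> At (Src (twist_obj A G p q)) b"
    then obtain x y where [simp]: "z = vpair x y" and x: "x \<in> At (Src p) b" and y: "y \<in> At (Src q) b"
      by (auto simp: At_twist homset_Obj[OF \<phi>])
    note ab = homset_Obj[OF \<phi>]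
    note act = Act_in_homset[OF \<phi> over_Map_in[OF q(1) ab(2) y]]
    show "vpair (app F a (vfst (Res (Src (twist_obj A G p q)) \<phi> z))) (app F' a (vsnd (Res (Src (twist_obj A G p q)) \<phi> z)))
        = Res (Src (twist_obj A G p' q')) \<phi> (vpair (app F b (vfst z)) (app F' b (vsnd z)))"
      using ab x y by (simp add: Res_twist[OF \<phi>] app_in[OF F] app_in[OF F'] app_Res[OF F act]
        app_Res[OF F' \<phi>] Map_app[OF F'])
  qed (auto simp: At_twist Map_twist app_in[OF F] app_in[OF F'] Map_app[OF F] Map_app[OF F'])
  show "a \<in> Obj A \<Longrightarrow> x \<in> At (Src p) a \<Longrightarrow> y \<in> At (Src q) a \<Longrightarrow>
      app (twist_arr A G F F') a (vpair x y) = vpair (app F a x) (app F' a y)"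
    by (simp add: twist_arr_eq_mkarr[OF F F'] app_mkarr At_twist)
qed

lemma twist_simps [simp]:
  "OMap (twist A G) (p, q) = twist_obj A G p q" "AMap (twist A G) (F, F') = twist_arr A G F F'"
  by (simp_all add: twist_def)

lemma is_functor_twist: "is_functor (over_cat A G \<times>\<^sub>C over_cat A G) (over_cat A G) (twist A G)"
proof -
  interpret O: category "over_cat A G" by (rule category_over)
  show ?thesis
  proof (rule is_functor_prodI)
    fix p q assume p: "p \<in> Obj (over_cat A G)" and q: "q \<in> Obj (over_cat A G)"
    note I = O.Ide_in_homset[OF p] O.Ide_in_homset[OF q]
    show "AMap (twist A G) (Ide (over_cat A G) p, Ide (over_cat A G) q) =
        Ide (over_cat A G) (OMap (twist A G) (p, q))"
      unfolding twist_simps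
      by (rule over_arr_eqI[OF twist_arr_in_homset[OF I] O.Ide_in_homset[OF twist_in_Obj[OF p q]]])
        (auto simp: At_twist app_twist_arr[OF I] app_Ide)
  next
    fix F F' H H' p p' p'' q q' q''
    assume F: "F \<in> homset (over_cat A G) p p'" and F': "F' \<in> homset (over_cat A G) p' p''"
      and H: "H \<in> homset (over_cat A G) q q'" and H': "H' \<in> homset (over_cat A G) q' q''"
    note FF = O.Cmp_in_homset[OF F F'] and HH = O.Cmp_in_homset[OF H H']
    show "AMap (twist A G) (F' \<cdot>\<^bsub>over_cat A G\<^esub> F, H' \<cdot>\<^bsub>over_cat A G\<^esub> H) =
        AMap (twist A G) (F', H') \<cdot>\<^bsub>over_cat A G\<^esub> AMap (twist A G) (F, H)"
      unfolding twist_simps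
      by (rule over_arr_eqI[OF twist_arr_in_homset[OF FF HH]
            O.Cmp_in_homset[OF twist_arr_in_homset[OF F H] twist_arr_in_homset[OF F' H']]])
        (auto simp: At_twist app_twist_arr[OF FF HH] app_twist_arr[OF F H] app_twist_arr[OF F' H']
          app_Cmp[OF twist_arr_in_homset[OF F H] twist_arr_in_homset[OF F' H']]
          app_Cmp[OF F F'] app_Cmp[OF H H'] app_in[OF F] app_in[OF H])
  qed (auto intro: category_over twist_in_Obj twist_arr_in_homset)
qed

end

section \<open>Coherence isomorphisms of the twisted product\<close>

context crossed_group_category
begin

interpretation O: category "over_cat A G"
  by (rule category_over)

lemma twist_assoc_eq_mkarr:
  "twist_assoc A G (p, q, r) = mkarr A (twist_obj A G (twist_obj A G p q) r) (twist_obj A G p (twist_obj A G q r))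
    (\<lambda>a z. vpair (vfst (vfst z)) (vpair (vsnd (vfst z)) (vsnd z)))"
proof -
  have "Src (twist_obj A G p q) = twist_psh A G p q" for p q
    by (simp add: twist_obj_def)
  moreover have "(\<lambda>a\<in>Obj A. \<lambda>z\<in>At (Src (twist_obj A G (twist_obj A G p q) r)) a. h a z) =
      (\<lambda>a\<in>Obj A. \<lambda>z\<in>vtimes (vtimes (At (Src p) a) (At (Src q) a)) (At (Src r) a). h a z)"
    for h :: "'o \<Rightarrow> 'u \<Rightarrow> 'u"
    by (auto simp: At_twist intro!: restrict_ext)
  ultimately show ?thesis
    by (simp add: twist_assoc_def mkarr_def)
qed

lemma app_twist_assoc:
  "a \<in> Obj A \<Longrightarrow> x \<in> At (Src p) a \<Longrightarrow> y \<in> At (Src q) a \<Longrightarrow> z \<in> At (Src r) a \<Longrightarrow>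
    app (twist_assoc A G (p, q, r)) a (vpair (vpair x y) z) = vpair x (vpair y z)"
  by (simp add: twist_assoc_eq_mkarr app_mkarr At_twist)

lemma twist_assoc_in_homset:
  assumes p: "p \<in> Obj (over_cat A G)" and q: "q \<in> Obj (over_cat A G)" and r: "r \<in> Obj (over_cat A G)"
  shows "twist_assoc A G (p, q, r) \<in> homset (over_cat A G)
    (twist_obj A G (twist_obj A G p q) r) (twist_obj A G p (twist_obj A G q r))"
  unfolding twist_assoc_eq_mkarr
proof (rule mkarr_in_homset)
  show "twist_obj A G (twist_obj A G p q) r \<in> Obj (over_cat A G)"
    "twist_obj A G p (twist_obj A G q r) \<in> Obj (over_cat A G)"
    by (intro twist_in_Obj p q r)+
next
  fix a v assume a: "a \<in> Obj A" and "v \<in> At (Src (twist_obj A G (twist_obj A G p q) r)) a"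
  then obtain x y z where [simp]: "v = vpair (vpair x y) z"
    and xyz: "x \<in> At (Src p) a" "y \<in> At (Src q) a" "z \<in> At (Src r) a"
    by (auto simp: At_twist)
  interpret g: group "Grp G a"
    by (rule Grp_group[OF a])
  show "vpair (vfst (vfst v)) (vpair (vsnd (vfst v)) (vsnd v)) \<in> At (Src (twist_obj A G p (twist_obj A G q r))) a"
    using a xyz by (simp add: At_twist)
  show "Map (twist_obj A G p (twist_obj A G q r)) a (vpair (vfst (vfst v)) (vpair (vsnd (vfst v)) (vsnd v)))
      = Map (twist_obj A G (twist_obj A G p q) r) a v"
    using a xyz by (simp add: Map_twist At_twist g.m_assoc Grp_carrier over_Map_in p q r)
next
  fix \<phi> a b v assume \<phi>: "\<phi> \<in> homset A a b" and "v \<in> At (Src (twist_obj A G (twist_obj A G p q) r)) b"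
  then obtain x y z where [simp]: "v = vpair (vpair x y) z"
    and xyz: "x \<in> At (Src p) b" "y \<in> At (Src q) b" "z \<in> At (Src r) b"
    by (auto simp: At_twist homset_Obj[OF \<phi>])
  note ab = homset_Obj[OF \<phi>]
  note act = Act_in_homset[OF \<phi> over_Map_in[OF r ab(2) xyz(3)]]
  \<comment> \<open>On \<open>x\<close> the left bracketing restricts along \<open>\<phi>\<close>
    twisted by \<open>z\<close> and afterwards by \<open>y\<close>, the right one along
    \<open>\<phi>\<close> twisted by the product of their images in G; \<open>Act_mult\<close>
    identifies the two.\<close>
  show "vpair (vfst (vfst (Res (Src (twist_obj A G (twist_obj A G p q) r)) \<phi> v)))
      (vpair (vsnd (vfst (Res (Src (twist_obj A G (twist_obj A G p q) r)) \<phi> v)))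
        (vsnd (Res (Src (twist_obj A G (twist_obj A G p q) r)) \<phi> v)))
    = Res (Src (twist_obj A G p (twist_obj A G q r))) \<phi> (vpair (vfst (vfst v)) (vpair (vsnd (vfst v)) (vsnd v)))"
    using ab xyz by (simp add: Res_twist[OF \<phi>] Res_twist[OF act] At_twist Map_twist
      Act_mult[OF \<phi>] over_Map_in q r)
qed

lemma iso_arrow_twist_assoc:
  assumes "p \<in> Obj (over_cat A G)" and "q \<in> Obj (over_cat A G)" and "r \<in> Obj (over_cat A G)"
  shows "iso_arrow (over_cat A G) (twist_assoc A G (p, q, r))"
proof (rule iso_arrow_over[OF twist_assoc_in_homset[OF assms]])
  fix a assume "a \<in> Obj A"
  then show "bij_betw (app (twist_assoc A G (p, q, r)) a)
      (At (Src (twist_obj A G (twist_obj A G p q) r)) a) (At (Src (twist_obj A G p (twist_obj A G q r))) a)"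
    by (intro bij_betwI[where g = "\<lambda>z. vpair (vpair (vfst z) (vfst (vsnd z))) (vsnd (vsnd z))"])
      (auto simp: At_twist app_twist_assoc)
qed

lemma twist_lunit_eq_mkarr:
  "twist_lunit A G p = mkarr A (twist_obj A G (unit_obj A G) p) p (\<lambda>a z. vsnd z)"
proof -
  have "(\<lambda>a\<in>Obj A. \<lambda>z\<in>At (Src (twist_obj A G (unit_obj A G) p)) a. vsnd z) =
      (\<lambda>a\<in>Obj A. \<lambda>z\<in>vtimes {mkset {}} (At (Src p) a). vsnd z)"
    by (auto simp: At_twist unit_simps intro!: restrict_ext)
  then show ?thesis
    by (simp add: twist_lunit_def mkarr_def) (simp add: twist_obj_def)
qed

lemma twist_runit_eq_mkarr:
  "twist_runit A G p = mkarr A (twist_obj A G p (unit_obj A G)) p (\<lambda>a z. vfst z)"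
proof -
  have "(\<lambda>a\<in>Obj A. \<lambda>z\<in>At (Src (twist_obj A G p (unit_obj A G))) a. vfst z) =
      (\<lambda>a\<in>Obj A. \<lambda>z\<in>vtimes (At (Src p) a) {mkset {}}. vfst z)"
    by (auto simp: At_twist unit_simps intro!: restrict_ext)
  then show ?thesis
    by (simp add: twist_runit_def mkarr_def) (simp add: twist_obj_def)
qed

lemma app_twist_unit:
  "a \<in> Obj A \<Longrightarrow> x \<in> At (Src p) a \<Longrightarrow> app (twist_lunit A G p) a (vpair (mkset {}) x) = x"
  "a \<in> Obj A \<Longrightarrow> x \<in> At (Src p) a \<Longrightarrow> app (twist_runit A G p) a (vpair x (mkset {})) = x"
  by (simp_all add: twist_lunit_eq_mkarr twist_runit_eq_mkarr app_mkarr At_twist unit_simps)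

context
  fixes p assumes p: "p \<in> Obj (over_cat A G)"
begin

lemma twist_lunit_in_homset:
  "twist_lunit A G p \<in> homset (over_cat A G) (twist_obj A G (unit_obj A G) p) p"
  unfolding twist_lunit_eq_mkarr
proof (rule mkarr_in_homset[OF twist_in_Obj[OF unit_in_Obj p] p])
  fix a v assume a: "a \<in> Obj A" and "v \<in> At (Src (twist_obj A G (unit_obj A G) p)) a"
  then obtain x where [simp]: "v = vpair (mkset {}) x" and x: "x \<in> At (Src p) a"
    by (auto simp: At_twist unit_simps)
  interpret g: group "Grp G a"
    by (rule Grp_group[OF a])
  show "vsnd v \<in> At (Src p) a" "Map p a (vsnd v) = Map (twist_obj A G (unit_obj A G) p) a v"
    using a x over_Map_in[OF p a x] by (simp_all add: Map_twist unit_simps Grp_carrier[symmetric])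
next
  fix \<phi> a b v assume \<phi>: "\<phi> \<in> homset A a b" and "v \<in> At (Src (twist_obj A G (unit_obj A G) p)) b"
  then show "vsnd (Res (Src (twist_obj A G (unit_obj A G) p)) \<phi> v) = Res (Src p) \<phi> (vsnd v)"
    using homset_Obj[OF \<phi>] by (auto simp: At_twist Res_twist[OF \<phi>] unit_simps)
qed

lemma twist_runit_in_homset:
  "twist_runit A G p \<in> homset (over_cat A G) (twist_obj A G p (unit_obj A G)) p"
  unfolding twist_runit_eq_mkarr
proof (rule mkarr_in_homset[OF twist_in_Obj[OF p unit_in_Obj] p])
  fix a v assume a: "a \<in> Obj A" and "v \<in> At (Src (twist_obj A G p (unit_obj A G))) a"
  then obtain x where [simp]: "v = vpair x (mkset {})" and x: "x \<in> At (Src p) a"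
    by (auto simp: At_twist unit_simps)
  interpret g: group "Grp G a"
    by (rule Grp_group[OF a])
  show "vfst v \<in> At (Src p) a" "Map p a (vfst v) = Map (twist_obj A G p (unit_obj A G)) a v"
    using a x over_Map_in[OF p a x] by (simp_all add: Map_twist unit_simps Grp_carrier[symmetric])
next
  fix \<phi> a b v assume \<phi>: "\<phi> \<in> homset A a b" and "v \<in> At (Src (twist_obj A G p (unit_obj A G))) b"
  \<comment> \<open>Here the twist falls on \<open>x\<close>, but by the group unit, so it is
    trivial. For the left unit it falls on the one-point presheaf and leaves no trace.\<close>
  then show "vfst (Res (Src (twist_obj A G p (unit_obj A G))) \<phi> v) = Res (Src p) \<phi> (vfst v)"
    using homset_Obj[OF \<phi>] by (auto simp: At_twist Res_twist[OF \<phi>] unit_simps Act_one[OF \<phi>])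
qed

lemma iso_arrow_twist_lunit: "iso_arrow (over_cat A G) (twist_lunit A G p)"
proof (rule iso_arrow_over[OF twist_lunit_in_homset])
  fix a assume "a \<in> Obj A"
  then show "bij_betw (app (twist_lunit A G p) a) (At (Src (twist_obj A G (unit_obj A G) p)) a) (At (Src p) a)"
    by (intro bij_betwI[where g = "\<lambda>x. vpair (mkset {}) x"])
      (auto simp: At_twist app_twist_unit unit_simps)
qed

lemma iso_arrow_twist_runit: "iso_arrow (over_cat A G) (twist_runit A G p)"
proof (rule iso_arrow_over[OF twist_runit_in_homset])
  fix a assume "a \<in> Obj A"
  then show "bij_betw (app (twist_runit A G p) a) (At (Src (twist_obj A G p (unit_obj A G))) a) (At (Src p) a)"
    by (intro bij_betwI[where g = "\<lambda>x. vpair x (mkset {})"])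
      (auto simp: At_twist app_twist_unit unit_simps)
qed

end

lemma monoidal_structure_twist:
  "monoidal_structure (over_cat A G) (twist A G) (unit_obj A G)
    (twist_assoc A G) (twist_lunit A G) (twist_runit A G)"
proof unfold_locales
  show "is_functor (over_cat A G \<times>\<^sub>C over_cat A G) (over_cat A G) (twist A G)"
    by (rule is_functor_twist)
  show "unit_obj A G \<in> Obj (over_cat A G)"
    by (rule unit_in_Obj)
  note I = O.Ide_in_homset[OF unit_in_Obj]
  show "natural_iso (over_cat A G \<times>\<^sub>C over_cat A G \<times>\<^sub>C over_cat A G) (over_cat A G)
      \<lparr>OMap = (\<lambda>(x, y, z). OMap (twist A G) (OMap (twist A G) (x, y), z)),
       AMap = (\<lambda>(f, g, h). AMap (twist A G) (AMap (twist A G) (f, g), h))\<rparr>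
      \<lparr>OMap = (\<lambda>(x, y, z). OMap (twist A G) (x, OMap (twist A G) (y, z))),
       AMap = (\<lambda>(f, g, h). AMap (twist A G) (f, AMap (twist A G) (g, h)))\<rparr> (twist_assoc A G)"
    (is "natural_iso ?CCC _ ?L ?R _")
  proof (rule natural_isoI)
    show "is_functor ?CCC (over_cat A G) ?L" "is_functor ?CCC (over_cat A G) ?R"
      by (rule is_functor_tensor_left[OF is_functor_twist]
        is_functor_tensor_right[OF is_functor_twist])+
  next
    fix pqr assume "pqr \<in> Obj ?CCC"
    then show "twist_assoc A G pqr \<in> homset (over_cat A G) (OMap ?L pqr) (OMap ?R pqr)"
      "iso_arrow (over_cat A G) (twist_assoc A G pqr)"
      by (cases pqr; simp add: twist_assoc_in_homset iso_arrow_twist_assoc)+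
  next
    fix FHK pqr pqr' assume FHK: "FHK \<in> homset ?CCC pqr pqr'"
    obtain p q r p' q' r' F H K where [simp]: "pqr = (p, q, r)" "pqr' = (p', q', r')" "FHK = (F, H, K)"
      by (metis prod.exhaust)
    have F: "F \<in> homset (over_cat A G) p p'" and H: "H \<in> homset (over_cat A G) q q'"
      and K: "K \<in> homset (over_cat A G) r r'"
      using FHK by auto
    note p = O.homset_Obj[OF F] and q = O.homset_Obj[OF H] and r = O.homset_Obj[OF K]
    note FH = twist_arr_in_homset[OF F H] and HK = twist_arr_in_homset[OF H K]
    note FH_K = twist_arr_in_homset[OF FH K] and F_HK = twist_arr_in_homset[OF F HK]
    note assoc = twist_assoc_in_homset[OF p(1) q(1) r(1)] and assoc' = twist_assoc_in_homset[OF p(2) q(2) r(2)]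
    have "twist_assoc A G (p', q', r') \<cdot>\<^bsub>over_cat A G\<^esub> twist_arr A G (twist_arr A G F H) K =
        twist_arr A G F (twist_arr A G H K) \<cdot>\<^bsub>over_cat A G\<^esub> twist_assoc A G (p, q, r)"
      by (rule over_arr_eqI[OF O.Cmp_in_homset[OF FH_K assoc'] O.Cmp_in_homset[OF assoc F_HK]])
        (auto simp: At_twist app_Cmp[OF FH_K assoc'] app_Cmp[OF assoc F_HK] app_twist_assoc
          app_twist_arr[OF F H] app_twist_arr[OF H K] app_twist_arr[OF FH K] app_twist_arr[OF F HK]
          app_in[OF F] app_in[OF H] app_in[OF K])
    then show "twist_assoc A G pqr' \<cdot>\<^bsub>over_cat A G\<^esub> AMap ?L FHK = AMap ?R FHK \<cdot>\<^bsub>over_cat A G\<^esub> twist_assoc A G pqr"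
      by simp
  qed
  show "natural_iso (over_cat A G) (over_cat A G)
      \<lparr>OMap = (\<lambda>x. OMap (twist A G) (unit_obj A G, x)),
       AMap = (\<lambda>f. AMap (twist A G) (Ide (over_cat A G) (unit_obj A G), f))\<rparr>
      \<lparr>OMap = (\<lambda>x. x), AMap = (\<lambda>f. f)\<rparr> (twist_lunit A G)"
  proof (rule natural_isoI[OF is_functor_tensor_fixed(1)[OF is_functor_twist unit_in_Obj]
        is_functor_ident[OF is_functor_twist]], simp_all add: twist_lunit_in_homset iso_arrow_twist_lunit)
    fix F p p' assume F: "F \<in> homset (over_cat A G) p p'"
    note p = O.homset_Obj[OF F]
    note lunit = twist_lunit_in_homset[OF p(1)] and lunit' = twist_lunit_in_homset[OF p(2)]
    note IF = twist_arr_in_homset[OF I F]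
    show "twist_lunit A G p' \<cdot>\<^bsub>over_cat A G\<^esub> twist_arr A G (Ide (over_cat A G) (unit_obj A G)) F =
        F \<cdot>\<^bsub>over_cat A G\<^esub> twist_lunit A G p"
      by (rule over_arr_eqI[OF O.Cmp_in_homset[OF IF lunit'] O.Cmp_in_homset[OF lunit F]])
        (auto simp: At_twist unit_simps app_Cmp[OF IF lunit'] app_Cmp[OF lunit F] app_twist_unit
          app_twist_arr[OF I F] app_Ide app_in[OF F])
  qed
  show "natural_iso (over_cat A G) (over_cat A G)
      \<lparr>OMap = (\<lambda>x. OMap (twist A G) (x, unit_obj A G)),
       AMap = (\<lambda>f. AMap (twist A G) (f, Ide (over_cat A G) (unit_obj A G)))\<rparr>
      \<lparr>OMap = (\<lambda>x. x), AMap = (\<lambda>f. f)\<rparr> (twist_runit A G)"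
  proof (rule natural_isoI[OF is_functor_tensor_fixed(2)[OF is_functor_twist unit_in_Obj]
        is_functor_ident[OF is_functor_twist]], simp_all add: twist_runit_in_homset iso_arrow_twist_runit)
    fix F p p' assume F: "F \<in> homset (over_cat A G) p p'"
    note p = O.homset_Obj[OF F]
    note runit = twist_runit_in_homset[OF p(1)] and runit' = twist_runit_in_homset[OF p(2)]
    note FI = twist_arr_in_homset[OF F I]
    show "twist_runit A G p' \<cdot>\<^bsub>over_cat A G\<^esub> twist_arr A G F (Ide (over_cat A G) (unit_obj A G)) =
        F \<cdot>\<^bsub>over_cat A G\<^esub> twist_runit A G p"
      by (rule over_arr_eqI[OF O.Cmp_in_homset[OF FI runit'] O.Cmp_in_homset[OF runit F]])
        (auto simp: At_twist unit_simps app_Cmp[OF FI runit'] app_Cmp[OF runit F] app_twist_unit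
          app_twist_arr[OF F I] app_Ide app_in[OF F])
  qed
next
  fix w p q r assume w: "w \<in> Obj (over_cat A G)" and p: "p \<in> Obj (over_cat A G)"
    and q: "q \<in> Obj (over_cat A G)" and r: "r \<in> Obj (over_cat A G)"
  note Io = O.Ide_in_homset[OF w] and Ir = O.Ide_in_homset[OF r]
  note opq = twist_assoc_in_homset[OF w p q] and pqr = twist_assoc_in_homset[OF p q r]
  note a1 = twist_assoc_in_homset[OF twist_in_Obj[OF w p] q r]
    and a2 = twist_assoc_in_homset[OF w p twist_in_Obj[OF q r]]
    and a3 = twist_assoc_in_homset[OF w twist_in_Obj[OF p q] r]
  note b1 = twist_arr_in_homset[OF opq Ir] and b2 = twist_arr_in_homset[OF Io pqr]
  note c = O.Cmp_in_homset[OF b1 O.Cmp_in_homset[OF a3 b2]]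
  \<comment> \<open>Arrows over G are equal once they agree on elements, and both sides send
    \<open>(((x, y), z), u)\<close> to \<open>(x, (y, (z, u)))\<close>.\<close>
  have "twist_assoc A G (w, p, twist_obj A G q r) \<cdot>\<^bsub>over_cat A G\<^esub> twist_assoc A G (twist_obj A G w p, q, r) =
      twist_arr A G (Ide (over_cat A G) w) (twist_assoc A G (p, q, r)) \<cdot>\<^bsub>over_cat A G\<^esub>
      twist_assoc A G (w, twist_obj A G p q, r) \<cdot>\<^bsub>over_cat A G\<^esub>
      twist_arr A G (twist_assoc A G (w, p, q)) (Ide (over_cat A G) r)"
    by (rule over_arr_eqI[OF O.Cmp_in_homset[OF a1 a2] c])
      (auto simp: At_twist app_Cmp[OF a1 a2] app_Cmp[OF b1 O.Cmp_in_homset[OF a3 b2]] app_Cmp[OF a3 b2]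
        app_twist_assoc app_twist_arr[OF opq Ir] app_twist_arr[OF Io pqr] app_Ide)
  then show "twist_assoc A G (w, p, OMap (twist A G) (q, r)) \<cdot>\<^bsub>over_cat A G\<^esub>
      twist_assoc A G (OMap (twist A G) (w, p), q, r) =
      AMap (twist A G) (Ide (over_cat A G) w, twist_assoc A G (p, q, r)) \<cdot>\<^bsub>over_cat A G\<^esub>
      twist_assoc A G (w, OMap (twist A G) (p, q), r) \<cdot>\<^bsub>over_cat A G\<^esub>
      AMap (twist A G) (twist_assoc A G (w, p, q), Ide (over_cat A G) r)"
    by simp
next
  fix p q assume p: "p \<in> Obj (over_cat A G)" and q: "q \<in> Obj (over_cat A G)"
  note Ip = O.Ide_in_homset[OF p] and Iq = O.Ide_in_homset[OF q]
  note assoc = twist_assoc_in_homset[OF p unit_in_Obj q]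
  note l = twist_arr_in_homset[OF Ip twist_lunit_in_homset[OF q]]
    and r = twist_arr_in_homset[OF twist_runit_in_homset[OF p] Iq]
  have "twist_arr A G (Ide (over_cat A G) p) (twist_lunit A G q) \<cdot>\<^bsub>over_cat A G\<^esub>
      twist_assoc A G (p, unit_obj A G, q) = twist_arr A G (twist_runit A G p) (Ide (over_cat A G) q)"
    by (rule over_arr_eqI[OF O.Cmp_in_homset[OF assoc l] r])
      (auto simp: At_twist unit_simps app_Cmp[OF assoc l] app_twist_assoc app_Ide app_twist_unit
        app_twist_arr[OF Ip twist_lunit_in_homset[OF q]] app_twist_arr[OF twist_runit_in_homset[OF p] Iq])
  then show "AMap (twist A G) (Ide (over_cat A G) p, twist_lunit A G q) \<cdot>\<^bsub>over_cat A G\<^esub>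
      twist_assoc A G (p, unit_obj A G, q) = AMap (twist A G) (twist_runit A G p, Ide (over_cat A G) q)"
    by simp
qed

end

section \<open>Internal homs\<close>

context crossed_group_category
begin

interpretation O: category "over_cat A G"
  by (rule category_over)

text \<open>Carries a presheaf over G with small values in any type into the universe:
  \<open>c\<close> codes and \<open>d\<close> decodes, degree by degree. Internal homs can then be
  described by elements of a convenient type.\<close>

lemma coded_object:
  fixes S :: "'o \<Rightarrow> 'x set"
  assumes small: "\<And>a. a \<in> Obj A \<Longrightarrow> small TYPE('u) (S a)"
    and R: "\<And>\<phi> a b s. \<phi> \<in> homset A a b \<Longrightarrow> s \<in> S b \<Longrightarrow> R \<phi> s \<in> S a"
    and R_Ide: "\<And>a s. a \<in> Obj A \<Longrightarrow> s \<in> S a \<Longrightarrow> R (Ide A a) s = s"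
    and R_Cmp: "\<And>\<phi> \<psi> a b c s. \<phi> \<in> homset A a b \<Longrightarrow> \<psi> \<in> homset A b c \<Longrightarrow> s \<in> S c \<Longrightarrow>
      R (\<psi> \<cdot> \<phi>) s = R \<phi> (R \<psi> s)"
    and m: "\<And>a s. a \<in> Obj A \<Longrightarrow> s \<in> S a \<Longrightarrow> m a s \<in> At (Und G) a"
    and nat: "\<And>\<phi> a b s. \<phi> \<in> homset A a b \<Longrightarrow> s \<in> S b \<Longrightarrow> m a (R \<phi> s) = Res (Und G) \<phi> (m b s)"
  obtains p c d where "p \<in> Obj (over_cat A G)"
    and "\<And>a s. a \<in> Obj A \<Longrightarrow> s \<in> S a \<Longrightarrow> c a s \<in> At (Src p) a"
    and "\<And>a s. a \<in> Obj A \<Longrightarrow> s \<in> S a \<Longrightarrow> d a (c a s) = s"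
    and "\<And>a x. a \<in> Obj A \<Longrightarrow> x \<in> At (Src p) a \<Longrightarrow> d a x \<in> S a"
    and "\<And>a x. a \<in> Obj A \<Longrightarrow> x \<in> At (Src p) a \<Longrightarrow> c a (d a x) = x"
    and "\<And>\<phi> a b x. \<phi> \<in> homset A a b \<Longrightarrow> x \<in> At (Src p) b \<Longrightarrow> Res (Src p) \<phi> x = c a (R \<phi> (d b x))"
    and "\<And>a x. a \<in> Obj A \<Longrightarrow> x \<in> At (Src p) a \<Longrightarrow> Map p a x = m a (d a x)"
proof -
  have "\<exists>f :: 'x \<Rightarrow> 'u. inj_on f (S a) \<and> f ` S a \<in> range elts" if "a \<in> Obj A" for a
    using small[OF that] by (simp add: small_def)
  then obtain c :: "'o \<Rightarrow> 'x \<Rightarrow> 'u" where c: "\<And>a. a \<in> Obj A \<Longrightarrow> inj_on (c a) (S a)"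
    "\<And>a. a \<in> Obj A \<Longrightarrow> c a ` S a \<in> range elts"
    by metis
  define d where "d a = inv_into (S a) (c a)" for a
  have dc: "d a (c a s) = s" if "a \<in> Obj A" "s \<in> S a" for a s
    using c(1)[OF that(1)] that(2) by (simp add: d_def)
  have d: "d a x \<in> S a" "c a (d a x) = x" if "x \<in> c a ` S a" for a x
    using that by (simp_all add: d_def inv_into_into f_inv_into_f)
  \<comment> \<open>Each degree has its own coding, and a restriction map is given only
    \<open>\<phi>\<close>; the two codings involved are those at its domain and codomain.\<close>
  let ?p = "mkobj A G (\<lambda>a. c a ` S a) (\<lambda>\<phi> x. c (Dom A \<phi>) (R \<phi> (d (Cod A \<phi>) x))) (\<lambda>a x. m a (d a x))"
  have R': "c (Dom A \<phi>) (R \<phi> (d (Cod A \<phi>) x)) = c a (R \<phi> (d b x))" if "\<phi> \<in> homset A a b" for \<phi> a b x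
    using that by (simp add: homset_iff)
  have p: "?p \<in> Obj (over_cat A G)"
  proof (rule mkobj_in_Obj)
    fix \<phi> a b x assume \<phi>: "\<phi> \<in> homset A a b" and x: "x \<in> c b ` S b"
    show "c (Dom A \<phi>) (R \<phi> (d (Cod A \<phi>) x)) \<in> c a ` S a"
      unfolding R'[OF \<phi>] using R[OF \<phi> d(1)[OF x]] by (rule imageI)
    show "m a (d a (c (Dom A \<phi>) (R \<phi> (d (Cod A \<phi>) x)))) = Res (Und G) \<phi> (m b (d b x))"
      unfolding R'[OF \<phi>]
      using dc[OF homset_Obj(1)[OF \<phi>] R[OF \<phi> d(1)[OF x]]] nat[OF \<phi> d(1)[OF x]] by simp
  next
    fix \<phi> \<psi> a b e x assume \<phi>: "\<phi> \<in> homset A a b" and \<psi>: "\<psi> \<in> homset A b e" and x: "x \<in> c e ` S e"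
    show "c (Dom A (\<psi> \<cdot> \<phi>)) (R (\<psi> \<cdot> \<phi>) (d (Cod A (\<psi> \<cdot> \<phi>)) x)) =
        c (Dom A \<phi>) (R \<phi> (d (Cod A \<phi>) (c (Dom A \<psi>) (R \<psi> (d (Cod A \<psi>) x)))))"
      unfolding R'[OF \<phi>] R'[OF \<psi>] R'[OF Cmp_in_homset[OF \<phi> \<psi>]]
      using dc[OF homset_Obj(1)[OF \<psi>] R[OF \<psi> d(1)[OF x]]] R_Cmp[OF \<phi> \<psi> d(1)[OF x]] by simp
  next
    fix a x assume a: "a \<in> Obj A" and x: "x \<in> c a ` S a"
    show "c (Dom A (Ide A a)) (R (Ide A a) (d (Cod A (Ide A a)) x)) = x"
      unfolding R'[OF Ide_in_homset[OF a]] using R_Ide[OF a d(1)[OF x]] d(2)[OF x] by simp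
    show "m a (d a x) \<in> At (Und G) a"
      by (rule m[OF a d(1)[OF x]])
  qed (rule c)
  show ?thesis
  proof (rule that[OF p, of c d])
    fix \<phi> a b x assume \<phi>: "\<phi> \<in> homset A a b" and "x \<in> At (Src ?p) b"
    then have "x \<in> c b ` S b"
      by (simp add: mkobj_simps homset_Obj[OF \<phi>])
    then show "Res (Src ?p) \<phi> x = c a (R \<phi> (d b x))"
      unfolding R'[OF \<phi>, symmetric] by (rule mkobj_simps(2)[OF \<phi>])
  qed (simp_all add: mkobj_simps dc d)
qed

text \<open>The two internal homs represent the maps \<open>P(a) \<times> Y(a) \<rightarrow> Z(a)\<close> over \<open>G\<close> that are natural
  after twisting a restriction \<open>\<phi>\<close> into \<open>l\<close> on \<open>P\<close> and into \<open>r\<close> on \<open>Y\<close>. The twist depends on \<open>P\<close> only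
  through the structure map to \<open>G\<close>, so the same construction serves both sides.\<close>

definition bimap :: "('o \<Rightarrow> 'u \<Rightarrow> 'u \<Rightarrow> 'm \<Rightarrow> 'm) \<Rightarrow> ('o \<Rightarrow> 'u \<Rightarrow> 'u \<Rightarrow> 'm \<Rightarrow> 'm) \<Rightarrow>
    ('o \<Rightarrow> 'u \<Rightarrow> 'u \<Rightarrow> 'u) \<Rightarrow> ('o, 'm, 'u) over_obj \<Rightarrow> ('o, 'm, 'u) over_obj \<Rightarrow> ('o, 'm, 'u) over_obj \<Rightarrow>
    ('o \<Rightarrow> 'u \<Rightarrow> 'u \<Rightarrow> 'u) \<Rightarrow> bool"
  where "bimap l r mul P Y Z f \<longleftrightarrow>
    (\<forall>a\<in>Obj A. \<forall>x\<in>At (Src P) a. \<forall>y\<in>At (Src Y) a.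
      f a x y \<in> At (Src Z) a \<and> Map Z a (f a x y) = mul a (Map P a x) y) \<and>
    (\<forall>\<phi> a b. \<phi> \<in> homset A a b \<longrightarrow> (\<forall>x\<in>At (Src P) b. \<forall>y\<in>At (Src Y) b.
      f a (Res (Src P) (l b (Map P b x) y \<phi>) x) (Res (Src Y) (r b (Map P b x) y \<phi>) y) =
      Res (Src Z) \<phi> (f b x y)))"

text \<open>By the Yoneda lemma the universal \<open>H\<close> must have as \<open>H(b)\<close> the pairs of \<open>g \<in> G(b)\<close> and a bimap
  out of the representable presheaf on \<open>b\<close>, lying over \<open>G\<close> by \<open>\<alpha> \<mapsto> \<alpha>\<^sup>*(g)\<close>.\<close>

lemma bimap_universal:
  assumes small_A: "small TYPE('u) (Obj A)" "small TYPE('u) (Arr A)"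
    and Y: "Y \<in> Obj (over_cat A G)" and Z: "Z \<in> Obj (over_cat A G)"
    and l: "\<And>\<phi> a b g y. \<phi> \<in> homset A a b \<Longrightarrow> g \<in> At (Und G) b \<Longrightarrow> y \<in> At (Src Y) b \<Longrightarrow>
      l b g y \<phi> \<in> homset A a b"
    and r: "\<And>\<phi> a b g y. \<phi> \<in> homset A a b \<Longrightarrow> g \<in> At (Und G) b \<Longrightarrow> y \<in> At (Src Y) b \<Longrightarrow>
      r b g y \<phi> \<in> homset A a b"
  obtains H e where "H \<in> Obj (over_cat A G)" and "bimap l r mul H Y Z e"
    and "\<And>P f. P \<in> Obj (over_cat A G) \<Longrightarrow> bimap l r mul P Y Z f \<Longrightarrow>
      \<exists>!k. k \<in> homset (over_cat A G) P H \<and>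
        (\<forall>a\<in>Obj A. \<forall>x\<in>At (Src P) a. \<forall>y\<in>At (Src Y) a. e a (app k a x) y = f a x y)"
proof -
  note G_Ide = presheaf.Res_Ide[OF Und_presheaf] and G_Cmp = presheaf.Res_Cmp[OF Und_presheaf]
  \<comment> \<open>All elements of \<open>A(-, b)\<close> times \<open>Y\<close>, in all degrees at
    once: the domain of \<open>\<alpha>\<close> records the degree, so a single function on
    \<open>D b\<close> stands for a whole family.\<close>
  define D where "D b = (SIGMA \<alpha>:{\<alpha>\<in>Arr A. Cod A \<alpha> = b}. At (Src Y) (Dom A \<alpha>))" for b
  have D_iff: "(\<alpha>, y) \<in> D b \<longleftrightarrow> (\<exists>a. \<alpha> \<in> homset A a b \<and> y \<in> At (Src Y) a)" for \<alpha> y b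
    by (auto simp: D_def homset_iff)
  \<comment> \<open>\<open>fst s\<close> is the group element. \<open>snd s\<close> satisfies the
    conditions of \<open>bimap\<close> for the representable presheaf, in which
    \<open>\<alpha>\<close> lies over the restriction of \<open>fst s\<close> along
    \<open>\<alpha>\<close> and restricts by composition. They are spelled out because arrows of A
    have type \<open>'m\<close> rather than \<open>'u\<close>.\<close>
  define S where "S b = {s. fst s \<in> At (Und G) b \<and> snd s \<in> extensional (D b) \<and>
    (\<forall>\<alpha> a. \<alpha> \<in> homset A a b \<longrightarrow> (\<forall>y\<in>At (Src Y) a.
      snd s (\<alpha>, y) \<in> At (Src Z) a \<and> Map Z a (snd s (\<alpha>, y)) = mul a (Res (Und G) \<alpha> (fst s)) y)) \<and>
    (\<forall>\<alpha> \<phi> a a'. \<alpha> \<in> homset A a b \<longrightarrow> \<phi> \<in> homset A a' a \<longrightarrow> (\<forall>y\<in>At (Src Y) a.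
      snd s (\<alpha> \<cdot> l a (Res (Und G) \<alpha> (fst s)) y \<phi>, Res (Src Y) (r a (Res (Und G) \<alpha> (fst s)) y \<phi>) y) =
      Res (Src Z) \<phi> (snd s (\<alpha>, y))))}" for b
  \<comment> \<open>The Yoneda map of \<open>\<beta>\<close> sends \<open>\<alpha>\<close> to
    \<open>\<beta> \<cdot> \<alpha>\<close>; restricting \<open>s\<close> means composing with
    it.\<close>
  define R where "R \<beta> s = (Res (Und G) \<beta> (fst s), \<lambda>(\<alpha>, y)\<in>D (Dom A \<beta>). snd s (\<beta> \<cdot> \<alpha>, y))"
    for \<beta> and s :: "'u \<times> ('m \<times> 'u \<Rightarrow> 'u)"
  have S_G: "fst s \<in> At (Und G) b" if "s \<in> S b" for s b
    using that unfolding S_def by blast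
  have S_ext: "snd s \<in> extensional (D b)" if "s \<in> S b" for s b
    using that unfolding S_def by blast
  have S_Z: "snd s (\<alpha>, y) \<in> At (Src Z) a" "Map Z a (snd s (\<alpha>, y)) = mul a (Res (Und G) \<alpha> (fst s)) y"
    if "s \<in> S b" "\<alpha> \<in> homset A a b" "y \<in> At (Src Y) a" for s \<alpha> y a b
    using that unfolding S_def by blast+
  have S_nat: "snd s (\<alpha> \<cdot> l a (Res (Und G) \<alpha> (fst s)) y \<phi>, Res (Src Y) (r a (Res (Und G) \<alpha> (fst s)) y \<phi>) y) =
      Res (Src Z) \<phi> (snd s (\<alpha>, y))"
    if "s \<in> S b" "\<alpha> \<in> homset A a b" "\<phi> \<in> homset A a' a" "y \<in> At (Src Y) a" for s \<alpha> \<phi> y a a' b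
    using that unfolding S_def by blast
  have S_I: "s \<in> S b" if "fst s \<in> At (Und G) b" "snd s \<in> extensional (D b)"
    "\<And>\<alpha> a y. \<alpha> \<in> homset A a b \<Longrightarrow> y \<in> At (Src Y) a \<Longrightarrow> snd s (\<alpha>, y) \<in> At (Src Z) a"
    "\<And>\<alpha> a y. \<alpha> \<in> homset A a b \<Longrightarrow> y \<in> At (Src Y) a \<Longrightarrow>
      Map Z a (snd s (\<alpha>, y)) = mul a (Res (Und G) \<alpha> (fst s)) y"
    "\<And>\<alpha> \<phi> a a' y. \<alpha> \<in> homset A a b \<Longrightarrow> \<phi> \<in> homset A a' a \<Longrightarrow> y \<in> At (Src Y) a \<Longrightarrow>
      snd s (\<alpha> \<cdot> l a (Res (Und G) \<alpha> (fst s)) y \<phi>, Res (Src Y) (r a (Res (Und G) \<alpha> (fst s)) y \<phi>) y) =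
      Res (Src Z) \<phi> (snd s (\<alpha>, y))" for s b
    using that unfolding S_def by blast
  have snd_R: "snd (R \<beta> s) (\<alpha>, y) = snd s (\<beta> \<cdot> \<alpha>, y)"
    if "\<beta> \<in> homset A b' b" "\<alpha> \<in> homset A a b'" "y \<in> At (Src Y) a" for \<beta> s \<alpha> y a b b'
    using that by (auto simp: R_def D_def homset_iff)
  have S_small: "small TYPE('u) (S b)" if b: "b \<in> Obj A" for b
  proof (rule small_mono)
    \<comment> \<open>\<open>?Z\<close> bounds the values of \<open>snd s\<close> in every degree,
      which embeds \<open>S b\<close> in a product of small sets; \<open>?Y\<close> does the same
      for the second components of \<open>D b\<close>. Both unions are small because A has a small
      set of objects.\<close>
    let ?Y = "\<Union>a\<in>Obj A. At (Src Y) a" and ?Z = "\<Union>a\<in>Obj A. At (Src Z) a"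
    have "small TYPE('u) (At (Und G) b)"
      by (rule small_if_range[OF presheaf.At_small[OF Und_presheaf b]])
    moreover have "small TYPE('u) (D b)"
      by (rule small_mono[OF small_Times[OF small_A(2) small_UN_external[of _ "At (Src Y)", OF small_A(1)]]])
        (auto simp: D_def intro: over_At_small[OF Y] Dom_in_Obj)
    moreover have "small TYPE('u) ?Z"
      by (rule small_UN_external[OF small_A(1) over_At_small[OF Z]])
    ultimately show "small TYPE('u) (At (Und G) b \<times> (D b \<rightarrow>\<^sub>E ?Z))"
      by (intro small_Times small_PiE)
    have "snd s \<in> D b \<rightarrow>\<^sub>E ?Z" if s: "s \<in> S b" for s
    proof (rule PiE_I)
      fix \<alpha>y assume "\<alpha>y \<in> D b"
      then obtain \<alpha> y a where "\<alpha>y = (\<alpha>, y)" and \<alpha>: "\<alpha> \<in> homset A a b" and y: "y \<in> At (Src Y) a"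
        by (cases \<alpha>y) (auto simp: D_iff)
      then show "snd s \<alpha>y \<in> ?Z"
        using UN_I[OF homset_Obj(1)[OF \<alpha>], of "snd s (\<alpha>, y)" "At (Src Z)"] S_Z(1)[OF s \<alpha> y] by simp
    qed (use S_ext[OF s] in \<open>auto simp: extensional_def\<close>)
    then show "S b \<subseteq> At (Und G) b \<times> (D b \<rightarrow>\<^sub>E ?Z)"
      using S_G unfolding subset_iff mem_Times_iff by blast
  qed
  have S_R: "R \<beta> s \<in> S b'" if \<beta>: "\<beta> \<in> homset A b' b" and s: "s \<in> S b" for \<beta> s b b'
  proof (rule S_I)
    show "fst (R \<beta> s) \<in> At (Und G) b'"
      using Res_in[OF \<beta> S_G[OF s]] by (simp add: R_def)
    show "snd (R \<beta> s) \<in> extensional (D b')"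
      using \<beta> by (simp add: R_def homset_iff)
  next
    fix \<alpha> a y assume \<alpha>: "\<alpha> \<in> homset A a b'" and y: "y \<in> At (Src Y) a"
    note \<beta>\<alpha> = Cmp_in_homset[OF \<alpha> \<beta>]
    have g: "Res (Und G) \<alpha> (fst (R \<beta> s)) = Res (Und G) (\<beta> \<cdot> \<alpha>) (fst s)"
      using G_Cmp[OF \<alpha> \<beta> S_G[OF s]] by (simp add: R_def)
    show "snd (R \<beta> s) (\<alpha>, y) \<in> At (Src Z) a"
      "Map Z a (snd (R \<beta> s) (\<alpha>, y)) = mul a (Res (Und G) \<alpha> (fst (R \<beta> s))) y"
      using S_Z[OF s \<beta>\<alpha> y] by (simp_all add: snd_R[OF \<beta> \<alpha> y] g)
    fix \<phi> a' assume \<phi>: "\<phi> \<in> homset A a' a"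
    have ga: "Res (Und G) (\<beta> \<cdot> \<alpha>) (fst s) \<in> At (Und G) a"
      by (rule Res_in[OF \<beta>\<alpha> S_G[OF s]])
    note l' = l[OF \<phi> ga y] and r' = r[OF \<phi> ga y]
    show "snd (R \<beta> s) (\<alpha> \<cdot> l a (Res (Und G) \<alpha> (fst (R \<beta> s))) y \<phi>,
        Res (Src Y) (r a (Res (Und G) \<alpha> (fst (R \<beta> s))) y \<phi>) y) = Res (Src Z) \<phi> (snd (R \<beta> s) (\<alpha>, y))"
      using S_nat[OF s \<beta>\<alpha> \<phi> y]
      by (simp add: g snd_R[OF \<beta> \<alpha> y] snd_R[OF \<beta> Cmp_in_homset[OF l' \<alpha>] over_Res_in[OF Y r' y]]
        Cmp_assoc[OF l' \<alpha> \<beta>])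
  qed
  \<comment> \<open>Values off \<open>D b'\<close> agree by extensionality, so a restriction is
    recognised by its group element and its values on \<open>D b'\<close>. The functor laws, the
    naturality of the transpose and its uniqueness all go through this criterion.\<close>
  have R_eqI: "R \<beta> s = t" if \<beta>: "\<beta> \<in> homset A b' b" and t: "t \<in> S b'"
    and "fst t = Res (Und G) \<beta> (fst s)"
    and h: "\<And>\<alpha> a y. \<alpha> \<in> homset A a b' \<Longrightarrow> y \<in> At (Src Y) a \<Longrightarrow> snd t (\<alpha>, y) = snd s (\<beta> \<cdot> \<alpha>, y)"
    for \<beta> s t b b'
  proof -
    have "snd (R \<beta> s) = snd t"
    proof (rule extensionalityI[OF _ S_ext[OF t]])
      show "snd (R \<beta> s) \<in> extensional (D b')"
        using \<beta> by (simp add: R_def homset_iff)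
      fix \<alpha>y assume "\<alpha>y \<in> D b'"
      then obtain \<alpha> y a where "\<alpha>y = (\<alpha>, y)" and \<alpha>: "\<alpha> \<in> homset A a b'" and y: "y \<in> At (Src Y) a"
        by (cases \<alpha>y) (auto simp: D_iff)
      then show "snd (R \<beta> s) \<alpha>y = snd t \<alpha>y"
        by (simp add: h[OF \<alpha> y] snd_R[OF \<beta> \<alpha> y])
    qed
    then show ?thesis
      using that(3) by (simp add: prod_eq_iff) (simp add: R_def)
  qed
  have R_Ide: "R (Ide A b) s = s" if b: "b \<in> Obj A" and s: "s \<in> S b" for b s
    by (rule R_eqI[OF Ide_in_homset[OF b] s]) (simp_all add: G_Ide[OF b S_G[OF s]] Cmp_Ide_left)
  have R_Cmp: "R (\<psi> \<cdot> \<phi>) s = R \<phi> (R \<psi> s)"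
    if \<phi>: "\<phi> \<in> homset A a b" and \<psi>: "\<psi> \<in> homset A b c" and s: "s \<in> S c" for \<phi> \<psi> a b c s
  proof (rule R_eqI[OF Cmp_in_homset[OF \<phi> \<psi>] S_R[OF \<phi> S_R[OF \<psi> s]]])
    show "fst (R \<phi> (R \<psi> s)) = Res (Und G) (\<psi> \<cdot> \<phi>) (fst s)"
      by (simp add: R_def G_Cmp[OF \<phi> \<psi> S_G[OF s]])
    fix \<alpha> a' y assume \<alpha>: "\<alpha> \<in> homset A a' a" and y: "y \<in> At (Src Y) a'"
    then show "snd (R \<phi> (R \<psi> s)) (\<alpha>, y) = snd s (\<psi> \<cdot> \<phi> \<cdot> \<alpha>, y)"
      by (simp add: snd_R[OF \<phi> \<alpha> y] snd_R[OF \<psi> Cmp_in_homset[OF \<alpha> \<phi>] y] Cmp_assoc[OF \<alpha> \<phi> \<psi>])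
  qed
  have fst_R: "fst (R \<phi> s) = Res (Und G) \<phi> (fst s)" for \<phi> s
    by (simp add: R_def)
  obtain H c d where H: "H \<in> Obj (over_cat A G)"
    and c: "\<And>a s. a \<in> Obj A \<Longrightarrow> s \<in> S a \<Longrightarrow> c a s \<in> At (Src H) a"
    and dc: "\<And>a s. a \<in> Obj A \<Longrightarrow> s \<in> S a \<Longrightarrow> d a (c a s) = s"
    and d: "\<And>a x. a \<in> Obj A \<Longrightarrow> x \<in> At (Src H) a \<Longrightarrow> d a x \<in> S a"
    and cd: "\<And>a x. a \<in> Obj A \<Longrightarrow> x \<in> At (Src H) a \<Longrightarrow> c a (d a x) = x"
    and Res_H: "\<And>\<phi> a b x. \<phi> \<in> homset A a b \<Longrightarrow> x \<in> At (Src H) b \<Longrightarrow> Res (Src H) \<phi> x = c a (R \<phi> (d b x))"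
    and Map_H: "\<And>a x. a \<in> Obj A \<Longrightarrow> x \<in> At (Src H) a \<Longrightarrow> Map H a x = fst (d a x)"
    by (rule coded_object[of S R "\<lambda>a s. fst s"])
      (rule S_small S_R R_Ide R_Cmp S_G fst_R that; assumption)+
  \<comment> \<open>As in the Yoneda lemma, evaluation takes the value at the universal element
    \<open>Ide A a\<close>.\<close>
  define e where "e a v y = snd (d a v) (Ide A a, y)" for a v y
  \<comment> \<open>Conversely, the value at any \<open>\<phi>\<close> is the evaluation of the
    restriction along \<open>\<phi>\<close>, so \<open>e\<close> recovers the whole function stored
    in an element of \<open>H\<close>.\<close>
  have e_Res: "e a (Res (Src H) \<phi> v) y = snd (d b v) (\<phi>, y)"
    if \<phi>: "\<phi> \<in> homset A a b" and v: "v \<in> At (Src H) b" and y: "y \<in> At (Src Y) a" for \<phi> a b v y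
    using dc[OF homset_Obj(1)[OF \<phi>] S_R[OF \<phi> d[OF homset_Obj(2)[OF \<phi>] v]]]
      snd_R[OF \<phi> Ide_in_homset[OF homset_Obj(1)[OF \<phi>]] y]
    by (simp add: e_def Res_H[OF \<phi> v] Cmp_Ide_right[OF \<phi>])
  have e: "bimap l r mul H Y Z e"
    unfolding bimap_def
  proof (intro conjI ballI allI impI)
    fix a v y assume a: "a \<in> Obj A" and v: "v \<in> At (Src H) a" and y: "y \<in> At (Src Y) a"
    show "e a v y \<in> At (Src Z) a" "Map Z a (e a v y) = mul a (Map H a v) y"
      using S_Z[OF d[OF a v] Ide_in_homset[OF a] y] G_Ide[OF a S_G[OF d[OF a v]]]
      by (simp_all add: e_def Map_H[OF a v])
  next
    fix \<phi> a b v y assume \<phi>: "\<phi> \<in> homset A a b" and v: "v \<in> At (Src H) b" and y: "y \<in> At (Src Y) b"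
    note b = homset_Obj(2)[OF \<phi>]
    have g: "fst (d b v) \<in> At (Und G) b"
      by (rule S_G[OF d[OF b v]])
    note l' = l[OF \<phi> g y] and r' = r[OF \<phi> g y]
    show "e a (Res (Src H) (l b (Map H b v) y \<phi>) v) (Res (Src Y) (r b (Map H b v) y \<phi>) y) =
        Res (Src Z) \<phi> (e b v y)"
      using S_nat[OF d[OF b v] Ide_in_homset[OF b] \<phi> y] G_Ide[OF b g]
      by (simp add: Map_H[OF b v] e_Res[OF l' v over_Res_in[OF Y r' y]] Cmp_Ide_left[OF l'] e_def[of b])
  qed
  have univ: "\<exists>!k. k \<in> homset (over_cat A G) P H \<and>
      (\<forall>a\<in>Obj A. \<forall>x\<in>At (Src P) a. \<forall>y\<in>At (Src Y) a. e a (app k a x) y = f a x y)"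
    if P: "P \<in> Obj (over_cat A G)" and f: "bimap l r mul P Y Z f" for P f
  proof -
    \<comment> \<open>Forced by \<open>e_Res\<close>: if \<open>k\<close> factors \<open>f\<close>
      through \<open>e\<close>, the value at \<open>(\<alpha>, y)\<close> of the function stored in
      the image of \<open>x\<close> is \<open>f\<close> at the restriction of \<open>x\<close> along
      \<open>\<alpha>\<close>.\<close>
    define t where "t a x = (Map P a x, \<lambda>(\<alpha>, y)\<in>D a. f (Dom A \<alpha>) (Res (Src P) \<alpha> x) y)" for a x
    have fst_t: "fst (t a x) = Map P a x" for a x
      by (simp add: t_def)
    have snd_t: "snd (t a x) (\<alpha>, y) = f a' (Res (Src P) \<alpha> x) y"
      if "\<alpha> \<in> homset A a' a" "y \<in> At (Src Y) a'" for a x \<alpha> a' y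
      using that by (auto simp: t_def D_def homset_iff)
    have t: "t b x \<in> S b" if b: "b \<in> Obj A" and x: "x \<in> At (Src P) b" for b x
    proof (rule S_I)
      show "fst (t b x) \<in> At (Und G) b" "snd (t b x) \<in> extensional (D b)"
        using over_Map_in[OF P b x] by (simp_all add: t_def)
    next
      fix \<alpha> a y assume \<alpha>: "\<alpha> \<in> homset A a b" and y: "y \<in> At (Src Y) a"
      note a = homset_Obj(1)[OF \<alpha>] and \<alpha>x = over_Res_in[OF P \<alpha> x]
      show "snd (t b x) (\<alpha>, y) \<in> At (Src Z) a"
        "Map Z a (snd (t b x) (\<alpha>, y)) = mul a (Res (Und G) \<alpha> (fst (t b x))) y"
        using f a y \<alpha>x by (simp_all add: bimap_def snd_t[OF \<alpha> y] fst_t over_Map_Res[OF P \<alpha> x])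
      fix \<phi> a' assume \<phi>: "\<phi> \<in> homset A a' a"
      let ?g = "Res (Und G) \<alpha> (Map P b x)"
      have g: "?g = Map P a (Res (Src P) \<alpha> x)"
        by (simp add: over_Map_Res[OF P \<alpha> x])
      have gG: "?g \<in> At (Und G) a"
        by (rule Res_in[OF \<alpha> over_Map_in[OF P b x]])
      note l' = l[OF \<phi> gG y] and r' = r[OF \<phi> gG y]
      have "f a' (Res (Src P) (l a ?g y \<phi>) (Res (Src P) \<alpha> x)) (Res (Src Y) (r a ?g y \<phi>) y) =
          Res (Src Z) \<phi> (f a (Res (Src P) \<alpha> x) y)"
        using f \<phi> \<alpha>x y unfolding g bimap_def by blast
      then show "snd (t b x) (\<alpha> \<cdot> l a (Res (Und G) \<alpha> (fst (t b x))) y \<phi>,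
          Res (Src Y) (r a (Res (Und G) \<alpha> (fst (t b x))) y \<phi>) y) = Res (Src Z) \<phi> (snd (t b x) (\<alpha>, y))"
        by (simp add: fst_t snd_t[OF \<alpha> y] snd_t[OF Cmp_in_homset[OF l' \<alpha>] over_Res_in[OF Y r' y]]
          over_Res_Cmp[OF P l' \<alpha> x])
    qed
    define k where "k = mkarr A P H (\<lambda>a x. c a (t a x))"
    have k: "k \<in> homset (over_cat A G) P H"
      unfolding k_def
    proof (rule mkarr_in_homset[OF P H])
      fix \<phi> a b x assume \<phi>: "\<phi> \<in> homset A a b" and x: "x \<in> At (Src P) b"
      note ab = homset_Obj[OF \<phi>]
      have "R \<phi> (t b x) = t a (Res (Src P) \<phi> x)"
        by (rule R_eqI[OF \<phi> t[OF ab(1) over_Res_in[OF P \<phi> x]]])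
          (auto simp: fst_t over_Map_Res[OF P \<phi> x] snd_t snd_t[OF Cmp_in_homset[OF _ \<phi>]]
            over_Res_Cmp[OF P _ \<phi> x])
      then show "c a (t a (Res (Src P) \<phi> x)) = Res (Src H) \<phi> (c b (t b x))"
        by (simp add: Res_H[OF \<phi> c[OF ab(2) t[OF ab(2) x]]] dc[OF ab(2) t[OF ab(2) x]])
    qed (simp_all add: c t Map_H dc fst_t)
    show ?thesis
    proof (intro ex1I conjI ballI)
      show "k \<in> homset (over_cat A G) P H" by (rule k)
    next
      fix a x y assume a: "a \<in> Obj A" and x: "x \<in> At (Src P) a" and y: "y \<in> At (Src Y) a"
      then show "e a (app k a x) y = f a x y"
        by (simp add: k_def app_mkarr e_def dc t snd_t[OF Ide_in_homset[OF a] y] over_Res_Ide[OF P a x])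
    next
      fix k' assume "k' \<in> homset (over_cat A G) P H \<and>
        (\<forall>a\<in>Obj A. \<forall>x\<in>At (Src P) a. \<forall>y\<in>At (Src Y) a. e a (app k' a x) y = f a x y)"
      then have k': "k' \<in> homset (over_cat A G) P H"
        and ef: "\<And>a x y. a \<in> Obj A \<Longrightarrow> x \<in> At (Src P) a \<Longrightarrow> y \<in> At (Src Y) a \<Longrightarrow> e a (app k' a x) y = f a x y"
        by auto
      show "k' = k"
      proof (rule over_arr_eqI[OF k' k])
        fix a x assume a: "a \<in> Obj A" and x: "x \<in> At (Src P) a"
        note v = app_in[OF k' a x]
        \<comment> \<open>A restriction along the identity is put in front so that
          \<open>R_eqI\<close> applies; \<open>R_Ide\<close> removes it afterwards.\<close>
        have "R (Ide A a) (d a (app k' a x)) = t a x"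
        proof (rule R_eqI[OF Ide_in_homset[OF a] t[OF a x]])
          show "fst (t a x) = Res (Und G) (Ide A a) (fst (d a (app k' a x)))"
            using Map_app[OF k' a x] by (simp add: G_Ide[OF a over_Map_in[OF P a x]] fst_t Map_H[OF a v])
          fix \<alpha> a' y assume \<alpha>: "\<alpha> \<in> homset A a' a" and y: "y \<in> At (Src Y) a'"
          have "snd (d a (app k' a x)) (\<alpha>, y) = e a' (app k' a' (Res (Src P) \<alpha> x)) y"
            by (simp add: e_Res[OF \<alpha> v y] app_Res[OF k' \<alpha> x])
          then show "snd (t a x) (\<alpha>, y) = snd (d a (app k' a x)) (Ide A a \<cdot> \<alpha>, y)"
            using ef[OF homset_Obj(1)[OF \<alpha>] over_Res_in[OF P \<alpha> x] y]
            by (simp add: snd_t[OF \<alpha> y] Cmp_Ide_left[OF \<alpha>])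
        qed
        then have "d a (app k' a x) = t a x"
          by (simp add: R_Ide[OF a d[OF a v]])
        then have "app k' a x = c a (t a x)"
          using cd[OF a v] by simp
        then show "app k' a x = app k a x"
          by (simp add: k_def app_mkarr a x)
      qed
    qed
  qed
  show ?thesis
    by (rule that[OF H e univ])
qed

text \<open>The variable factor comes first and is the twisted one, by the image of \<open>y\<close>
  in G: hence \<open>?l\<close> acts through \<open>y\<close> and \<open>?r\<close> changes nothing.
  Bimaps are then the arrows out of the twisted product, read on pairs.\<close>

lemma right_hom_exists:
  assumes small_A: "small TYPE('u) (Obj A)" "small TYPE('u) (Arr A)"
    and Y: "Y \<in> Obj (over_cat A G)" and Z: "Z \<in> Obj (over_cat A G)"
  shows "\<exists>H\<in>Obj (over_cat A G). \<exists>e\<in>homset (over_cat A G) (twist_obj A G H Y) Z.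
    \<forall>P\<in>Obj (over_cat A G). \<forall>f\<in>homset (over_cat A G) (twist_obj A G P Y) Z.
      \<exists>!k. k \<in> homset (over_cat A G) P H \<and>
        e \<cdot>\<^bsub>over_cat A G\<^esub> twist_arr A G k (Ide (over_cat A G) Y) = f"
proof -
  let ?l = "\<lambda>b g y \<phi>. Act G (Map Y b y) \<phi>" and ?r = "\<lambda>b g y \<phi>. \<phi>"
  let ?mul = "\<lambda>a g y. g \<otimes>\<^bsub>Grp G a\<^esub> Map Y a y"
  obtain H e where H: "H \<in> Obj (over_cat A G)" and e: "bimap ?l ?r ?mul H Y Z e"
    and univ: "\<And>P f. P \<in> Obj (over_cat A G) \<Longrightarrow> bimap ?l ?r ?mul P Y Z f \<Longrightarrow>
      \<exists>!k. k \<in> homset (over_cat A G) P H \<and>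
        (\<forall>a\<in>Obj A. \<forall>x\<in>At (Src P) a. \<forall>y\<in>At (Src Y) a. e a (app k a x) y = f a x y)"
    by (rule bimap_universal[OF small_A Y Z, of ?l ?r ?mul])
      (auto intro: Act_in_homset over_Map_in[OF Y] homset_Obj)
  define E where "E = mkarr A (twist_obj A G H Y) Z (\<lambda>a v. e a (vfst v) (vsnd v))"
  have E: "E \<in> homset (over_cat A G) (twist_obj A G H Y) Z"
    unfolding E_def
  proof (rule mkarr_in_homset[OF twist_in_Obj[OF H Y] Z])
    fix \<phi> a b v assume \<phi>: "\<phi> \<in> homset A a b" and "v \<in> At (Src (twist_obj A G H Y)) b"
    then show "e a (vfst (Res (Src (twist_obj A G H Y)) \<phi> v)) (vsnd (Res (Src (twist_obj A G H Y)) \<phi> v)) =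
        Res (Src Z) \<phi> (e b (vfst v) (vsnd v))"
      using homset_Obj[OF \<phi>] e by (auto simp: At_twist Res_twist[OF \<phi>] bimap_def)
  qed (use e in \<open>auto simp: At_twist Map_twist bimap_def\<close>)
  have app_E: "app E a (vpair x y) = e a x y"
    if "a \<in> Obj A" "x \<in> At (Src H) a" "y \<in> At (Src Y) a" for a x y
    using that by (simp add: E_def app_mkarr At_twist)
  have "\<exists>!k. k \<in> homset (over_cat A G) P H \<and>
      E \<cdot>\<^bsub>over_cat A G\<^esub> twist_arr A G k (Ide (over_cat A G) Y) = f"
    if P: "P \<in> Obj (over_cat A G)" and f: "f \<in> homset (over_cat A G) (twist_obj A G P Y) Z" for P f
  proof -
    have "bimap ?l ?r ?mul P Y Z (\<lambda>a x y. app f a (vpair x y))"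
      unfolding bimap_def
    proof (intro conjI ballI allI impI)
      fix a x y assume "a \<in> Obj A" "x \<in> At (Src P) a" "y \<in> At (Src Y) a"
      then show "app f a (vpair x y) \<in> At (Src Z) a"
        "Map Z a (app f a (vpair x y)) = Map P a x \<otimes>\<^bsub>Grp G a\<^esub> Map Y a y"
        using app_in[OF f, of a "vpair x y"] Map_app[OF f, of a "vpair x y"]
        by (simp_all add: At_twist Map_twist)
    next
      fix \<phi> a b x y assume \<phi>: "\<phi> \<in> homset A a b" and "x \<in> At (Src P) b" "y \<in> At (Src Y) b"
      then show "app f a (vpair (Res (Src P) (Act G (Map Y b y) \<phi>) x) (Res (Src Y) \<phi> y)) =
          Res (Src Z) \<phi> (app f b (vpair x y))"
        using app_Res[OF f \<phi>, of "vpair x y"] homset_Obj[OF \<phi>] by (simp add: At_twist Res_twist)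
    qed
    note ex1 = univ[OF P this]
    \<comment> \<open>Every element of the product is a pair, so for each \<open>k\<close> the
      elementwise condition and the equation between arrows are equivalent, and unique existence
      passes from one to the other.\<close>
    have "(\<forall>a\<in>Obj A. \<forall>x\<in>At (Src P) a. \<forall>y\<in>At (Src Y) a. e a (app k a x) y = app f a (vpair x y)) \<longleftrightarrow>
        E \<cdot>\<^bsub>over_cat A G\<^esub> twist_arr A G k (Ide (over_cat A G) Y) = f"
      if k: "k \<in> homset (over_cat A G) P H" for k
    proof -
      note I = O.Ide_in_homset[OF Y]
      note kI = twist_arr_in_homset[OF k I]
      have "app (E \<cdot>\<^bsub>over_cat A G\<^esub> twist_arr A G k (Ide (over_cat A G) Y)) a (vpair x y) = e a (app k a x) y"
        if "a \<in> Obj A" "x \<in> At (Src P) a" "y \<in> At (Src Y) a" for a x y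
        using that by (simp add: app_Cmp[OF kI E] At_twist app_twist_arr[OF k I] app_Ide app_E app_in[OF k])
      then show ?thesis
        by (auto simp: At_twist intro!: over_arr_eqI[OF O.Cmp_in_homset[OF kI E] f])
    qed
    then have "k \<in> homset (over_cat A G) P H \<and>
        (\<forall>a\<in>Obj A. \<forall>x\<in>At (Src P) a. \<forall>y\<in>At (Src Y) a. e a (app k a x) y = app f a (vpair x y)) \<longleftrightarrow>
        k \<in> homset (over_cat A G) P H \<and> E \<cdot>\<^bsub>over_cat A G\<^esub> twist_arr A G k (Ide (over_cat A G) Y) = f" for k
      by blast
    with ex1 show ?thesis
      by (simp only:)
  qed
  then show ?thesis
    using H E by blast
qed

text \<open>The variable factor now comes second: its own restrictions stay untwisted, while those
  of \<open>X\<close> are twisted by the group element \<open>g\<close> over which its element lies.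
  This is why the twists of \<open>bimap\<close> may depend on \<open>g\<close>. The variable factor
  is still the first argument of a bimap, hence the reversed order of \<open>x\<close> and
  \<open>y\<close>.\<close>

lemma left_hom_exists:
  assumes small_A: "small TYPE('u) (Obj A)" "small TYPE('u) (Arr A)"
    and X: "X \<in> Obj (over_cat A G)" and Z: "Z \<in> Obj (over_cat A G)"
  shows "\<exists>H\<in>Obj (over_cat A G). \<exists>e\<in>homset (over_cat A G) (twist_obj A G X H) Z.
    \<forall>P\<in>Obj (over_cat A G). \<forall>f\<in>homset (over_cat A G) (twist_obj A G X P) Z.
      \<exists>!k. k \<in> homset (over_cat A G) P H \<and>
        e \<cdot>\<^bsub>over_cat A G\<^esub> twist_arr A G (Ide (over_cat A G) X) k = f"
proof -
  let ?l = "\<lambda>b g x \<phi>. \<phi>" and ?r = "\<lambda>b g x \<phi>. Act G g \<phi>"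
  let ?mul = "\<lambda>a g x. Map X a x \<otimes>\<^bsub>Grp G a\<^esub> g"
  obtain H e where H: "H \<in> Obj (over_cat A G)" and e: "bimap ?l ?r ?mul H X Z e"
    and univ: "\<And>P f. P \<in> Obj (over_cat A G) \<Longrightarrow> bimap ?l ?r ?mul P X Z f \<Longrightarrow>
      \<exists>!k. k \<in> homset (over_cat A G) P H \<and>
        (\<forall>a\<in>Obj A. \<forall>y\<in>At (Src P) a. \<forall>x\<in>At (Src X) a. e a (app k a y) x = f a y x)"
    by (rule bimap_universal[OF small_A X Z, of ?l ?r ?mul]) (auto intro: Act_in_homset)
  define E where "E = mkarr A (twist_obj A G X H) Z (\<lambda>a v. e a (vsnd v) (vfst v))"
  have E: "E \<in> homset (over_cat A G) (twist_obj A G X H) Z"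
    unfolding E_def
  proof (rule mkarr_in_homset[OF twist_in_Obj[OF X H] Z])
    fix \<phi> a b v assume \<phi>: "\<phi> \<in> homset A a b" and "v \<in> At (Src (twist_obj A G X H)) b"
    then show "e a (vsnd (Res (Src (twist_obj A G X H)) \<phi> v)) (vfst (Res (Src (twist_obj A G X H)) \<phi> v)) =
        Res (Src Z) \<phi> (e b (vsnd v) (vfst v))"
      using homset_Obj[OF \<phi>] e by (auto simp: At_twist Res_twist[OF \<phi>] bimap_def)
  qed (use e in \<open>auto simp: At_twist Map_twist bimap_def\<close>)
  have app_E: "app E a (vpair x y) = e a y x"
    if "a \<in> Obj A" "x \<in> At (Src X) a" "y \<in> At (Src H) a" for a x y
    using that by (simp add: E_def app_mkarr At_twist)
  have "\<exists>!k. k \<in> homset (over_cat A G) P H \<and>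
      E \<cdot>\<^bsub>over_cat A G\<^esub> twist_arr A G (Ide (over_cat A G) X) k = f"
    if P: "P \<in> Obj (over_cat A G)" and f: "f \<in> homset (over_cat A G) (twist_obj A G X P) Z" for P f
  proof -
    have "bimap ?l ?r ?mul P X Z (\<lambda>a y x. app f a (vpair x y))"
      unfolding bimap_def
    proof (intro conjI ballI allI impI)
      fix a y x assume "a \<in> Obj A" "y \<in> At (Src P) a" "x \<in> At (Src X) a"
      then show "app f a (vpair x y) \<in> At (Src Z) a"
        "Map Z a (app f a (vpair x y)) = Map X a x \<otimes>\<^bsub>Grp G a\<^esub> Map P a y"
        using app_in[OF f, of a "vpair x y"] Map_app[OF f, of a "vpair x y"]
        by (simp_all add: At_twist Map_twist)
    next
      fix \<phi> a b y x assume \<phi>: "\<phi> \<in> homset A a b" and "y \<in> At (Src P) b" "x \<in> At (Src X) b"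
      then show "app f a (vpair (Res (Src X) (Act G (Map P b y) \<phi>) x) (Res (Src P) \<phi> y)) =
          Res (Src Z) \<phi> (app f b (vpair x y))"
        using app_Res[OF f \<phi>, of "vpair x y"] homset_Obj[OF \<phi>] by (simp add: At_twist Res_twist)
    qed
    note ex1 = univ[OF P this]
    have "(\<forall>a\<in>Obj A. \<forall>y\<in>At (Src P) a. \<forall>x\<in>At (Src X) a. e a (app k a y) x = app f a (vpair x y)) \<longleftrightarrow>
        E \<cdot>\<^bsub>over_cat A G\<^esub> twist_arr A G (Ide (over_cat A G) X) k = f"
      if k: "k \<in> homset (over_cat A G) P H" for k
    proof -
      note I = O.Ide_in_homset[OF X]
      note Ik = twist_arr_in_homset[OF I k]
      have "app (E \<cdot>\<^bsub>over_cat A G\<^esub> twist_arr A G (Ide (over_cat A G) X) k) a (vpair x y) = e a (app k a y) x"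
        if "a \<in> Obj A" "x \<in> At (Src X) a" "y \<in> At (Src P) a" for a x y
        using that by (simp add: app_Cmp[OF Ik E] At_twist app_twist_arr[OF I k] app_Ide app_E app_in[OF k])
      then show ?thesis
        by (auto simp: At_twist intro!: over_arr_eqI[OF O.Cmp_in_homset[OF Ik E] f])
    qed
    then have "k \<in> homset (over_cat A G) P H \<and>
        (\<forall>a\<in>Obj A. \<forall>y\<in>At (Src P) a. \<forall>x\<in>At (Src X) a. e a (app k a y) x = app f a (vpair x y)) \<longleftrightarrow>
        k \<in> homset (over_cat A G) P H \<and> E \<cdot>\<^bsub>over_cat A G\<^esub> twist_arr A G (Ide (over_cat A G) X) k = f" for k
      by blast
    with ex1 show ?thesis
      by (simp only:)
  qed
  then show ?thesis
    using H E by blast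
qed

end

theorem proposition4p4:
  fixes A :: "('o, 'm) cat"
    and G :: "('o, 'm, 'u::set_universe) crossed_grp"
  assumes "small_category TYPE('u) A"
    and "crossed_group A G"
  shows "terminal_object (presheaf_cat A) (terminal_psh A :: ('o, 'm, 'u) psh) \<and>
    monoidal_structure (over_cat A G) (twist A G) (unit_obj A G)
      (twist_assoc A G) (twist_lunit A G) (twist_runit A G) \<and>
    (\<exists>HomL HomR.
      is_functor (op_cat (over_cat A G) \<times>\<^sub>C over_cat A G) (over_cat A G) HomL \<and>
      is_functor (op_cat (over_cat A G) \<times>\<^sub>C over_cat A G) (over_cat A G) HomR \<and>
      naturally_isomorphic
        (op_cat (over_cat A G) \<times>\<^sub>C op_cat (over_cat A G) \<times>\<^sub>C over_cat A G) sets_cat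
        (hom_tensor (over_cat A G) (twist A G)) (hom_right (over_cat A G) HomR) \<and>
      naturally_isomorphic
        (op_cat (over_cat A G) \<times>\<^sub>C op_cat (over_cat A G) \<times>\<^sub>C over_cat A G) sets_cat
        (hom_right (over_cat A G) HomR) (hom_left (over_cat A G) HomL))"
proof -
  interpret category A
    using assms(1) by (simp add: small_category_def)
  interpret crossed_group A G
    by fact
  interpret crossed_group_category A G ..
  interpret O: category "over_cat A G"
    by (rule category_over)
  have small_A: "small TYPE('u) (Obj A)" "small TYPE('u) (Arr A)"
    using assms(1) small_if_eqpoll unfolding small_category_def by blast+
  show ?thesis
    using terminal_object_terminal_psh[OF category_axioms] monoidal_structure_twist
      O.biclosed_exists[OF is_functor_twist] right_hom_exists[OF small_A] left_hom_exists[OF small_A]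
    by simp
qed

end
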